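(* Let $r:\mathbb{R}^n\to\mathbb{R}^m$, $f(x)=\tfrac12\|r(x)\|^2$, $\epsilon\in(0,1]$, and let $(x_k)$ be the iterates generated by the DFO-GN algorithm (described in the context). Suppose that: (i) there is $c_1\in[1/2,1]$ independent of $k$ such that every trust-region step $s_k$ satisfies $m_k(0)-m_k(s_k)\ge c_1\|g_k\|\min\left(\Delta_k,\frac{\|g_k\|}{\max(\|H_k\|,1)}\right)$; (ii) $r$ is $C^1$ and, on $\mathcal{B}$, the convex hull of $\bigcup_k B(x_k,\Delta_{max})$, its Jacobian $J$ is Lipschitz continuous with constant $L_J$, and $\|r(x)\|\le r_{max}$ and $\|J(x)\|\le J_{max}$ for all $x\in\mathcal{B}$; (iii) there is $\kappa_H\ge1$ such that $\|H_k\|\le\kappa_H$ for all $k$; (iv) the algorithm parameter $\epsilon_C$ satisfies $\epsilon_C\ge c_3\epsilon$ for some constant $c_3>0$. Let $i_\epsilon$ be the last iteration before $\|\nabla f(x_{i_\epsilon+1})\|<\epsilon$ for the first time, and let $\kappa_d=\max(\kappa_{ef},\kappa_{eg})$. Then the number of iterations (i.e. the number of times a model $m_k$ is built, each pass of the loop in a criticality phase counting as a separate iteration) until $\|\nabla f(x_{i_\epsilon+1})\|<\epsilon$ is at most $O(\kappa_H\kappa_d^2\epsilon^{-2})$, and the number of objective evaluations (evaluations of $r$) until $i_\epsilon$ is at most $O(\kappa_H\kappa_d^2\,n\,\epsilon^{-2})$, where $\kappa_d=O(nL_J^2)$.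
   Context: **Notation.** $\|\cdot\|$ is the Euclidean norm for vectors and the largest singular value for matrices; $B(x,\Delta)=\{y\in\mathbb{R}^n:\|y-x\|\le\Delta\}$; $J(x)\in\mathbb{R}^{m\times n}$ is the Jacobian of $r$. **Model.** Given $x_k$ and an interpolation set $Y_k=\{y_0,\dots,y_n\}\subset\mathbb{R}^n$ with $y_0=x_k$ and $y_1-x_k,\dots,y_n-x_k$ linearly independent, $J_k\in\mathbb{R}^{m\times n}$ is the unique matrix with $J_k(y_t-x_k)=r(y_t)-r(x_k)$, $t=1,\dots,n$, and $m_k(s)=\tfrac12\|r(x_k)+J_ks\|^2=f(x_k)+g_k^Ts+\tfrac12 s^TH_ks$ with $g_k=J_k^Tr(x_k)$, $H_k=J_k^TJ_k$. **$\Lambda$-poisedness.** The Lagrange polynomials of $Y_k$ are the affine functions $\Lambda_0,\dots,\Lambda_n$ with $\Lambda_l(y_t)=\delta_{l,t}$. $Y_k$ is $\Lambda$-poised in $B$ if $Y_k\subset B$ and $\max_t\max_{x\in B}|\Lambda_t(x)|\le\Lambda$. **DFO-GN algorithm.** Inputs: $x_0\in\mathbb{R}^n$, $\Delta_0^{init}>0$. Parameters: $\Delta_{max}\ge\Delta_0^{init}$, $\epsilon_C>0$, $\mu>0$, $0<\gamma_{dec}<1<\gamma_{inc}\le\overline\gamma_{inc}$, $0<\alpha_1<\alpha_2<1$, $0<\eta_1\le\eta_2<1$, $0<\omega_S<1$, $0<\omega_C<1$, $0<\gamma_S<2c_1/(1+\sqrt{1+2c_1})$, $\Lambda\ge1$.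 Choose $Y_0$ of size $n+1$ with $x_0\in Y_0$; set $\rho_0^{init}=\Delta_0^{init}$. For $k=0,1,2,\dots$: 1. Build the model $m_k^{init}$ (with gradient $g_k^{init}$ at $0$) from $x_k,Y_k$. 2. If $\|g_k^{init}\|\le\epsilon_C$ ( *criticality phase* ): for $i=1,2,\dots$, modify $Y_k$ (keeping $x_k$) until it is $\Lambda$-poised in $B(x_k,\omega_C^{i-1}\Delta_k^{init})$, rebuild the model with gradient $g_k^{(i)}$, and stop as soon as $\omega_C^{i-1}\Delta_k^{init}\le\mu\|g_k^{(i)}\|$, returning the current $Y_k$, the current model as $m_k$, and $\Delta_k=\omega_C^{i-1}\Delta_k^{init}$; set $\rho_k=\min(\rho_k^{init},\Delta_k)$. Otherwise set $m_k=m_k^{init}$, $\Delta_k=\Delta_k^{init}$, $\rho_k=\rho_k^{init}$. 3. Compute a step $s_k$ with $\|s_k\|\le\Delta_k$ approximately minimizing $m_k$ over $\|s\|\le\Delta_k$. 4. If $\|s_k\|<\gamma_S\rho_k$ ( *safety phase* ): set $x_{k+1}=x_k$, $\Delta_{k+1}^{init}=\max(\rho_k,\omega_S\Delta_k)$, form $Y_{k+1}$ by making $Y_k$ $\Lambda$-poised in $B(x_{k+1},\Delta_{k+1}^{init})$; then if $\Delta_{k+1}^{init}=\rho_k$ reset $(\rho_{k+1}^{init},\Delta_{k+1}^{init})=(\alpha_1\rho_k,\alpha_2\rho_k)$, otherwise $\rho_{k+1}^{init}=\rho_k$. Go to iteration $k+1$. 5. Otherwise compute $r_k=\frac{f(x_k)-f(x_k+s_k)}{m_k(0)-m_k(s_k)}$.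 Set $x_{k+1}=x_k+s_k$ if $r_k\ge\eta_1$, else $x_{k+1}=x_k$. Set $\Delta_{k+1}^{init}=\min(\max(\gamma_{inc}\Delta_k,\overline\gamma_{inc}\|s_k\|),\Delta_{max})$ if $r_k\ge\eta_2$; $\max(\gamma_{dec}\Delta_k,\|s_k\|,\rho_k)$ if $\eta_1\le r_k<\eta_2$; $\max(\min(\gamma_{dec}\Delta_k,\|s_k\|),\rho_k)$ if $r_k<\eta_1$. 6. If $r_k\ge\eta_1$ ( *successful* ): $Y_{k+1}=Y_k\cup\{x_{k+1}\}\setminus\{y_t\}$ for some $y_t\in Y_k$, $\rho_{k+1}^{init}=\rho_k$. Else, if $Y_k$ is not $\Lambda$-poised in $B(x_k,\Delta_k)$ ( *model-improving* ): form $Y_{k+1}$ by making $Y_k$ $\Lambda$-poised in $B(x_{k+1},\Delta_{k+1}^{init})$, $\rho_{k+1}^{init}=\rho_k$. Else ( *unsuccessful* ): $Y_{k+1}=Y_k$, and if $\Delta_{k+1}^{init}=\rho_k$ reset $(\rho_{k+1}^{init},\Delta_{k+1}^{init})=(\alpha_1\rho_k,\alpha_2\rho_k)$, otherwise $\rho_{k+1}^{init}=\rho_k$. It is understood that all interpolation systems encountered are solvable and that every criticality phase reached terminates, so that an infinite sequence of iterations is generated. **Constants.** Let $L_{\nabla f}=r_{max}L_J+J_{max}^2$, $\kappa_{eg}^r=\tfrac12L_J(\sqrt n\,C+2)$, $\kappa_{eg}=L_{\nabla f}+\kappa_{eg}^rr_{max}+(\kappa_{eg}^r\Delta_{max}+J_{max})^2$,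 $\kappa_{ef}=\kappa_{eg}+\tfrac12\left(L_{\nabla f}+(\kappa_{eg}^r\Delta_{max}+J_{max})^2\right)$, where $C=O(\Lambda)$ is a uniform upper bound (over all $\Lambda$-poised sets $Y_k$ in $B(x_k,\Delta_k)$) on the norm of the inverse of the matrix with rows $(y_t-x_k)^T/\Delta_k$, $t=1,\dots,n$. With these constants, whenever $Y_k$ is $\Lambda$-poised in $B(x_k,\Delta_k)$ one has $|f(x_k+s)-m_k(s)|\le\kappa_{ef}\Delta_k^2$ and $\|\nabla f(x_k+s)-\nabla m_k(s)\|\le\kappa_{eg}\Delta_k$ for all $\|s\|\le\Delta_k$. **Conventions.** In the iteration and evaluation bounds, the constant hidden in $O(\cdot)$ may depend on the algorithm parameters, $c_1$, $c_3$, $\Delta_0^{init}$ and $f(x_0)$, but not on $\epsilon$, $n$, $\kappa_H$, $\kappa_d$ (leading order, with $\kappa_d$ bounded away from $0$). In $\kappa_d=O(nL_J^2)$ the hidden constant may depend on $r_{max}$, $J_{max}$, $\Delta_{max}$ and $C$, with $C$ regarded as independent of $n$ (leading order in $n$ and $L_J$). Each iteration (model build) changes at most $n+1$ points of the interpolation set, and $r$ is evaluated only at changed points, so an iteration is charged at most $n+1$ evaluations. *)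

theory Defs
  imports Complex_Main "Jordan_Normal_Form.VS_Connect" "Jordan_Normal_Form.Char_Poly"
begin

text \<open>
  The constants hidden in the complexity bounds must not depend on the dimension, so the dimensions
  \<open>n\<close> and \<open>m\<close> have to be quantified inside the statement. Hence the space of
  \<open>n\<close>-dimensional vectors is \<^term>\<open>carrier_vec n\<close> and the space of matrices with \<open>m\<close> rows
  and \<open>n\<close> columns is \<^term>\<open>carrier_mat m n\<close>, with real entries; functions on vectors are only
  meaningful on the carrier.
\<close>

section \<open>Norms, balls, convexity, derivatives\<close>

definition vec_norm :: "real vec \<Rightarrow> real" where
  "vec_norm v = sqrt (v \<bullet> v)"

text \<open>The largest singular value, a singular value of \<open>A\<close> being the nonnegative square root
  of an eigenvalue of \<open>A\<^sup>T * A\<close>.\<close>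

definition mat_norm :: "real mat \<Rightarrow> real" where
  "mat_norm A = Max {\<sigma>. 0 \<le> \<sigma> \<and> eigenvalue (A\<^sup>T * A) (\<sigma>\<^sup>2)}"

definition vball :: "nat \<Rightarrow> real vec \<Rightarrow> real \<Rightarrow> real vec set" where
  "vball n x D = {y \<in> carrier_vec n. vec_norm (y - x) \<le> D}"

definition vec_convex :: "real vec set \<Rightarrow> bool" where
  "vec_convex S \<longleftrightarrow>
     (\<forall>u\<in>S. \<forall>v\<in>S. \<forall>t. 0 \<le> t \<and> t \<le> 1 \<longrightarrow> (1 - t) \<cdot>\<^sub>v u + t \<cdot>\<^sub>v v \<in> S)"

definition has_jacobian ::
  "nat \<Rightarrow> nat \<Rightarrow> (real vec \<Rightarrow> real vec) \<Rightarrow> real mat \<Rightarrow> real vec \<Rightarrow> bool" where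
  "has_jacobian n m r A x \<longleftrightarrow> A \<in> carrier_mat m n \<and>
     (\<forall>e>0. \<exists>d>0. \<forall>y\<in>carrier_vec n. vec_norm (y - x) < d \<longrightarrow>
        vec_norm (r y - r x - A *\<^sub>v (y - x)) \<le> e * vec_norm (y - x))"

definition jacobian :: "nat \<Rightarrow> nat \<Rightarrow> (real vec \<Rightarrow> real vec) \<Rightarrow> real vec \<Rightarrow> real mat" where
  "jacobian n m r x = (THE A. has_jacobian n m r A x)"

definition C1_map :: "nat \<Rightarrow> nat \<Rightarrow> (real vec \<Rightarrow> real vec) \<Rightarrow> bool" where
  "C1_map n m r \<longleftrightarrow>
     (\<forall>x\<in>carrier_vec n. \<exists>A. has_jacobian n m r A x) \<and>
     (\<forall>x\<in>carrier_vec n. \<forall>e>0. \<exists>d>0. \<forall>y\<in>carrier_vec n. vec_norm (y - x) < d \<longrightarrow>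
        mat_norm (jacobian n m r y - jacobian n m r x) < e)"

definition has_gradient ::
  "nat \<Rightarrow> (real vec \<Rightarrow> real) \<Rightarrow> real vec \<Rightarrow> real vec \<Rightarrow> bool" where
  "has_gradient n f g x \<longleftrightarrow> g \<in> carrier_vec n \<and>
     (\<forall>e>0. \<exists>d>0. \<forall>y\<in>carrier_vec n. vec_norm (y - x) < d \<longrightarrow>
        \<bar>f y - f x - g \<bullet> (y - x)\<bar> \<le> e * vec_norm (y - x))"

definition gradient :: "nat \<Rightarrow> (real vec \<Rightarrow> real) \<Rightarrow> real vec \<Rightarrow> real vec" where
  "gradient n f x = (THE g. has_gradient n f g x)"

definition lsq :: "(real vec \<Rightarrow> real vec) \<Rightarrow> real vec \<Rightarrow> real" where
  "lsq r x = (vec_norm (r x))\<^sup>2 / 2"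

section \<open>Interpolation models and poisedness\<close>

definition interp_set :: "nat \<Rightarrow> real vec set \<Rightarrow> real vec \<Rightarrow> bool" where
  "interp_set n Y x \<longleftrightarrow> finite Y \<and> Y \<subseteq> carrier_vec n \<and> card Y = n + 1 \<and> x \<in> Y \<and>
     LinearCombinations.module.lin_indpt class_ring (module_vec TYPE(real) n)
       ((\<lambda>y. y - x) ` (Y - {x}))"

definition interp_jac ::
  "nat \<Rightarrow> nat \<Rightarrow> (real vec \<Rightarrow> real vec) \<Rightarrow> real vec \<Rightarrow> real vec set \<Rightarrow> real mat" where
  "interp_jac n m r x Y =
     (THE A. A \<in> carrier_mat m n \<and> (\<forall>y\<in>Y - {x}. A *\<^sub>v (y - x) = r y - r x))"

definition model_val ::
  "(real vec \<Rightarrow> real vec) \<Rightarrow> real vec \<Rightarrow> real mat \<Rightarrow> real vec \<Rightarrow> real" where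
  "model_val r x A s = (vec_norm (r x + A *\<^sub>v s))\<^sup>2 / 2"

definition model_grad :: "(real vec \<Rightarrow> real vec) \<Rightarrow> real vec \<Rightarrow> real mat \<Rightarrow> real vec" where
  "model_grad r x A = A\<^sup>T *\<^sub>v r x"

definition model_hess :: "real mat \<Rightarrow> real mat" where
  "model_hess A = A\<^sup>T * A"

definition affine_fun :: "nat \<Rightarrow> (real vec \<Rightarrow> real) \<Rightarrow> bool" where
  "affine_fun n p \<longleftrightarrow> (\<exists>c. \<exists>w\<in>carrier_vec n. \<forall>z\<in>carrier_vec n. p z = c + w \<bullet> z)"

definition lagrange_poly ::
  "nat \<Rightarrow> real vec set \<Rightarrow> real vec \<Rightarrow> (real vec \<Rightarrow> real) \<Rightarrow> bool" where
  "lagrange_poly n Y y p \<longleftrightarrow>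
     affine_fun n p \<and> (\<forall>z\<in>Y. p z = (if z = y then 1 else 0))"

text \<open>Poisedness is only used for sets satisfying \<^const>\<open>interp_set\<close>; on such a set each Lagrange
  polynomial exists and is unique as a function on \<^term>\<open>carrier_vec n\<close>.\<close>

definition lambda_poised :: "nat \<Rightarrow> real \<Rightarrow> real vec \<Rightarrow> real \<Rightarrow> real vec set \<Rightarrow> bool" where
  "lambda_poised n Lam x D Y \<longleftrightarrow> Y \<subseteq> vball n x D \<and>
     (\<forall>y\<in>Y. \<exists>p. lagrange_poly n Y y p \<and> (\<forall>z\<in>vball n x D. \<bar>p z\<bar> \<le> Lam))"

text \<open>\<open>C\<close> bounds the norm of the inverse of the scaled interpolation matrix, uniformly over all
  \<open>Lam\<close>-poised interpolation sets in balls around their base point.\<close>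

definition inverse_bound :: "nat \<Rightarrow> real \<Rightarrow> real \<Rightarrow> bool" where
  "inverse_bound n Lam C \<longleftrightarrow> 0 \<le> C \<and>
     (\<forall>x D ys V. 0 < D \<and> distinct ys \<and> x \<notin> set ys \<and> interp_set n (insert x (set ys)) x \<and>
        lambda_poised n Lam x D (insert x (set ys)) \<and> V \<in> carrier_mat n n \<and>
        inverts_mat (mat_of_rows n (map (\<lambda>y. (1 / D) \<cdot>\<^sub>v (y - x)) ys)) V \<and>
        inverts_mat V (mat_of_rows n (map (\<lambda>y. (1 / D) \<cdot>\<^sub>v (y - x)) ys))
        \<longrightarrow> mat_norm V \<le> C)"

section \<open>The DFO-GN algorithm\<close>

text \<open>The criticality threshold \<open>epsC\<close> is also an algorithm parameter, but it is kept out
  of this record: it is tied to the accuracy \<open>eps\<close> by \<open>epsC \<ge> c3 * eps\<close>, so the constants of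
  the complexity bounds must not depend on it except through \<open>c3\<close>.\<close>

record params =
  Delta_max :: real
  mu :: real
  gamma_dec :: real
  gamma_inc :: real
  gamma_inc_bar :: real
  alpha1 :: real
  alpha2 :: real
  eta1 :: real
  eta2 :: real
  omega_S :: real
  omega_C :: real
  gamma_S :: real
  Lambda :: real

definition valid_params :: "params \<Rightarrow> real \<Rightarrow> real \<Rightarrow> bool" where
  "valid_params P c1 D0 \<longleftrightarrow>
     0 < D0 \<and> D0 \<le> Delta_max P \<and> 0 < mu P \<and>
     0 < gamma_dec P \<and> gamma_dec P < 1 \<and> 1 < gamma_inc P \<and> gamma_inc P \<le> gamma_inc_bar P \<and>
     0 < alpha1 P \<and> alpha1 P < alpha2 P \<and> alpha2 P < 1 \<and>
     0 < eta1 P \<and> eta1 P \<le> eta2 P \<and> eta2 P < 1 \<and>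
     0 < omega_S P \<and> omega_S P < 1 \<and> 0 < omega_C P \<and> omega_C P < 1 \<and>
     0 < gamma_S P \<and> gamma_S P < 2 * c1 / (1 + sqrt (1 + 2 * c1)) \<and>
     1 \<le> Lambda P"

text \<open>
  A run of the algorithm. \<open>radius_init k\<close> and \<open>rho_init k\<close> are the values at the start of
  iteration \<open>k\<close>; \<open>ncrit k\<close> is the number of passes of the criticality loop in iteration \<open>k\<close>
  (\<open>0\<close> if the phase is not entered); \<open>Yset k 0\<close> is the interpolation set at the start of
  iteration \<open>k\<close> and \<open>Yset k i\<close> the one produced by the \<open>i\<close>-th pass.
\<close>

record run =
  iterate :: "nat \<Rightarrow> real vec"
  step :: "nat \<Rightarrow> real vec"
  radius_init :: "nat \<Rightarrow> real"
  rho_init :: "nat \<Rightarrow> real"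
  ncrit :: "nat \<Rightarrow> nat"
  Yset :: "nat \<Rightarrow> nat \<Rightarrow> real vec set"

definition crit_radius :: "params \<Rightarrow> run \<Rightarrow> nat \<Rightarrow> nat \<Rightarrow> real" where
  "crit_radius P R k i = omega_C P ^ (i - 1) * radius_init R k"

definition radius :: "params \<Rightarrow> run \<Rightarrow> nat \<Rightarrow> real" where
  "radius P R k =
     (if ncrit R k = 0 then radius_init R k else crit_radius P R k (ncrit R k))"

definition rho :: "params \<Rightarrow> run \<Rightarrow> nat \<Rightarrow> real" where
  "rho P R k = (if ncrit R k = 0 then rho_init R k else min (rho_init R k) (radius P R k))"

definition Yfin :: "run \<Rightarrow> nat \<Rightarrow> real vec set" where
  "Yfin R k = Yset R k (ncrit R k)"

definition crit_grad ::
  "nat \<Rightarrow> nat \<Rightarrow> (real vec \<Rightarrow> real vec) \<Rightarrow> run \<Rightarrow> nat \<Rightarrow> nat \<Rightarrow> real vec" where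
  "crit_grad n m r R k i =
     model_grad r (iterate R k) (interp_jac n m r (iterate R k) (Yset R k i))"

definition Jmod :: "nat \<Rightarrow> nat \<Rightarrow> (real vec \<Rightarrow> real vec) \<Rightarrow> run \<Rightarrow> nat \<Rightarrow> real mat" where
  "Jmod n m r R k = interp_jac n m r (iterate R k) (Yfin R k)"

definition gmod :: "nat \<Rightarrow> nat \<Rightarrow> (real vec \<Rightarrow> real vec) \<Rightarrow> run \<Rightarrow> nat \<Rightarrow> real vec" where
  "gmod n m r R k = model_grad r (iterate R k) (Jmod n m r R k)"

definition Hmod :: "nat \<Rightarrow> nat \<Rightarrow> (real vec \<Rightarrow> real vec) \<Rightarrow> run \<Rightarrow> nat \<Rightarrow> real mat" where
  "Hmod n m r R k = model_hess (Jmod n m r R k)"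

definition model_decrease ::
  "nat \<Rightarrow> nat \<Rightarrow> (real vec \<Rightarrow> real vec) \<Rightarrow> run \<Rightarrow> nat \<Rightarrow> real" where
  "model_decrease n m r R k =
     model_val r (iterate R k) (Jmod n m r R k) (0\<^sub>v n)
       - model_val r (iterate R k) (Jmod n m r R k) (step R k)"

definition ratio :: "nat \<Rightarrow> nat \<Rightarrow> (real vec \<Rightarrow> real vec) \<Rightarrow> run \<Rightarrow> nat \<Rightarrow> real" where
  "ratio n m r R k =
     (lsq r (iterate R k) - lsq r (iterate R k + step R k)) / model_decrease n m r R k"

definition is_safety :: "params \<Rightarrow> run \<Rightarrow> nat \<Rightarrow> bool" where
  "is_safety P R k \<longleftrightarrow> vec_norm (step R k) < gamma_S P * rho P R k"

definition criticality_phase ::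
  "nat \<Rightarrow> nat \<Rightarrow> (real vec \<Rightarrow> real vec) \<Rightarrow> params \<Rightarrow> real \<Rightarrow> run \<Rightarrow> nat \<Rightarrow> bool" where
  "criticality_phase n m r P epsC R k \<longleftrightarrow>
     (if vec_norm (crit_grad n m r R k 0) \<le> epsC
      then 1 \<le> ncrit R k \<and>
        (\<forall>i\<in>{1..ncrit R k}.
           lambda_poised n (Lambda P) (iterate R k) (crit_radius P R k i) (Yset R k i) \<and>
           (crit_radius P R k i \<le> mu P * vec_norm (crit_grad n m r R k i)
              \<longleftrightarrow> i = ncrit R k))
      else ncrit R k = 0)"

text \<open>The assignments to \<open>rho\<close> and the radius that end safety and unsuccessful iterations, from
  the tentative new radius \<open>D\<close>.\<close>

definition reset_or_keep :: "params \<Rightarrow> run \<Rightarrow> nat \<Rightarrow> real \<Rightarrow> bool" where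
  "reset_or_keep P R k D \<longleftrightarrow>
     (if D = rho P R k
      then rho_init R (Suc k) = alpha1 P * rho P R k \<and>
           radius_init R (Suc k) = alpha2 P * rho P R k
      else rho_init R (Suc k) = rho P R k \<and> radius_init R (Suc k) = D)"

definition safety_update :: "nat \<Rightarrow> params \<Rightarrow> run \<Rightarrow> nat \<Rightarrow> bool" where
  "safety_update n P R k \<longleftrightarrow>
     (let D = max (rho P R k) (omega_S P * radius P R k) in
       iterate R (Suc k) = iterate R k \<and>
       lambda_poised n (Lambda P) (iterate R (Suc k)) D (Yset R (Suc k) 0) \<and>
       reset_or_keep P R k D)"

definition tr_radius ::
  "nat \<Rightarrow> nat \<Rightarrow> (real vec \<Rightarrow> real vec) \<Rightarrow> params \<Rightarrow> run \<Rightarrow> nat \<Rightarrow> real" where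
  "tr_radius n m r P R k =
     (if ratio n m r R k \<ge> eta2 P
      then min (max (gamma_inc P * radius P R k) (gamma_inc_bar P * vec_norm (step R k)))
             (Delta_max P)
      else if ratio n m r R k \<ge> eta1 P
      then max (max (gamma_dec P * radius P R k) (vec_norm (step R k))) (rho P R k)
      else max (min (gamma_dec P * radius P R k) (vec_norm (step R k))) (rho P R k))"

text \<open>In a successful iteration the new set is formed by removing \<open>y\<close> and then inserting the new
  iterate; this agrees with inserting first whenever the new iterate is not already in the set,
  and otherwise lets the set be kept.\<close>

definition tr_update ::
  "nat \<Rightarrow> nat \<Rightarrow> (real vec \<Rightarrow> real vec) \<Rightarrow> params \<Rightarrow> run \<Rightarrow> nat \<Rightarrow> bool" where
  "tr_update n m r P R k \<longleftrightarrow>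
     (let D = tr_radius n m r P R k in
       if ratio n m r R k \<ge> eta1 P
       then iterate R (Suc k) = iterate R k + step R k \<and>
            (\<exists>y\<in>Yfin R k. Yset R (Suc k) 0 = insert (iterate R (Suc k)) (Yfin R k - {y})) \<and>
            rho_init R (Suc k) = rho P R k \<and> radius_init R (Suc k) = D
       else iterate R (Suc k) = iterate R k \<and>
         (if \<not> lambda_poised n (Lambda P) (iterate R k) (radius P R k) (Yfin R k)
          then lambda_poised n (Lambda P) (iterate R (Suc k)) D (Yset R (Suc k) 0) \<and>
               rho_init R (Suc k) = rho P R k \<and> radius_init R (Suc k) = D
          else Yset R (Suc k) 0 = Yfin R k \<and> reset_or_keep P R k D))"

text \<open>An infinite run: every interpolation system encountered is solvable and every criticality
  phase ends after finitely many passes. Where a set is ``made poised'', the new set is arbitrary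
  apart from being poised and containing the current iterate.\<close>

definition dfogn_run ::
  "nat \<Rightarrow> nat \<Rightarrow> (real vec \<Rightarrow> real vec) \<Rightarrow> params \<Rightarrow> real \<Rightarrow> real \<Rightarrow> run \<Rightarrow> bool" where
  "dfogn_run n m r P epsC D0 R \<longleftrightarrow>
     radius_init R 0 = D0 \<and> rho_init R 0 = D0 \<and>
     (\<forall>k. iterate R k \<in> carrier_vec n \<and>
          (\<forall>i\<le>ncrit R k. interp_set n (Yset R k i) (iterate R k)) \<and>
          criticality_phase n m r P epsC R k \<and>
          step R k \<in> carrier_vec n \<and> vec_norm (step R k) \<le> radius P R k \<and>
          (if is_safety P R k then safety_update n P R k else tr_update n m r P R k))"

definition cauchy_decrease ::
  "nat \<Rightarrow> nat \<Rightarrow> (real vec \<Rightarrow> real vec) \<Rightarrow> params \<Rightarrow> real \<Rightarrow> run \<Rightarrow> bool" where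
  "cauchy_decrease n m r P c1 R \<longleftrightarrow>
     (\<forall>k. model_decrease n m r R k \<ge> c1 * vec_norm (gmod n m r R k) *
        min (radius P R k) (vec_norm (gmod n m r R k) / max (mat_norm (Hmod n m r R k)) 1))"

definition region :: "nat \<Rightarrow> params \<Rightarrow> run \<Rightarrow> real vec set" where
  "region n P R = vec_convex hull (\<Union>k. vball n (iterate R k) (Delta_max P))"

definition smooth_bounded ::
  "nat \<Rightarrow> nat \<Rightarrow> (real vec \<Rightarrow> real vec) \<Rightarrow> params \<Rightarrow> run \<Rightarrow> real \<Rightarrow> real \<Rightarrow> real \<Rightarrow> bool" where
  "smooth_bounded n m r P R LJ rmax Jmax \<longleftrightarrow>
     C1_map n m r \<and> 0 \<le> LJ \<and>
     (\<forall>x\<in>region n P R. \<forall>y\<in>region n P R.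
        mat_norm (jacobian n m r x - jacobian n m r y) \<le> LJ * vec_norm (x - y)) \<and>
     (\<forall>x\<in>region n P R. vec_norm (r x) \<le> rmax \<and> mat_norm (jacobian n m r x) \<le> Jmax)"

section \<open>Constants and complexity measures\<close>

definition L_grad :: "real \<Rightarrow> real \<Rightarrow> real \<Rightarrow> real" where
  "L_grad LJ rmax Jmax = rmax * LJ + Jmax\<^sup>2"

definition kappa_eg_r :: "nat \<Rightarrow> real \<Rightarrow> real \<Rightarrow> real" where
  "kappa_eg_r n C LJ = 1 / 2 * LJ * (sqrt (real n) * C + 2)"

definition kappa_eg :: "nat \<Rightarrow> real \<Rightarrow> real \<Rightarrow> real \<Rightarrow> real \<Rightarrow> real \<Rightarrow> real" where
  "kappa_eg n C Dmax LJ rmax Jmax =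
     L_grad LJ rmax Jmax + kappa_eg_r n C LJ * rmax + (kappa_eg_r n C LJ * Dmax + Jmax)\<^sup>2"

definition kappa_ef :: "nat \<Rightarrow> real \<Rightarrow> real \<Rightarrow> real \<Rightarrow> real \<Rightarrow> real \<Rightarrow> real" where
  "kappa_ef n C Dmax LJ rmax Jmax =
     kappa_eg n C Dmax LJ rmax Jmax +
     1 / 2 * (L_grad LJ rmax Jmax + (kappa_eg_r n C LJ * Dmax + Jmax)\<^sup>2)"

definition kappa_d :: "nat \<Rightarrow> real \<Rightarrow> real \<Rightarrow> real \<Rightarrow> real \<Rightarrow> real \<Rightarrow> real" where
  "kappa_d n C Dmax LJ rmax Jmax =
     max (kappa_ef n C Dmax LJ rmax Jmax) (kappa_eg n C Dmax LJ rmax Jmax)"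

definition small_grad :: "nat \<Rightarrow> (real vec \<Rightarrow> real vec) \<Rightarrow> run \<Rightarrow> real \<Rightarrow> nat \<Rightarrow> bool" where
  "small_grad n r R eps k \<longleftrightarrow> vec_norm (gradient n (lsq r) (iterate R k)) < eps"

text \<open>The index \<open>i\<^sub>\<epsilon> + 1\<close>: iterations \<open>0, \<dots>, i\<^sub>\<epsilon>\<close> are those with index below it
  (none if the gradient is already small at the starting point).\<close>

definition first_small :: "nat \<Rightarrow> (real vec \<Rightarrow> real vec) \<Rightarrow> run \<Rightarrow> real \<Rightarrow> nat" where
  "first_small n r R eps = (LEAST k. small_grad n r R eps k)"

text \<open>The number of models built in the iterations with index below \<open>N\<close>: the initial one of each
  iteration and one for each pass of its criticality loop.\<close>

definition num_iterations :: "run \<Rightarrow> nat \<Rightarrow> nat" where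
  "num_iterations R N = (\<Sum>k<N. 1 + ncrit R k)"

text \<open>The number of evaluations of \<open>r\<close> before the end of the last iteration with index below
  \<open>N\<close>: at the points of the initial set, at the points changed by each criticality pass, and
  at the points changed at the end of the iteration, including the trial point whenever the
  ratio is computed, even if that point is then rejected.\<close>

definition num_evaluations :: "params \<Rightarrow> run \<Rightarrow> nat \<Rightarrow> nat" where
  "num_evaluations P R N = card (Yset R 0 0) +
     (\<Sum>k<N. (\<Sum>i<ncrit R k. card (Yset R k (Suc i) - Yset R k i)) +
        card ((if is_safety P R k then Yset R (Suc k) 0
               else insert (iterate R k + step R k) (Yset R (Suc k) 0)) - Yfin R k))"

end

theory Submission
  imports Defs "HOL-Analysis.L2_Norm" "Jordan_Normal_Form.DL_Rank" "Jordan_Normal_Form.Spectral_Radius"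
begin

text \<open>
  While the gradient of \<open>f\<close> is at least \<open>eps\<close>, the criticality phase keeps the model gradient at least
  of order \<open>eps / \<kappa>\<^sub>d\<close>. A trust region that is small compared with the model gradient yields a successful
  step once the interpolation set is poised, so the radii stay above a multiple of
  \<open>z = eps / (\<kappa>\<^sub>H \<kappa>\<^sub>d\<^sup>2)\<close>, and each successful step decreases \<open>f\<close> by a multiple of \<open>eps * z\<close>.
  As \<open>f\<close> is nonnegative, this bounds the number of successful steps. The logarithm of the radius
  bounds the safety and unsuccessful steps and the repeated criticality passes in terms of the
  successful steps, and two model-improving steps never follow each other.
\<close>

section \<open>Vector and matrix norms\<close>

text \<open>The hidden constants have to be chosen before the dimension, the accuracy and the
  problem data. Each is therefore an explicit term in \<open>P\<close>, \<open>c1\<close>,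
  \<open>c3\<close>, \<open>D0\<close>, \<open>f0\<close> and a lower bound \<open>d0\<close> on
  \<open>kappa_d\<close>; with \<open>d0\<close> one trades surplus factors of
  \<open>kappa_d\<close> and absorbs additive constants. The square of \<open>kappa_d\<close> has
  two sources: the model gradient may fall to the order of \<open>eps / kappa_d\<close>, and a
  rejected step on a poised set only shows that the radius is not small compared with that gradient
  divided by \<open>kappa_d\<close> or \<open>kappaH\<close>. Up to constants, \<open>z\<close> lies
  below both resulting radii. The number of successful steps is of order
  \<open>1 / (eps * z)\<close>, which is the claimed bound. The logarithmic terms need no care:
  \<open>ln t < t\<close> keeps them within that order. Taylor estimates are reduced to functions of
  one real variable by testing \<open>r\<close> against a fixed vector along a segment.\<close>

lemma vec_norm_eq_L2_set: "vec_norm v = L2_set (($) v) {0..<dim_vec v}"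
  by (simp add: vec_norm_def L2_set_def scalar_prod_def power2_eq_square)

lemma scalar_prod_self_nonneg: "0 \<le> v \<bullet> (v :: real vec)"
  by (simp add: scalar_prod_def sum_nonneg)

lemma vec_norm_nonneg [simp]: "0 \<le> vec_norm v"
  by (simp add: vec_norm_def scalar_prod_self_nonneg)

lemma vec_norm_power2: "(vec_norm v)\<^sup>2 = v \<bullet> v"
  by (simp add: vec_norm_def scalar_prod_self_nonneg)

lemma scalar_prod_le_vec_norm:
  assumes "u \<in> carrier_vec n" "v \<in> carrier_vec n"
  shows "\<bar>u \<bullet> v\<bar> \<le> vec_norm u * vec_norm v"
proof -
  have "\<bar>u \<bullet> v\<bar> \<le> (\<Sum>i = 0..<n. \<bar>u $ i\<bar> * \<bar>v $ i\<bar>)"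
    using assms by (auto simp: scalar_prod_def abs_mult intro: order_trans[OF sum_abs])
  also have "\<dots> \<le> vec_norm u * vec_norm v"
    using assms L2_set_mult_ineq by (auto simp: vec_norm_eq_L2_set)
  finally show ?thesis .
qed

lemma vec_norm_triangle:
  assumes "u \<in> carrier_vec n" "v \<in> carrier_vec n"
  shows "vec_norm (u + v) \<le> vec_norm u + vec_norm v"
proof -
  have "vec_norm (u + v) = L2_set (\<lambda>i. u $ i + v $ i) {0..<n}"
    unfolding vec_norm_eq_L2_set using assms by (intro L2_set_cong) auto
  then show ?thesis
    using L2_set_triangle_ineq[of "($) u" "($) v" "{0..<n}"] assms by (simp add: vec_norm_eq_L2_set)
qed

lemma vec_norm_smult: "vec_norm (a \<cdot>\<^sub>v v) = \<bar>a\<bar> * vec_norm v"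
proof -
  have "(a \<cdot>\<^sub>v v) \<bullet> (a \<cdot>\<^sub>v v) = a\<^sup>2 * (v \<bullet> v)"
    by (simp add: scalar_prod_def sum_distrib_left power2_eq_square algebra_simps)
  then show ?thesis by (simp add: vec_norm_def real_sqrt_mult)
qed

lemma vec_norm_minus_commute:
  assumes "u \<in> carrier_vec n" "v \<in> carrier_vec n"
  shows "vec_norm (u - v) = vec_norm (v - u)"
proof -
  have "v - u = (-1) \<cdot>\<^sub>v (u - v)" using assms by auto
  then show ?thesis by (metis abs_minus_cancel abs_one mult_1 vec_norm_smult)
qed

lemma vec_norm_triangle_minus:
  assumes "u \<in> carrier_vec n" "v \<in> carrier_vec n"
  shows "vec_norm (u - v) \<le> vec_norm u + vec_norm v"
proof -
  have "u - v = u + (-1) \<cdot>\<^sub>v v" using assms by auto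
  then show ?thesis using vec_norm_triangle[of u n "(-1) \<cdot>\<^sub>v v"] assms by (simp add: vec_norm_smult)
qed

lemma vec_norm_zero [simp]: "vec_norm (0\<^sub>v n) = 0"
  by (simp add: vec_norm_def scalar_prod_def)

lemma vec_norm_eq_0D:
  assumes "v \<in> carrier_vec n" "vec_norm v = 0"
  shows "v = 0\<^sub>v n"
proof -
  have "\<forall>i\<in>{0..<n}. v $ i = 0"
    using assms L2_set_eq_0_iff[of "{0..<n}" "($) v"] by (simp add: vec_norm_eq_L2_set)
  then show ?thesis using assms by auto
qed

text \<open>Cauchy-Schwarz in each of the \<open>k\<close> components. Applied to the
  \<open>n\<close> interpolation conditions, it is the source of the factor
  \<open>sqrt (real n)\<close> in \<open>kappa_eg_r\<close>.\<close>

lemma vec_norm_mult_mat_le_rows: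
  assumes A: "A \<in> carrier_mat k n" and v: "v \<in> carrier_vec n"
    and rows: "\<And>i. i < k \<Longrightarrow> vec_norm (row A i) \<le> b" and b: "0 \<le> b"
  shows "vec_norm (A *\<^sub>v v) \<le> sqrt (real k) * b * vec_norm v"
proof -
  have "vec_norm (A *\<^sub>v v) = L2_set (\<lambda>i. \<bar>row A i \<bullet> v\<bar>) {0..<k}"
    using A by (simp add: vec_norm_eq_L2_set L2_set_def)
  also have "\<dots> \<le> L2_set (\<lambda>i. b * vec_norm v) {0..<k}"
  proof (rule L2_set_mono)
    fix i assume "i \<in> {0..<k}"
    then have "\<bar>row A i \<bullet> v\<bar> \<le> vec_norm (row A i) * vec_norm v" "vec_norm (row A i) \<le> b"
      using A v rows by (auto intro!: scalar_prod_le_vec_norm)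
    then show "\<bar>row A i \<bullet> v\<bar> \<le> b * vec_norm v"
      by (meson mult_right_mono order_trans vec_norm_nonneg)
  qed auto
  also have "\<dots> = sqrt (real k) * b * vec_norm v"
    using b by (simp add: L2_set_constant abs_mult)
  finally show ?thesis .
qed

text \<open>A crude operator bound, obtained before \<open>mat_norm\<close> is known to be one; the
  finiteness of the supremum below and the limit arguments rely on it.\<close>

lemma mult_mat_vec_bounded:
  obtains c where "0 \<le> c"
    "\<And>v. v \<in> carrier_vec (dim_col A) \<Longrightarrow> vec_norm (A *\<^sub>v v) \<le> c * vec_norm v"
proof -
  define b where "b = (\<Sum>i<dim_row A. vec_norm (row A i))"
  have b: "0 \<le> b" by (simp add: b_def sum_nonneg)
  have "vec_norm (row A i) \<le> b" if "i < dim_row A" for i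
    unfolding b_def using that by (intro member_le_sum) auto
  then have "vec_norm (A *\<^sub>v v) \<le> sqrt (real (dim_row A)) * b * vec_norm v"
    if "v \<in> carrier_vec (dim_col A)" for v
    using vec_norm_mult_mat_le_rows[of A "dim_row A" "dim_col A" v b] that b by auto
  with b show thesis by (intro that[of "sqrt (real (dim_row A)) * b"]) auto
qed

section \<open>Transposes, inverses and the largest singular value\<close>

lemma quad_form_mult_mat:
  assumes "(A :: real mat) \<in> carrier_mat m n" "u \<in> carrier_vec n" "v \<in> carrier_vec n"
  shows "u \<bullet> ((A\<^sup>T * A) *\<^sub>v v) = (A *\<^sub>v u) \<bullet> (A *\<^sub>v v)"
proof -
  have "u \<bullet> ((A\<^sup>T * A) *\<^sub>v v) = (A\<^sup>T *\<^sub>v (A *\<^sub>v v)) \<bullet> u"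
    using assms by (simp add: comm_scalar_prod[of u n] assoc_mult_mat_vec[of "A\<^sup>T" n m A n v])
  also have "\<dots> = (A *\<^sub>v v) \<bullet> (A *\<^sub>v u)"
    using assms by (simp add: transpose_vec_mult_scalar)
  finally show ?thesis using assms by (simp add: comm_scalar_prod[of "A *\<^sub>v u" m])
qed

text \<open>The squared norm of \<open>A\<^sup>T *\<^sub>v w\<close> is the product of
  \<open>w\<close> with \<open>A\<close> applied to that vector, so one factor cancels. Bounds thus
  pass to the transpose without a comparison of spectra.\<close>

lemma transpose_vec_norm_le:
  assumes A: "A \<in> carrier_mat m n" and w: "w \<in> carrier_vec m"
    and le: "\<And>v. v \<in> carrier_vec n \<Longrightarrow> vec_norm (A *\<^sub>v v) \<le> c * vec_norm v" and c: "0 \<le> c"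
  shows "vec_norm (A\<^sup>T *\<^sub>v w) \<le> c * vec_norm w"
proof -
  let ?z = "A\<^sup>T *\<^sub>v w"
  have z: "?z \<in> carrier_vec n" using A w by auto
  have "(vec_norm ?z)\<^sup>2 = w \<bullet> (A *\<^sub>v ?z)"
    unfolding vec_norm_power2 using transpose_vec_mult_scalar[OF A z w] .
  also have "\<dots> \<le> vec_norm w * vec_norm (A *\<^sub>v ?z)"
    using scalar_prod_le_vec_norm[of w m "A *\<^sub>v ?z"] A w z by auto
  also have "\<dots> \<le> vec_norm w * (c * vec_norm ?z)"
    using le[OF z] by (intro mult_left_mono) auto
  finally have "vec_norm ?z * vec_norm ?z \<le> (c * vec_norm w) * vec_norm ?z"
    by (simp add: power2_eq_square mult_ac)
  then show ?thesis using c by (cases "vec_norm ?z = 0") (auto simp: less_le)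
qed

lemma mat_inverseE:
  assumes "(A :: real mat) \<in> carrier_mat n n" "det A \<noteq> 0"
  obtains B where "B \<in> carrier_mat n n" "A * B = 1\<^sub>m n" "B * A = 1\<^sub>m n"
  using det_non_zero_imp_unit[OF assms]
  by (auto simp: Units_def ring_mat_def)

text \<open>For \<open>M = sup {\<bar>A v\<bar>\<^sup>2 | \<bar>v\<bar> = 1}\<close> the matrix \<open>B = M I - A\<^sup>T A\<close> is positive
  semidefinite, and \<open>\<bar>B v\<bar>\<^sup>2 \<le> M (M - \<bar>A v\<bar>\<^sup>2)\<close> on unit vectors. An invertible \<open>B\<close> would
  thus keep \<open>\<bar>A v\<bar>\<^sup>2\<close> away from \<open>M\<close>, so \<open>M\<close> is an eigenvalue; this replaces compactness of the
  unit sphere.\<close>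

lemma singular_value_boundE:
  assumes A: "A \<in> carrier_mat m n" and n: "1 \<le> n"
  obtains s where "0 \<le> s" "eigenvalue (A\<^sup>T * A) (s\<^sup>2)"
    "\<And>v. v \<in> carrier_vec n \<Longrightarrow> vec_norm (A *\<^sub>v v) \<le> s * vec_norm v"
proof -
  define S where "S = {v \<in> carrier_vec n. vec_norm v = 1}"
  define M where "M = (SUP v\<in>S. (vec_norm (A *\<^sub>v v))\<^sup>2)"
  define B where "B = M \<cdot>\<^sub>m 1\<^sub>m n - A\<^sup>T * A"
  have B: "B \<in> carrier_mat n n" using A by (auto simp: B_def)
  obtain c where c: "0 \<le> c" "\<And>v. v \<in> carrier_vec n \<Longrightarrow> vec_norm (A *\<^sub>v v) \<le> c * vec_norm v"
    using mult_mat_vec_bounded[of A] A by auto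
  have "unit_vec n 0 \<in> S" using n by (simp add: S_def vec_norm_def)
  then have ne: "S \<noteq> {}" by auto
  have bdd: "bdd_above ((\<lambda>v. (vec_norm (A *\<^sub>v v))\<^sup>2) ` S)"
  proof (rule bdd_aboveI2)
    fix v assume "v \<in> S"
    then have "vec_norm (A *\<^sub>v v) \<le> c" using c(2)[of v] by (auto simp: S_def)
    then show "(vec_norm (A *\<^sub>v v))\<^sup>2 \<le> c\<^sup>2" by (simp add: power_mono)
  qed
  have M0: "0 \<le> M"
    using cSUP_upper2[OF bdd, of _ 0] ne by (auto simp: M_def)
  have unit: "(vec_norm (A *\<^sub>v v))\<^sup>2 \<le> M" if "v \<in> S" for v
    unfolding M_def using that bdd by (intro cSUP_upper)
  have le: "(vec_norm (A *\<^sub>v v))\<^sup>2 \<le> M * (vec_norm v)\<^sup>2" if v: "v \<in> carrier_vec n" for v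
  proof (cases "vec_norm v = 0")
    case True
    then show ?thesis using c(2)[OF v] vec_norm_nonneg[of "A *\<^sub>v v"] by (simp add: le_less_trans order_antisym)
  next
    case False
    define u where "u = (1 / vec_norm v) \<cdot>\<^sub>v v"
    have "u \<in> S" using v False by (simp add: S_def u_def vec_norm_smult)
    moreover have "A *\<^sub>v u = (1 / vec_norm v) \<cdot>\<^sub>v (A *\<^sub>v v)"
      unfolding u_def using A v by (rule mult_mat_vec)
    ultimately have "(1 / vec_norm v)\<^sup>2 * (vec_norm (A *\<^sub>v v))\<^sup>2 \<le> M"
      using unit[of u] by (simp add: vec_norm_smult power_mult_distrib power_divide)
    then show ?thesis using False by (simp add: field_simps)
  qed
  have Bv: "B *\<^sub>v v = M \<cdot>\<^sub>v v - (A\<^sup>T * A) *\<^sub>v v" if "v \<in> carrier_vec n" for v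
    unfolding B_def using A that
    by (subst minus_mult_distrib_mat_vec[of _ n n]) (auto intro!: eq_vecI)
  have Buv: "u \<bullet> (B *\<^sub>v v) = M * (u \<bullet> v) - (A *\<^sub>v u) \<bullet> (A *\<^sub>v v)"
    if "u \<in> carrier_vec n" "v \<in> carrier_vec n" for u v
    unfolding Bv[OF that(2)] using quad_form_mult_mat[OF A that] that A
    by (subst scalar_prod_minus_distrib[of _ n])
      (auto simp del: assoc_mult_mat_vec intro!: mult_mat_vec_carrier[of _ n n])
  have q: "v \<bullet> (B *\<^sub>v v) = M * (vec_norm v)\<^sup>2 - (vec_norm (A *\<^sub>v v))\<^sup>2"
    if "v \<in> carrier_vec n" for v
    using Buv[OF that that] by (simp add: vec_norm_power2)
  have q0: "0 \<le> v \<bullet> (B *\<^sub>v v)" if "v \<in> carrier_vec n" for v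
    using q[OF that] le[OF that] by simp
  have sym: "u \<bullet> (B *\<^sub>v v) = v \<bullet> (B *\<^sub>v u)" if "u \<in> carrier_vec n" "v \<in> carrier_vec n" for u v
    using that A by (simp add: Buv comm_scalar_prod[of u n v] comm_scalar_prod[of "A *\<^sub>v u" m])
  \<comment> \<open>Cauchy-Schwarz for the semidefinite form of \<open>B\<close>: the polynomial
    \<open>poly\<close> in \<open>t\<close> never becomes negative.\<close>
  have CS: "(u \<bullet> (B *\<^sub>v v))\<^sup>2 \<le> (u \<bullet> (B *\<^sub>v u)) * (v \<bullet> (B *\<^sub>v v))"
    if u: "u \<in> carrier_vec n" and v: "v \<in> carrier_vec n" for u v
  proof -
    have poly: "0 \<le> u \<bullet> (B *\<^sub>v u) + 2 * t * (u \<bullet> (B *\<^sub>v v)) + t\<^sup>2 * (v \<bullet> (B *\<^sub>v v))" for t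
    proof -
      let ?w = "u + t \<cdot>\<^sub>v v"
      have w: "?w \<in> carrier_vec n" using u v by auto
      have e: "B *\<^sub>v ?w = B *\<^sub>v u + t \<cdot>\<^sub>v (B *\<^sub>v v)"
        using B u v by (simp add: mult_add_distrib_mat_vec[of _ n n] mult_mat_vec[of _ n n])
      have "?w \<bullet> (B *\<^sub>v ?w) = u \<bullet> (B *\<^sub>v u) + t * (u \<bullet> (B *\<^sub>v v)) +
          (t * (v \<bullet> (B *\<^sub>v u)) + t * (t * (v \<bullet> (B *\<^sub>v v))))"
        unfolding e using B u v
        by (simp add: add_scalar_prod_distrib[of _ n] scalar_prod_add_distrib[of _ n] algebra_simps)
      then show ?thesis using q0[OF w] sym[OF u v] by (simp add: power2_eq_square algebra_simps)
    qed
    let ?a = "v \<bullet> (B *\<^sub>v v)" and ?b = "u \<bullet> (B *\<^sub>v v)" and ?d = "u \<bullet> (B *\<^sub>v u)"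
    show ?thesis
    proof (cases "?a = 0")
      case True
      show ?thesis
      proof (cases "?b = 0")
        case False
        \<comment> \<open>With \<open>?a = 0\<close> the polynomial is affine in \<open>t\<close>;
          this choice of \<open>t\<close> would bring it to \<open>- ?d - 2\<close>, which is
          negative.\<close>
        have "0 \<le> ?d + 2 * (- (?d + 1) / ?b) * ?b" using poly[of "- (?d + 1) / ?b"] True by simp
        then show ?thesis using False q0[OF u] by simp
      qed (simp add: True)
    next
      case False
      \<comment> \<open>\<open>- ?b / ?a\<close> is the minimizer of the quadratic.\<close>
      have "0 \<le> ?d + 2 * (- ?b / ?a) * ?b + (- ?b / ?a)\<^sup>2 * ?a" by (rule poly)
      also have "\<dots> = ?d - ?b\<^sup>2 / ?a" using False by (simp add: field_simps power2_eq_square)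
      finally show ?thesis using False q0[OF v] by (simp add: field_simps less_le)
    qed
  qed
  have Bsq: "(vec_norm (B *\<^sub>v v))\<^sup>2 \<le> M * (v \<bullet> (B *\<^sub>v v))" if v: "v \<in> carrier_vec n" for v
  proof -
    let ?u = "B *\<^sub>v v"
    have u: "?u \<in> carrier_vec n" using B v by auto
    \<comment> \<open>Cauchy-Schwarz for the pair \<open>?u\<close>, \<open>v\<close>. The form at
      \<open>?u\<close> is at most \<open>M\<close> times the squared norm of \<open>?u\<close>,
      which then cancels on both sides.\<close>
    have "(?u \<bullet> ?u)\<^sup>2 \<le> (?u \<bullet> (B *\<^sub>v ?u)) * (v \<bullet> ?u)" using CS[OF u v] .
    also have "\<dots> \<le> (M * (vec_norm ?u)\<^sup>2) * (v \<bullet> ?u)"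
      using q[OF u] q0[OF v] by (intro mult_right_mono) auto
    finally have le': "(vec_norm ?u)\<^sup>2 * (vec_norm ?u)\<^sup>2 \<le> (M * (v \<bullet> ?u)) * (vec_norm ?u)\<^sup>2"
      by (simp only: vec_norm_power2[symmetric] power2_eq_square mult_ac)
    show ?thesis
    proof (cases "vec_norm ?u = 0")
      case True
      then show ?thesis using M0 q0[OF v] by simp
    next
      case False
      then show ?thesis using mult_right_le_imp_le[OF le'] by simp
    qed
  qed
  have "det B = 0"
  proof (rule ccontr)
    assume "det B \<noteq> 0"
    then obtain B' where B': "B' \<in> carrier_mat n n" "B' * B = 1\<^sub>m n"
      using mat_inverseE[OF B] by metis
    obtain b where b: "0 \<le> b"
      "\<And>v. v \<in> carrier_vec n \<Longrightarrow> vec_norm (B' *\<^sub>v v) \<le> b * vec_norm v"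
      using mult_mat_vec_bounded[of B'] B' by auto
    have key: "1 \<le> b\<^sup>2 * M * (M - (vec_norm (A *\<^sub>v v))\<^sup>2)" if v: "v \<in> S" for v
    proof -
      have vc: "v \<in> carrier_vec n" and v1: "vec_norm v = 1" using v by (auto simp: S_def)
      have Bvc: "B *\<^sub>v v \<in> carrier_vec n" using B vc by auto
      have "B' *\<^sub>v (B *\<^sub>v v) = v"
        using assoc_mult_mat_vec[OF B'(1) B vc] B'(2) vc by simp
      then have "1 \<le> b * vec_norm (B *\<^sub>v v)" using b(2)[OF Bvc] v1 by simp
      then have "1 \<le> (b * vec_norm (B *\<^sub>v v))\<^sup>2" by simp
      also have "\<dots> \<le> b\<^sup>2 * (M * (v \<bullet> (B *\<^sub>v v)))"
        unfolding power_mult_distrib using Bsq[OF vc] by (intro mult_left_mono) auto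
      finally show ?thesis using q[OF vc] v1 by (simp add: mult_ac)
    qed
    define c' where "c' = b\<^sup>2 * M"
    obtain v0 where v0: "v0 \<in> S" using ne by auto
    have "c' \<noteq> 0" using key[OF v0] by (auto simp: c'_def)
    then have c'0: "0 < c'" using M0 by (simp add: c'_def less_le)
    have "(vec_norm (A *\<^sub>v v))\<^sup>2 \<le> M - 1 / c'" if "v \<in> S" for v
      using key[OF that] c'0 unfolding c'_def[symmetric] by (simp add: field_simps)
    then have "M \<le> M - 1 / c'" unfolding M_def[symmetric]
      by (subst (1) M_def) (intro cSUP_least[OF ne])
    then show False using c'0 by simp
  qed
  then obtain v where v: "v \<in> carrier_vec n" "v \<noteq> 0\<^sub>v n" "B *\<^sub>v v = 0\<^sub>v n"
    using det_0_iff_vec_prod_zero[OF B] by auto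
  have AA: "A\<^sup>T * A \<in> carrier_mat n n" using A by auto
  have "(A\<^sup>T * A) *\<^sub>v v = M \<cdot>\<^sub>v v"
  proof (rule eq_vecI)
    fix i assume "i < dim_vec (M \<cdot>\<^sub>v v)"
    then have i: "i < n" using v by auto
    have "(M \<cdot>\<^sub>v v - (A\<^sup>T * A) *\<^sub>v v) $ i = 0"
      unfolding Bv[OF v(1), symmetric] v(3) using i by simp
    moreover have "(M \<cdot>\<^sub>v v - (A\<^sup>T * A) *\<^sub>v v) $ i = (M \<cdot>\<^sub>v v) $ i - ((A\<^sup>T * A) *\<^sub>v v) $ i"
      using i AA by (intro index_minus_vec) auto
    ultimately show "((A\<^sup>T * A) *\<^sub>v v) $ i = (M \<cdot>\<^sub>v v) $ i" by simp
  qed (use A v in auto)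
  then have "eigenvalue (A\<^sup>T * A) ((sqrt M)\<^sup>2)"
    using v A M0 by (auto simp: eigenvalue_def eigenvector_def)
  moreover have "vec_norm (A *\<^sub>v v) \<le> sqrt M * vec_norm v" if "v \<in> carrier_vec n" for v
    using real_sqrt_le_mono[OF le[OF that]] by (simp add: real_sqrt_mult)
  ultimately show thesis using M0 by (intro that[of "sqrt M"]) auto
qed

text \<open>The \<open>Max\<close> dominates the singular value found above because its set is
  finite, consisting of square roots of the finite spectrum. For \<open>n = 0\<close> there are no
  eigenvectors and the \<open>Max\<close> would range over the empty set.\<close>

lemma
  assumes A: "A \<in> carrier_mat m n" and n: "1 \<le> n"
  shows mat_norm_nonneg: "0 \<le> mat_norm A"
    and vec_norm_mult_mat_le: "v \<in> carrier_vec n \<Longrightarrow> vec_norm (A *\<^sub>v v) \<le> mat_norm A * vec_norm v"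
proof -
  obtain s where s: "0 \<le> s" "eigenvalue (A\<^sup>T * A) (s\<^sup>2)"
    "\<And>v. v \<in> carrier_vec n \<Longrightarrow> vec_norm (A *\<^sub>v v) \<le> s * vec_norm v"
    using singular_value_boundE[OF A n] by metis
  let ?E = "{\<sigma>. 0 \<le> \<sigma> \<and> eigenvalue (A\<^sup>T * A) (\<sigma>\<^sup>2)}"
  have "finite (spectrum (A\<^sup>T * A))" using A by (intro card_finite_spectrum[of _ n]) auto
  then have "finite (sqrt ` spectrum (A\<^sup>T * A))" by simp
  moreover have "?E \<subseteq> sqrt ` spectrum (A\<^sup>T * A)"
    by (force simp: spectrum_def image_iff intro: exI[of _ "_\<^sup>2"])
  ultimately have "finite ?E" by (rule rev_finite_subset)
  then have le: "s \<le> mat_norm A" unfolding mat_norm_def using s by (intro Max_ge) auto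
  with s show "0 \<le> mat_norm A" by simp
  show "vec_norm (A *\<^sub>v v) \<le> mat_norm A * vec_norm v" if "v \<in> carrier_vec n"
    using s(3)[OF that] le by (meson mult_right_mono order_trans vec_norm_nonneg)
qed

section \<open>Derivatives of least-squares functions\<close>

lemma vec_norm_add_power2:
  assumes "(u :: real vec) \<in> carrier_vec n" "v \<in> carrier_vec n"
  shows "(vec_norm (u + v))\<^sup>2 = (vec_norm u)\<^sup>2 + 2 * (u \<bullet> v) + (vec_norm v)\<^sup>2"
  using assms comm_scalar_prod[of v n u]
  by (simp add: vec_norm_power2 add_scalar_prod_distrib[of _ n] scalar_prod_add_distrib[of _ n])

lemma vec_minus_self_add:
  assumes "(u :: real vec) \<in> carrier_vec n" "v \<in> carrier_vec n"
  shows "u + v - u = v" "u + (v - u) = v"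
  using assms by auto

lemma eq_mat_on_vecI:
  assumes "(A :: real mat) \<in> carrier_mat m n" "B \<in> carrier_mat m n"
    and eq: "\<And>v. v \<in> carrier_vec n \<Longrightarrow> A *\<^sub>v v = B *\<^sub>v v"
  shows "A = B"
proof (rule eq_matI)
  fix i j assume ij: "i < dim_row B" "j < dim_col B"
  then have "A *\<^sub>v unit_vec n j = B *\<^sub>v unit_vec n j" using eq by auto
  then have "(A *\<^sub>v unit_vec n j) $ i = (B *\<^sub>v unit_vec n j) $ i" by simp
  then show "A $$ (i, j) = B $$ (i, j)" using ij assms(1,2) by auto
qed (use assms in auto)

text \<open>The passage to the limit in the two uniqueness proofs below.\<close>

lemma nonpos_if_le_small_mult:
  fixes a b :: real
  assumes "\<And>e. 0 < e \<Longrightarrow> a \<le> e * b"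
  shows "a \<le> 0"
proof (rule ccontr)
  assume "\<not> a \<le> 0"
  moreover have "a \<le> a / (2 * (\<bar>b\<bar> + 1)) * b" using calculation by (intro assms) auto
  moreover have "a / (2 * (\<bar>b\<bar> + 1)) * b \<le> a / (2 * (\<bar>b\<bar> + 1)) * (\<bar>b\<bar> + 1)"
    using calculation by (intro mult_left_mono) auto
  moreover have "a / (2 * (\<bar>b\<bar> + 1)) * (\<bar>b\<bar> + 1) = a / 2" by (simp add: field_simps)
  ultimately show False by linarith
qed

lemma half_quotient_mult: "(c :: real) \<noteq> 0 \<Longrightarrow> a / (2 * c) * c = a / 2"
  by simp

lemma small_multiple:
  assumes "0 < d" "(v :: real vec) \<in> carrier_vec n"
  obtains t where "0 < t" "vec_norm (t \<cdot>\<^sub>v v) < d"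
proof
  show "0 < d / (2 * (vec_norm v + 1))" using assms by (simp add: add_nonneg_pos)
  have "d / (2 * (vec_norm v + 1)) * vec_norm v \<le> d / (2 * (vec_norm v + 1)) * (vec_norm v + 1)"
    using assms by (intro mult_left_mono) (auto simp: add_nonneg_nonneg)
  also have "\<dots> = d / 2"
    using vec_norm_nonneg[of v] by (intro half_quotient_mult) linarith
  also have "\<dots> < d" using assms by simp
  finally show "vec_norm (d / (2 * (vec_norm v + 1)) \<cdot>\<^sub>v v) < d"
    using assms by (simp add: vec_norm_smult abs_of_nonneg add_nonneg_nonneg)
qed

text \<open>Gives the \<open>THE\<close> in \<open>jacobian\<close> a determined value. Along a
  short multiple \<open>t \<cdot>\<^sub>v v\<close> of a direction, the two remainders differ by
  \<open>t\<close> times \<open>A *\<^sub>v v - B *\<^sub>v v\<close>, and \<open>t\<close>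
  cancels.\<close>

lemma has_jacobian_unique:
  assumes r: "r \<in> carrier_vec n \<rightarrow> carrier_vec m" and x: "x \<in> carrier_vec n"
    and A: "has_jacobian n m r A x" and B: "has_jacobian n m r B x"
  shows "A = B"
proof (rule eq_mat_on_vecI)
  show Ac: "A \<in> carrier_mat m n" and Bc: "B \<in> carrier_mat m n"
    using A B by (auto simp: has_jacobian_def)
  fix v :: "real vec" assume v: "v \<in> carrier_vec n"
  have "vec_norm (A *\<^sub>v v - B *\<^sub>v v) \<le> e * (2 * vec_norm v)" if e: "0 < e" for e
  proof -
    obtain d1 where d1: "0 < d1" "\<And>y. y \<in> carrier_vec n \<Longrightarrow> vec_norm (y - x) < d1 \<Longrightarrow>
        vec_norm (r y - r x - A *\<^sub>v (y - x)) \<le> e * vec_norm (y - x)"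
      using A e unfolding has_jacobian_def by metis
    obtain d2 where d2: "0 < d2" "\<And>y. y \<in> carrier_vec n \<Longrightarrow> vec_norm (y - x) < d2 \<Longrightarrow>
        vec_norm (r y - r x - B *\<^sub>v (y - x)) \<le> e * vec_norm (y - x)"
      using B e unfolding has_jacobian_def by metis
    obtain t where t: "0 < t" "vec_norm (t \<cdot>\<^sub>v v) < min d1 d2"
      using small_multiple[of "min d1 d2" v n] d1 d2 v by auto
    let ?y = "x + t \<cdot>\<^sub>v v"
    have y: "?y \<in> carrier_vec n" "?y - x = t \<cdot>\<^sub>v v" using x v by auto
    have c: "r ?y \<in> carrier_vec m" "r x \<in> carrier_vec m" using r x y by auto
    let ?a = "r ?y - r x - A *\<^sub>v (t \<cdot>\<^sub>v v)" and ?b = "r ?y - r x - B *\<^sub>v (t \<cdot>\<^sub>v v)"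
    have ab: "?a \<in> carrier_vec m" "?b \<in> carrier_vec m" using c Ac Bc v by auto
    have "?b - ?a = t \<cdot>\<^sub>v (A *\<^sub>v v - B *\<^sub>v v)"
      using c Ac Bc v mult_mat_vec[OF Ac v, of t] mult_mat_vec[OF Bc v, of t]
      by (auto simp: algebra_simps)
    then have "t * vec_norm (A *\<^sub>v v - B *\<^sub>v v) = vec_norm (?b - ?a)"
      using t by (simp add: vec_norm_smult)
    also have "\<dots> \<le> vec_norm ?b + vec_norm ?a"
      using ab by (intro vec_norm_triangle_minus)
    also have "\<dots> \<le> e * vec_norm (t \<cdot>\<^sub>v v) + e * vec_norm (t \<cdot>\<^sub>v v)"
      using d1(2)[OF y(1)] d2(2)[OF y(1)] t y(2) by (intro add_mono) auto
    finally have "t * vec_norm (A *\<^sub>v v - B *\<^sub>v v) \<le> t * (e * (2 * vec_norm v))"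
      using t by (simp add: vec_norm_smult)
    then show ?thesis using t by simp
  qed
  then have "vec_norm (A *\<^sub>v v - B *\<^sub>v v) \<le> 0" by (rule nonpos_if_le_small_mult)
  then have "A *\<^sub>v v - B *\<^sub>v v = 0\<^sub>v m"
    using Ac Bc v by (intro vec_norm_eq_0D) (auto intro: order_antisym)
  then have "\<forall>i<m. (A *\<^sub>v v - B *\<^sub>v v) $ i = 0" by simp
  then show "A *\<^sub>v v = B *\<^sub>v v" using Ac Bc v by (intro eq_vecI) auto
qed

lemma jacobian_eqI:
  assumes "r \<in> carrier_vec n \<rightarrow> carrier_vec m" "x \<in> carrier_vec n" "has_jacobian n m r A x"
  shows "jacobian n m r x = A"
  unfolding jacobian_def using assms has_jacobian_unique[OF assms(1,2)] by blast

lemma has_gradient_unique: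
  assumes x: "x \<in> carrier_vec n" and g: "has_gradient n f g x" and h: "has_gradient n f h x"
  shows "g = h"
proof -
  have gc: "g \<in> carrier_vec n" and hc: "h \<in> carrier_vec n"
    using g h by (auto simp: has_gradient_def)
  \<comment> \<open>In the direction of the difference itself, the two linear terms differ by
    \<open>t\<close> times its squared norm.\<close>
  define v where "v = g - h"
  have v: "v \<in> carrier_vec n" using gc hc by (simp add: v_def)
  have "(vec_norm v)\<^sup>2 \<le> e * (2 * vec_norm v)" if e: "0 < e" for e
  proof -
    obtain d1 where d1: "0 < d1" "\<And>y. y \<in> carrier_vec n \<Longrightarrow> vec_norm (y - x) < d1 \<Longrightarrow>
        \<bar>f y - f x - g \<bullet> (y - x)\<bar> \<le> e * vec_norm (y - x)"
      using g e unfolding has_gradient_def by metis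
    obtain d2 where d2: "0 < d2" "\<And>y. y \<in> carrier_vec n \<Longrightarrow> vec_norm (y - x) < d2 \<Longrightarrow>
        \<bar>f y - f x - h \<bullet> (y - x)\<bar> \<le> e * vec_norm (y - x)"
      using h e unfolding has_gradient_def by metis
    obtain t where t: "0 < t" "vec_norm (t \<cdot>\<^sub>v v) < min d1 d2"
      using small_multiple[of "min d1 d2" v n] d1 d2 v by auto
    let ?y = "x + t \<cdot>\<^sub>v v"
    have y: "?y \<in> carrier_vec n" "?y - x = t \<cdot>\<^sub>v v" using x v by auto
    have "g \<bullet> (t \<cdot>\<^sub>v v) - h \<bullet> (t \<cdot>\<^sub>v v) \<le> e * vec_norm (t \<cdot>\<^sub>v v) + e * vec_norm (t \<cdot>\<^sub>v v)"
      using d1(2)[OF y(1)] d2(2)[OF y(1)] t y(2) by auto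
    moreover have "g \<bullet> (t \<cdot>\<^sub>v v) - h \<bullet> (t \<cdot>\<^sub>v v) = t * (vec_norm v)\<^sup>2"
      using v gc hc minus_scalar_prod_distrib[OF gc hc v]
      by (simp add: vec_norm_power2 v_def[symmetric] right_diff_distrib)
    ultimately have "t * (vec_norm v)\<^sup>2 \<le> t * (e * (2 * vec_norm v))"
      using t by (simp add: vec_norm_smult)
    then show ?thesis using t by simp
  qed
  then have "(vec_norm v)\<^sup>2 \<le> 0" by (rule nonpos_if_le_small_mult)
  then have "g - h = 0\<^sub>v n" using v by (intro vec_norm_eq_0D) (auto simp: v_def)
  then have "\<forall>i<n. (g - h) $ i = 0" by simp
  then show ?thesis using gc hc by (intro eq_vecI) auto
qed

text \<open>Since the expansion is exact, it serves both the derivative of \<open>f\<close> and the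
  model error at a finite distance.\<close>

lemma lsq_diff:
  assumes "r x \<in> carrier_vec m" "r y \<in> carrier_vec m"
  shows "lsq r y - lsq r x = r x \<bullet> (r y - r x) + (vec_norm (r y - r x))\<^sup>2 / 2"
  using vec_norm_add_power2[of "r x" m "r y - r x"] assms
  by (simp add: vec_minus_self_add[OF assms] lsq_def field_simps)

lemma has_gradient_lsq:
  assumes r: "r \<in> carrier_vec n \<rightarrow> carrier_vec m" and x: "x \<in> carrier_vec n"
    and A: "has_jacobian n m r A x"
  shows "has_gradient n (lsq r) (A\<^sup>T *\<^sub>v r x) x"
  unfolding has_gradient_def
proof (intro conjI allI impI)
  have Ac: "A \<in> carrier_mat m n" using A by (auto simp: has_jacobian_def)
  have rx: "r x \<in> carrier_vec m" using r x by auto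
  show "A\<^sup>T *\<^sub>v r x \<in> carrier_vec n" using Ac rx by auto
  fix e :: real assume e: "0 < e"
  obtain a where a: "0 \<le> a" "\<And>v. v \<in> carrier_vec n \<Longrightarrow> vec_norm (A *\<^sub>v v) \<le> a * vec_norm v"
    using mult_mat_vec_bounded[of A] Ac by auto
  \<comment> \<open>The bound 1 controls the growth of \<open>r\<close> near \<open>x\<close>; the
    quotient keeps the first-order error within half of \<open>e\<close>.\<close>
  define e1 where "e1 = min 1 (e / (2 * (vec_norm (r x) + 1)))"
  have e1: "0 < e1" "e1 \<le> 1" using e by (auto simp: e1_def add_nonneg_pos)
  have "vec_norm (r x) * e1 \<le> (vec_norm (r x) + 1) * (e / (2 * (vec_norm (r x) + 1)))"
    using e1 by (intro mult_mono) (auto simp: e1_def)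
  also have "\<dots> = e / 2"
    using vec_norm_nonneg[of "r x"] half_quotient_mult[of "vec_norm (r x) + 1" e] by (simp only: mult.commute)
  finally have e1': "vec_norm (r x) * e1 \<le> e / 2" .
  obtain d where d: "0 < d" "\<And>y. y \<in> carrier_vec n \<Longrightarrow> vec_norm (y - x) < d \<Longrightarrow>
      vec_norm (r y - r x - A *\<^sub>v (y - x)) \<le> e1 * vec_norm (y - x)"
    using A e1 unfolding has_jacobian_def by metis
  \<comment> \<open>Half of the squared increment of \<open>r\<close> is at most
    \<open>(a + 1)^2 / 2\<close> times the squared distance; this radius fits it into the other half
    of \<open>e\<close>.\<close>
  define d' where "d' = min d (e / (a + 1)\<^sup>2)"
  have d': "0 < d'" using d e a by (auto simp: d'_def)
  show "\<exists>d>0. \<forall>y\<in>carrier_vec n. vec_norm (y - x) < d \<longrightarrow>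
      \<bar>lsq r y - lsq r x - (A\<^sup>T *\<^sub>v r x) \<bullet> (y - x)\<bar> \<le> e * vec_norm (y - x)"
  proof (intro exI[of _ d'] conjI ballI impI d')
    fix y assume y: "y \<in> carrier_vec n" and dist: "vec_norm (y - x) < d'"
    let ?h = "y - x" and ?d = "r y - r x"
    have h: "?h \<in> carrier_vec n" and ry: "r y \<in> carrier_vec m" using x y r by auto
    have Ah: "A *\<^sub>v ?h \<in> carrier_vec m" using Ac h by auto
    have D: "?d \<in> carrier_vec m" using rx ry by auto
    have err: "vec_norm (?d - A *\<^sub>v ?h) \<le> e1 * vec_norm ?h"
      using d(2)[OF y] dist by (simp add: d'_def)
    have "vec_norm ?d = vec_norm ((?d - A *\<^sub>v ?h) + A *\<^sub>v ?h)"
      using D Ah rx ry Ac by (intro arg_cong[where f = vec_norm] eq_vecI) auto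
    also have "\<dots> \<le> vec_norm (?d - A *\<^sub>v ?h) + vec_norm (A *\<^sub>v ?h)"
      using D Ah by (intro vec_norm_triangle) auto
    also have "\<dots> \<le> 1 * vec_norm ?h + a * vec_norm ?h"
      using order_trans[OF err mult_right_mono[OF e1(2) vec_norm_nonneg]] a(2)[OF h]
      by (intro add_mono)
    finally have "vec_norm ?d \<le> (a + 1) * vec_norm ?h" by (simp add: algebra_simps)
    then have "(vec_norm ?d)\<^sup>2 \<le> ((a + 1) * vec_norm ?h)\<^sup>2" by (simp add: power_mono)
    also have "\<dots> = (a + 1)\<^sup>2 * vec_norm ?h * vec_norm ?h" by (simp add: power2_eq_square)
    also have "\<dots> \<le> e * vec_norm ?h"
    proof (rule mult_right_mono)
      have "vec_norm ?h \<le> e / (a + 1)\<^sup>2" using dist by (simp add: d'_def)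
      moreover have "0 < (a + 1)\<^sup>2" using a by simp
      ultimately show "(a + 1)\<^sup>2 * vec_norm ?h \<le> e" by (simp add: field_simps)
    qed simp
    finally have sq: "(vec_norm ?d)\<^sup>2 / 2 \<le> e / 2 * vec_norm ?h" by simp
    have "\<bar>r x \<bullet> (?d - A *\<^sub>v ?h)\<bar> \<le> vec_norm (r x) * vec_norm (?d - A *\<^sub>v ?h)"
      using rx D Ah by (intro scalar_prod_le_vec_norm) auto
    also have "\<dots> \<le> vec_norm (r x) * (e1 * vec_norm ?h)"
      using err by (intro mult_left_mono) auto
    also have "\<dots> \<le> e / 2 * vec_norm ?h"
      using mult_right_mono[OF e1', of "vec_norm ?h"] by (simp add: mult.assoc)
    finally have lin: "\<bar>r x \<bullet> (?d - A *\<^sub>v ?h)\<bar> \<le> e / 2 * vec_norm ?h" .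
    have "lsq r y - lsq r x - (A\<^sup>T *\<^sub>v r x) \<bullet> ?h = r x \<bullet> (?d - A *\<^sub>v ?h) + (vec_norm ?d)\<^sup>2 / 2"
      unfolding lsq_diff[where r = r, OF rx ry] transpose_vec_mult_scalar[OF Ac h rx]
        scalar_prod_minus_distrib[OF rx D Ah] by simp
    then show "\<bar>lsq r y - lsq r x - (A\<^sup>T *\<^sub>v r x) \<bullet> ?h\<bar> \<le> e * vec_norm ?h"
      using lin sq by (simp add: abs_le_iff)
        (smt (verit, ccfv_SIG) field_sum_of_halves zero_le_power2 divide_nonneg_nonneg distrib_right)
  qed
qed

lemma gradient_lsq:
  assumes "r \<in> carrier_vec n \<rightarrow> carrier_vec m" "x \<in> carrier_vec n" "has_jacobian n m r A x"
  shows "gradient n (lsq r) x = A\<^sup>T *\<^sub>v r x"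
  unfolding gradient_def
  using has_gradient_lsq[OF assms] has_gradient_unique[OF assms(2)] by blast

text \<open>Tested against a fixed \<open>w\<close>, the map \<open>r\<close> becomes a real
  function of \<open>t\<close>, to which one-dimensional monotonicity applies.\<close>

lemma has_real_derivative_along_segment:
  assumes r: "r \<in> carrier_vec n \<rightarrow> carrier_vec m" and x: "x \<in> carrier_vec n"
    and s: "s \<in> carrier_vec n" and w: "w \<in> carrier_vec m"
    and A: "has_jacobian n m r A (x + t \<cdot>\<^sub>v s)"
  shows "((\<lambda>t. w \<bullet> r (x + t \<cdot>\<^sub>v s)) has_real_derivative w \<bullet> (A *\<^sub>v s)) (at t)"
  unfolding DERIV_def LIM_eq
proof (intro allI impI)
  fix e :: real assume e: "0 < e"
  let ?y = "\<lambda>t. x + t \<cdot>\<^sub>v s" and ?c = "vec_norm w * vec_norm s + 1"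
  have c: "0 < ?c" by (simp add: add_nonneg_pos)
  have Ac: "A \<in> carrier_mat m n" using A by (auto simp: has_jacobian_def)
  obtain d where d: "0 < d" "\<And>y. y \<in> carrier_vec n \<Longrightarrow> vec_norm (y - ?y t) < d \<Longrightarrow>
      vec_norm (r y - r (?y t) - A *\<^sub>v (y - ?y t)) \<le> e / (2 * ?c) * vec_norm (y - ?y t)"
    using A e c unfolding has_jacobian_def by (metis divide_pos_pos mult_pos_pos zero_less_numeral)
  show "\<exists>d>0. \<forall>h. h \<noteq> 0 \<and> norm (h - 0) < d \<longrightarrow>
      norm ((w \<bullet> r (?y (t + h)) - w \<bullet> r (?y t)) / h - w \<bullet> (A *\<^sub>v s)) < e"
  proof (intro exI[of _ "d / (vec_norm s + 1)"] conjI allI impI)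
    show "0 < d / (vec_norm s + 1)" using d by (simp add: add_nonneg_pos)
    fix h :: real assume h: "h \<noteq> 0 \<and> norm (h - 0) < d / (vec_norm s + 1)"
    have eq: "?y (t + h) - ?y t = h \<cdot>\<^sub>v s"
      using x s by (auto simp: algebra_simps)
    have yc: "?y (t + h) \<in> carrier_vec n" "?y t \<in> carrier_vec n" using x s by auto
    have rc: "r (?y (t + h)) \<in> carrier_vec m" "r (?y t) \<in> carrier_vec m" using r yc by auto
    have As: "A *\<^sub>v s \<in> carrier_vec m" using Ac s by auto
    have "\<bar>h\<bar> * vec_norm s \<le> \<bar>h\<bar> * (vec_norm s + 1)" by (intro mult_left_mono) auto
    also have "\<dots> < d" using h by (simp add: pos_less_divide_eq add_nonneg_pos)
    finally have "vec_norm (h \<cdot>\<^sub>v s) < d" by (simp add: vec_norm_smult)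
    then have err: "vec_norm (r (?y (t + h)) - r (?y t) - h \<cdot>\<^sub>v (A *\<^sub>v s)) \<le> e / (2 * ?c) * vec_norm (h \<cdot>\<^sub>v s)"
      using d(2)[OF yc(1)] by (simp add: eq mult_mat_vec[OF Ac s])
    have split: "w \<bullet> (r (?y (t + h)) - r (?y t) - h \<cdot>\<^sub>v (A *\<^sub>v s)) =
        w \<bullet> r (?y (t + h)) - w \<bullet> r (?y t) - h * (w \<bullet> (A *\<^sub>v s))"
      using w rc As by (simp add: scalar_prod_minus_distrib[of _ m])
    have "\<bar>w \<bullet> r (?y (t + h)) - w \<bullet> r (?y t) - h * (w \<bullet> (A *\<^sub>v s))\<bar>
        \<le> vec_norm w * vec_norm (r (?y (t + h)) - r (?y t) - h \<cdot>\<^sub>v (A *\<^sub>v s))"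
      unfolding split[symmetric] using w rc As by (intro scalar_prod_le_vec_norm) auto
    also have "\<dots> \<le> vec_norm w * (e / (2 * ?c) * vec_norm (h \<cdot>\<^sub>v s))"
      using err by (intro mult_left_mono) auto
    also have "\<dots> = \<bar>h\<bar> * (e / (2 * ?c) * (vec_norm w * vec_norm s))"
      by (simp add: vec_norm_smult mult_ac)
    also have "\<dots> \<le> \<bar>h\<bar> * (e / (2 * ?c) * ?c)"
      using e c by (intro mult_left_mono) auto
    also have "\<dots> = \<bar>h\<bar> * (e / 2)"
      using half_quotient_mult[of ?c e] c by (metis less_irrefl)
    finally have le: "\<bar>w \<bullet> r (?y (t + h)) - w \<bullet> r (?y t) - h * (w \<bullet> (A *\<^sub>v s))\<bar> \<le> \<bar>h\<bar> * (e / 2)" .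
    have "(w \<bullet> r (?y (t + h)) - w \<bullet> r (?y t)) / h - w \<bullet> (A *\<^sub>v s) =
        (w \<bullet> r (?y (t + h)) - w \<bullet> r (?y t) - h * (w \<bullet> (A *\<^sub>v s))) / h"
      using h by (simp add: field_simps)
    then have "\<bar>(w \<bullet> r (?y (t + h)) - w \<bullet> r (?y t)) / h - w \<bullet> (A *\<^sub>v s)\<bar> \<le> e / 2"
      using le h by (simp add: abs_divide pos_divide_le_eq mult.commute)
    then show "norm ((w \<bullet> r (?y (t + h)) - w \<bullet> r (?y t)) / h - w \<bullet> (A *\<^sub>v s)) < e"
      using e by simp
  qed
qed

text \<open>A mean value inequality: testing with the remainder \<open>w\<close> itself makes \<psi>
  nonincreasing, and \<open>\<psi> 1 \<le> \<psi> 0\<close> bounds the squared norm of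
  \<open>w\<close> by \<open>a + b / 2\<close> times its norm. A bound linear in \<open>t\<close>
  covers both a bounded Jacobian (\<open>b = 0\<close>) and a Lipschitz one
  (\<open>a = 0\<close>).\<close>

lemma segment_increment_le:
  assumes r: "r \<in> carrier_vec n \<rightarrow> carrier_vec m" and x: "x \<in> carrier_vec n"
    and s: "s \<in> carrier_vec n" and q: "q \<in> carrier_vec m"
    and J: "\<And>t. 0 \<le> t \<Longrightarrow> t \<le> 1 \<Longrightarrow> has_jacobian n m r (J t) (x + t \<cdot>\<^sub>v s)"
    and le: "\<And>t. 0 \<le> t \<Longrightarrow> t \<le> 1 \<Longrightarrow> vec_norm (J t *\<^sub>v s - q) \<le> a + b * t"
  shows "vec_norm (r (x + s) - r x - q) \<le> a + b / 2"
proof -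
  let ?y = "\<lambda>t. x + t \<cdot>\<^sub>v s"
  define w where "w = r (x + s) - r x - q"
  have rc: "r (x + s) \<in> carrier_vec m" "r x \<in> carrier_vec m" using r x s by auto
  have w: "w \<in> carrier_vec m" using rc q by (auto simp: w_def)
  define \<psi> where "\<psi> t = w \<bullet> r (?y t) - t * (w \<bullet> q) - vec_norm w * (a * t + b * t\<^sup>2 / 2)" for t
  have "\<psi> 1 \<le> \<psi> 0"
  proof (rule DERIV_nonpos_imp_nonincreasing[of 0 1 \<psi>])
    fix t :: real assume t: "0 \<le> t" "t \<le> 1"
    have Jc: "J t \<in> carrier_mat m n" using J[OF t] by (auto simp: has_jacobian_def)
    have "(\<psi> has_real_derivative w \<bullet> (J t *\<^sub>v s) - w \<bullet> q - vec_norm w * (a + b * t)) (at t)"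
      unfolding \<psi>_def
      by (rule derivative_eq_intros has_real_derivative_along_segment[OF r x s w J[OF t]] refl | simp)+
    moreover have "w \<bullet> (J t *\<^sub>v s) - w \<bullet> q \<le> vec_norm w * (a + b * t)"
    proof -
      have "w \<bullet> (J t *\<^sub>v s) - w \<bullet> q = w \<bullet> (J t *\<^sub>v s - q)"
        using w q Jc s by (simp add: scalar_prod_minus_distrib[of _ m])
      also have "\<dots> \<le> vec_norm w * vec_norm (J t *\<^sub>v s - q)"
        using scalar_prod_le_vec_norm[of w m "J t *\<^sub>v s - q"] w q Jc s by auto
      also have "\<dots> \<le> vec_norm w * (a + b * t)"
        using le[OF t] by (intro mult_left_mono) auto
      finally show ?thesis .
    qed
    ultimately show "\<exists>y. (\<psi> has_real_derivative y) (at t) \<and> y \<le> 0"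
      by (intro exI conjI) auto
  qed simp
  moreover have "\<psi> 0 = w \<bullet> r x"
  proof -
    have "x + 0 \<cdot>\<^sub>v s = x" using x s by auto
    then show ?thesis by (simp add: \<psi>_def)
  qed
  moreover have "\<psi> 1 = w \<bullet> r (x + s) - w \<bullet> q - vec_norm w * (a + b / 2)" by (simp add: \<psi>_def)
  moreover have "(vec_norm w)\<^sup>2 = w \<bullet> r (x + s) - w \<bullet> r x - w \<bullet> q"
  proof -
    have "w \<bullet> (r (x + s) - r x - q) = w \<bullet> r (x + s) - w \<bullet> r x - w \<bullet> q"
      using w rc q by (simp add: scalar_prod_minus_distrib[of _ m])
    then show ?thesis by (simp add: vec_norm_power2 w_def[symmetric])
  qed
  ultimately have "vec_norm w * vec_norm w \<le> (a + b / 2) * vec_norm w"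
    by (simp add: power2_eq_square mult.commute)
  \<comment> \<open>At the midpoint the hypothesis has exactly the claimed bound on its right-hand
    side, hence it is nonnegative; this settles the case of a zero remainder.\<close>
  moreover have "0 \<le> a + b / 2" using order_trans[OF vec_norm_nonneg le[of "1/2"]] by simp
  ultimately show ?thesis
    unfolding w_def[symmetric] by (cases "vec_norm w = 0") (auto simp: less_le)
qed

section \<open>Linear interpolation\<close>

text \<open>Linear independence of the \<open>n\<close> displacements means full rank of the square
  matrix with these columns, hence invertibility.\<close>

lemma interp_set_listE:
  assumes Y: "interp_set n Y x"
  obtains ys Wi where "distinct ys" "set ys = Y - {x}" "length ys = n"
    "Wi \<in> carrier_mat n n"
    "mat_of_cols n (map (\<lambda>y. y - x) ys) * Wi = 1\<^sub>m n"
    "Wi * mat_of_cols n (map (\<lambda>y. y - x) ys) = 1\<^sub>m n"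
proof -
  have fin: "finite Y" and Yc: "Y \<subseteq> carrier_vec n" and card: "card Y = n + 1" and xY: "x \<in> Y"
    using Y by (auto simp: interp_set_def)
  obtain ys where ys: "distinct ys" "set ys = Y - {x}"
    using fin finite_distinct_list[of "Y - {x}"] by auto
  have len: "length ys = n"
    using distinct_card[OF ys(1)] ys(2) fin card xY by simp
  let ?vs = "map (\<lambda>y. y - x) ys"
  define W where "W = mat_of_cols n ?vs"
  have W: "W \<in> carrier_mat n n" using len by (auto simp: W_def mat_of_cols_def)
  have vs: "set ?vs \<subseteq> carrier_vec n" using ys Yc subsetD[OF Yc xY] by auto
  then have cols: "cols W = ?vs" unfolding W_def by (intro cols_mat_of_cols)
  \<comment> \<open>Independence is assumed for the set of displacements; only with distinct columns
    does it yield rank \<open>n\<close>.\<close>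
  have "inj_on (\<lambda>y. y - x) (set ys)"
  proof (rule inj_onI)
    fix y z assume yz: "y \<in> set ys" "z \<in> set ys" "y - x = z - x"
    then have c: "y \<in> carrier_vec n" "z \<in> carrier_vec n" "x \<in> carrier_vec n" using ys Yc xY by auto
    have "y = x + (y - x)" "z = x + (z - x)" using vec_minus_self_add(2)[OF c(3)] c by auto
    then show "y = z" using yz(3) by metis
  qed
  then have "distinct (cols W)" using ys by (simp add: cols distinct_map)
  moreover have "\<not> LinearCombinations.module.lin_dep class_ring (module_vec TYPE(real) n) (set (cols W))"
    using Y ys by (simp add: cols interp_set_def)
  ultimately have "vec_space.rank n W = n"
    by (intro vec_space.lin_indpt_full_rank[OF W])
  then have "det W \<noteq> 0" using vec_space.det_rank_iff[OF W] by simp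
  then obtain Wi where "Wi \<in> carrier_mat n n" "W * Wi = 1\<^sub>m n" "Wi * W = 1\<^sub>m n"
    using mat_inverseE[OF W] by metis
  then show thesis using that ys len by (simp add: W_def)
qed

text \<open>The interpolation conditions form the system \<open>A * W = Q\<close> with invertible
  \<open>W\<close>, whose only solution is \<open>Q * Wi\<close>; this determines the
  \<open>THE\<close> in \<open>interp_jac\<close>.\<close>

lemma interp_jac_props:
  assumes r: "r \<in> carrier_vec n \<rightarrow> carrier_vec m" and Y: "interp_set n Y x"
  shows "interp_jac n m r x Y \<in> carrier_mat m n"
    and "\<And>y. y \<in> Y \<Longrightarrow> interp_jac n m r x Y *\<^sub>v (y - x) = r y - r x"
proof -
  obtain ys Wi where ys: "distinct ys" "set ys = Y - {x}" "length ys = n"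
    and Wi: "Wi \<in> carrier_mat n n"
    and inv: "mat_of_cols n (map (\<lambda>y. y - x) ys) * Wi = 1\<^sub>m n"
    "Wi * mat_of_cols n (map (\<lambda>y. y - x) ys) = 1\<^sub>m n"
    using interp_set_listE[OF Y] by metis
  define W where "W = mat_of_cols n (map (\<lambda>y. y - x) ys)"
  define Q where "Q = mat_of_cols m (map (\<lambda>y. r y - r x) ys)"
  have Yc: "Y \<subseteq> carrier_vec n" and xY: "x \<in> Y" using Y by (auto simp: interp_set_def)
  have yi: "ys ! i \<in> Y" "ys ! i \<in> carrier_vec n" if "i < n" for i
    using that ys Yc nth_mem[of i ys] by auto
  have xc: "x \<in> carrier_vec n" using xY Yc by auto
  have W: "W \<in> carrier_mat n n" and Q: "Q \<in> carrier_mat m n"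
    using ys by (auto simp: W_def Q_def mat_of_cols_def)
  have colW: "col W i = ys ! i - x" and colQ: "col Q i = r (ys ! i) - r x" if "i < n" for i
  proof -
    have "ys ! i - x \<in> carrier_vec n" "r (ys ! i) - r x \<in> carrier_vec m"
      using yi[OF that] xc funcset_mem[OF r] by auto
    then show "col W i = ys ! i - x" "col Q i = r (ys ! i) - r x"
      unfolding W_def Q_def using that ys by auto
  qed
  have iff: "(\<forall>y\<in>Y - {x}. A *\<^sub>v (y - x) = r y - r x) \<longleftrightarrow> A * W = Q" if A: "A \<in> carrier_mat m n" for A
  proof
    assume L: "\<forall>y\<in>Y - {x}. A *\<^sub>v (y - x) = r y - r x"
    show "A * W = Q"
    proof (rule mat_col_eqI)
      fix i assume "i < dim_col Q"
      then have i: "i < n" using Q by simp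
      then have "ys ! i \<in> Y - {x}" using ys nth_mem by metis
      then show "col (A * W) i = col Q i"
        using col_mult2[OF A W i] colW[OF i] colQ[OF i] L by simp
    qed (use A W Q in auto)
  next
    assume Reqn: "A * W = Q"
    show "\<forall>y\<in>Y - {x}. A *\<^sub>v (y - x) = r y - r x"
    proof
      fix y assume "y \<in> Y - {x}"
      then obtain i where i: "i < n" "y = ys ! i" using ys by (metis in_set_conv_nth)
      then show "A *\<^sub>v (y - x) = r y - r x"
        using col_mult2[OF A W i(1)] colW[OF i(1)] colQ[OF i(1)] Reqn by simp
    qed
  qed
  have sol: "A * W = Q \<longleftrightarrow> A = Q * Wi" if A: "A \<in> carrier_mat m n" for A
  proof
    assume "A * W = Q"
    then have "Q * Wi = A * (W * Wi)" using assoc_mult_mat[OF A W Wi] by simp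
    then show "A = Q * Wi" using inv A by (simp add: W_def)
  next
    assume "A = Q * Wi"
    then have "A * W = Q * (Wi * W)" using assoc_mult_mat[OF Q Wi W] by simp
    then show "A * W = Q" using inv Q by (simp add: W_def)
  qed
  have QW: "Q * Wi \<in> carrier_mat m n" using Q Wi by auto
  have "interp_jac n m r x Y = Q * Wi"
    unfolding interp_jac_def
  proof (rule the_equality)
    show "Q * Wi \<in> carrier_mat m n \<and> (\<forall>y\<in>Y - {x}. (Q * Wi) *\<^sub>v (y - x) = r y - r x)"
      using iff[OF QW] sol[OF QW] QW by blast
  qed (use iff sol in blast)
  then have ij: "interp_jac n m r x Y \<in> carrier_mat m n"
    "\<forall>y\<in>Y - {x}. interp_jac n m r x Y *\<^sub>v (y - x) = r y - r x"
    using iff[OF QW] sol[OF QW] QW by auto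
  show "interp_jac n m r x Y \<in> carrier_mat m n" by fact
  show "interp_jac n m r x Y *\<^sub>v (y - x) = r y - r x" if "y \<in> Y" for y
  proof (cases "y = x")
    case True
    have "r x \<in> carrier_vec m" using r xc by auto
    then show ?thesis using True ij(1) xc by auto
  qed (use ij that in auto)
qed

text \<open>The rows of \<open>S * F\<^sup>T\<close> are the scaled values of \<open>F\<close> at
  the displacements, which by interpolation are remainders of \<open>r\<close>, so their norm is at
  most \<open>b\<close>. Multiplying by the inverse \<open>V\<close> of \<open>S\<close> recovers
  \<open>F\<^sup>T\<close> at the cost of the factor \<open>C\<close>, and the bound passes from
  \<open>F\<^sup>T\<close> to \<open>F\<close>.\<close>

lemma interp_jac_error:
  assumes n: "1 \<le> n" and r: "r \<in> carrier_vec n \<rightarrow> carrier_vec m" and Y: "interp_set n Y x"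
    and poised: "lambda_poised n Lam x D Y" and D: "0 < D" and C: "inverse_bound n Lam C"
    and A: "A \<in> carrier_mat m n" and b: "0 \<le> b"
    and err: "\<And>y. y \<in> Y \<Longrightarrow> vec_norm (r y - r x - A *\<^sub>v (y - x)) \<le> b * D"
    and v: "v \<in> carrier_vec n"
  shows "vec_norm ((A - interp_jac n m r x Y) *\<^sub>v v) \<le> sqrt (real n) * b * C * vec_norm v"
proof -
  obtain ys Wi where ys: "distinct ys" "set ys = Y - {x}" "length ys = n"
    and Wi: "Wi \<in> carrier_mat n n"
    and inv: "mat_of_cols n (map (\<lambda>y. y - x) ys) * Wi = 1\<^sub>m n"
    "Wi * mat_of_cols n (map (\<lambda>y. y - x) ys) = 1\<^sub>m n"
    using interp_set_listE[OF Y] by metis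
  define W where "W = mat_of_cols n (map (\<lambda>y. y - x) ys)"
  define S where "S = mat_of_rows n (map (\<lambda>y. (1 / D) \<cdot>\<^sub>v (y - x)) ys)"
  \<comment> \<open>\<open>S\<close> is \<open>W\<^sup>T\<close> divided by \<open>D\<close>, so its
    inverse carries the factor \<open>D\<close>.\<close>
  define V where "V = D \<cdot>\<^sub>m Wi\<^sup>T"
  define B where "B = interp_jac n m r x Y"
  define F where "F = A - B"
  have Yc: "Y \<subseteq> carrier_vec n" and xY: "x \<in> Y" using Y by (auto simp: interp_set_def)
  have yi: "ys ! i \<in> Y" "ys ! i \<in> carrier_vec n" if "i < n" for i
    using that ys Yc nth_mem[of i ys] by auto
  have xc: "x \<in> carrier_vec n" using xY Yc by auto
  have W: "W \<in> carrier_mat n n" using ys by (auto simp: W_def mat_of_cols_def)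
  have S: "S \<in> carrier_mat n n" using ys by (auto simp: S_def mat_of_rows_def)
  have V: "V \<in> carrier_mat n n" using Wi by (auto simp: V_def)
  have B: "B \<in> carrier_mat m n" unfolding B_def by (rule interp_jac_props(1)[OF r Y])
  have F: "F \<in> carrier_mat m n" and FT: "F\<^sup>T \<in> carrier_mat n m" using A B by (auto simp: F_def)
  have rowS: "row S i = (1 / D) \<cdot>\<^sub>v (ys ! i - x)" if "i < n" for i
    unfolding S_def using that ys yi[OF that] xc by (subst mat_of_rows_row) auto
  have SW: "S = (1 / D) \<cdot>\<^sub>m W\<^sup>T"
  proof (rule eq_matI)
    fix i j assume "i < dim_row ((1 / D) \<cdot>\<^sub>m W\<^sup>T)" "j < dim_col ((1 / D) \<cdot>\<^sub>m W\<^sup>T)"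
    then have ij: "i < n" "j < n" using W by auto
    then show "S $$ (i, j) = ((1 / D) \<cdot>\<^sub>m W\<^sup>T) $$ (i, j)"
      using ys yi[OF ij(1)] xc by (simp add: S_def W_def mat_of_cols_def mat_of_rows_def)
  qed (use S W in auto)
  have WT: "W\<^sup>T * Wi\<^sup>T = 1\<^sub>m n" "Wi\<^sup>T * W\<^sup>T = 1\<^sub>m n"
    unfolding transpose_mult[OF Wi W, symmetric] transpose_mult[OF W Wi, symmetric]
    using inv by (simp_all add: W_def)
  have SV: "S * V = 1\<^sub>m n" "V * S = 1\<^sub>m n"
    unfolding SW V_def using W Wi D WT
    by (auto simp: mult_smult_distrib[of _ n n _ n] mult_smult_assoc_mat[of _ n n _ n])
  have "mat_norm V \<le> C"
  proof -
    have eqY: "insert x (set ys) = Y" using ys xY by auto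
    have "inverts_mat S V" "inverts_mat V S" using SV S V by (auto simp: inverts_mat_def)
    then show ?thesis
      using C D ys Y poised V unfolding inverse_bound_def S_def
      by (metis (no_types, lifting) Diff_iff eqY insertI1)
  qed
  have C0: "0 \<le> C" using C by (simp add: inverse_bound_def)
  have FTu: "vec_norm (F\<^sup>T *\<^sub>v u) \<le> sqrt (real n) * b * C * vec_norm u" if u: "u \<in> carrier_vec m" for u
  proof -
    have SF: "S * F\<^sup>T \<in> carrier_mat n m" using S F by auto
    have "vec_norm ((S * F\<^sup>T) *\<^sub>v u) \<le> sqrt (real n) * b * vec_norm u"
    proof (rule vec_norm_mult_mat_le_rows[OF SF u _ b])
      fix i assume i: "i < n"
      let ?y = "ys ! i"
      have yx: "?y - x \<in> carrier_vec n" using yi[OF i] xc by auto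
      have "row (S * F\<^sup>T) i = (1 / D) \<cdot>\<^sub>v (F *\<^sub>v (?y - x))"
      proof (rule eq_vecI)
        fix j assume "j < dim_vec ((1 / D) \<cdot>\<^sub>v (F *\<^sub>v (?y - x)))"
        then have j: "j < m" using F by auto
        have rj: "row F j \<in> carrier_vec n" using F j by auto
        show "row (S * F\<^sup>T) i $ j = ((1 / D) \<cdot>\<^sub>v (F *\<^sub>v (?y - x))) $ j"
          using S F i j rowS[OF i] comm_scalar_prod[OF yx rj] smult_scalar_prod_distrib[OF yx rj] by simp
      qed (use S F in auto)
      moreover have "F *\<^sub>v (?y - x) = A *\<^sub>v (?y - x) - (r ?y - r x)"
        unfolding F_def minus_mult_distrib_mat_vec[OF A B yx]
        using interp_jac_props(2)[OF r Y yi(1)[OF i]] by (simp add: B_def)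
      moreover have "vec_norm (A *\<^sub>v (?y - x) - (r ?y - r x)) = vec_norm (r ?y - r x - A *\<^sub>v (?y - x))"
        using A yx funcset_mem[OF r xc] funcset_mem[OF r yi(2)[OF i]]
        by (intro vec_norm_minus_commute[of _ m]) auto
      ultimately have "vec_norm (row (S * F\<^sup>T) i) \<le> \<bar>1 / D\<bar> * (b * D)"
        using err[OF yi(1)[OF i]] by (simp add: vec_norm_smult mult_left_mono divide_right_mono)
      then show "vec_norm (row (S * F\<^sup>T) i) \<le> b" using D by simp
    qed
    moreover have "V *\<^sub>v ((S * F\<^sup>T) *\<^sub>v u) = F\<^sup>T *\<^sub>v u"
    proof -
      have z: "F\<^sup>T *\<^sub>v u \<in> carrier_vec n" using FT u by auto
      have "V *\<^sub>v (S *\<^sub>v (F\<^sup>T *\<^sub>v u)) = (V * S) *\<^sub>v (F\<^sup>T *\<^sub>v u)"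
        using assoc_mult_mat_vec[OF V S z] by simp
      then show ?thesis using assoc_mult_mat_vec[OF S FT u] SV z by simp
    qed
    moreover have "vec_norm (V *\<^sub>v ((S * F\<^sup>T) *\<^sub>v u)) \<le> mat_norm V * vec_norm ((S * F\<^sup>T) *\<^sub>v u)"
      using SF u by (intro vec_norm_mult_mat_le[OF V n] mult_mat_vec_carrier[OF SF])
    ultimately have "vec_norm (F\<^sup>T *\<^sub>v u) \<le> mat_norm V * vec_norm ((S * F\<^sup>T) *\<^sub>v u)" by metis
    also have "\<dots> \<le> C * (sqrt (real n) * b * vec_norm u)"
      using \<open>mat_norm V \<le> C\<close> \<open>vec_norm ((S * F\<^sup>T) *\<^sub>v u) \<le> _\<close> C0 by (intro mult_mono) auto
    finally show ?thesis by (simp add: mult_ac)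
  qed
  have "vec_norm ((F\<^sup>T)\<^sup>T *\<^sub>v v) \<le> sqrt (real n) * b * C * vec_norm v"
    using b C0 by (intro transpose_vec_norm_le[OF FT v FTu]) auto
  then show ?thesis by (simp add: F_def B_def)
qed

section \<open>Model accuracy along a run\<close>

lemma vec_convex_region: "vec_convex (region n P R)"
  unfolding region_def hull_def vec_convex_def by blast

lemma region_subset_carrier: "region n P R \<subseteq> carrier_vec n"
  unfolding region_def
proof (rule hull_minimal)
  show "(\<Union>k. vball n (iterate R k) (Delta_max P)) \<subseteq> carrier_vec n" by (auto simp: vball_def)
  show "vec_convex (carrier_vec n)" by (auto simp: vec_convex_def)
qed

lemma vball_subset_region: "vball n (iterate R k) (Delta_max P) \<subseteq> region n P R"
  unfolding region_def by (rule order_trans[OF _ hull_subset]) blast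

lemma region_segment:
  assumes x: "x \<in> region n P R" and y: "x + s \<in> region n P R" and s: "s \<in> carrier_vec n"
    and t: "0 \<le> t" "t \<le> 1"
  shows "x + t \<cdot>\<^sub>v s \<in> region n P R"
proof -
  have xc: "x \<in> carrier_vec n" using x region_subset_carrier by blast
  have "(1 - t) \<cdot>\<^sub>v x + t \<cdot>\<^sub>v (x + s) \<in> region n P R"
    using vec_convex_region x y t unfolding vec_convex_def by blast
  moreover have "(1 - t) \<cdot>\<^sub>v x + t \<cdot>\<^sub>v (x + s) = x + t \<cdot>\<^sub>v s"
    using xc s by (intro eq_vecI) (auto simp: algebra_simps)
  ultimately show ?thesis by simp
qed

text \<open>One run with all problem data fixed. The constants derived here may depend on the lower
  bound \<open>d0\<close> of \<open>kappa_d\<close>, but not on \<open>kappa_d\<close>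
  itself.\<close>

locale dfogn =
  fixes n m :: nat and r :: "real vec \<Rightarrow> real vec" and P :: params and R :: run
    and c1 c3 D0 f0 d0 eps epsC kappaH LJ rmax Jmax C :: real
  assumes n: "1 \<le> n" and r: "r \<in> carrier_vec n \<rightarrow> carrier_vec m"
    and c1: "1 / 2 \<le> c1" "c1 \<le> 1" and c3: "0 < c3" and d0: "0 < d0"
    and valid: "valid_params P c1 D0"
    and eps: "0 < eps" "eps \<le> 1" and epsC: "c3 * eps \<le> epsC"
    and run: "dfogn_run n m r P epsC D0 R" and f0: "lsq r (iterate R 0) = f0"
    and cauchy: "cauchy_decrease n m r P c1 R"
    and smooth: "smooth_bounded n m r P R LJ rmax Jmax"
    and kappaH: "1 \<le> kappaH" "\<And>k. mat_norm (Hmod n m r R k) \<le> kappaH"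
    and C: "inverse_bound n (Lambda P) C"
    and d0_le: "d0 \<le> kappa_d n C (Delta_max P) LJ rmax Jmax"
begin

abbreviation "x k \<equiv> iterate R k"
abbreviation "s k \<equiv> step R k"
abbreviation "J y \<equiv> jacobian n m r y"
abbreviation "f \<equiv> lsq r"
abbreviation "\<Delta> k \<equiv> radius P R k"
abbreviation "\<Delta>i k \<equiv> radius_init R k"
abbreviation "\<rho> k \<equiv> rho P R k"
abbreviation "gn k \<equiv> vec_norm (gmod n m r R k)"
abbreviation "\<kappa> \<equiv> kappa_d n C (Delta_max P) LJ rmax Jmax"

lemma params:
  "0 < D0" "D0 \<le> Delta_max P" "0 < mu P" "0 < gamma_dec P" "gamma_dec P < 1"
  "1 < gamma_inc P" "gamma_inc P \<le> gamma_inc_bar P"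
  "0 < alpha1 P" "alpha1 P < alpha2 P" "alpha2 P < 1"
  "0 < eta1 P" "eta1 P \<le> eta2 P" "eta2 P < 1"
  "0 < omega_S P" "omega_S P < 1" "0 < omega_C P" "omega_C P < 1" "0 < gamma_S P"
  using valid unfolding valid_params_def by blast+

text \<open>As the square root is at least 1, the admissible range of \<open>gamma_S\<close> lies
  below \<open>c1\<close>, the constant of \<open>step_lower\<close>. A safety step at a too small
  \<rho> will contradict that bound.\<close>

lemma gamma_S_less_c1: "gamma_S P < c1"
proof -
  have "gamma_S P < 2 * c1 / (1 + sqrt (1 + 2 * c1))" using valid unfolding valid_params_def by blast
  also have "\<dots> \<le> 2 * c1 / (1 + 1)"
    using c1 by (intro divide_left_mono mult_pos_pos add_mono) (auto simp: add_pos_nonneg)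
  finally show ?thesis by simp
qed

lemma run_at:
  "x k \<in> carrier_vec n" "\<And>i. i \<le> ncrit R k \<Longrightarrow> interp_set n (Yset R k i) (x k)"
  "criticality_phase n m r P epsC R k"
  "s k \<in> carrier_vec n" "vec_norm (s k) \<le> \<Delta> k"
  "is_safety P R k \<Longrightarrow> safety_update n P R k"
  "\<not> is_safety P R k \<Longrightarrow> tr_update n m r P R k"
  using run unfolding dfogn_run_def by metis+

section \<open>Smoothness on the region of the run and errors of poised models\<close>

lemma r_carrier: "y \<in> carrier_vec n \<Longrightarrow> r y \<in> carrier_vec m"
  using r by auto

lemma has_jacobian_J:
  assumes "y \<in> carrier_vec n"
  shows "has_jacobian n m r (J y) y"
proof -
  obtain A where A: "has_jacobian n m r A y"
    using smooth assms unfolding smooth_bounded_def C1_map_def by blast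
  then show ?thesis using jacobian_eqI[OF r assms A] by simp
qed

lemma J_carrier: "y \<in> carrier_vec n \<Longrightarrow> J y \<in> carrier_mat m n"
  using has_jacobian_J by (auto simp: has_jacobian_def)

lemma gradient_f: "y \<in> carrier_vec n \<Longrightarrow> gradient n f y = (J y)\<^sup>T *\<^sub>v r y"
  using gradient_lsq[OF r _ has_jacobian_J] .

lemma x_in_region: "x k \<in> region n P R"
proof -
  have "x k - x k = 0\<^sub>v n" using run_at(1)[of k] by auto
  then have "x k \<in> vball n (x k) (Delta_max P)"
    using run_at(1)[of k] params by (simp add: vball_def)
  then show ?thesis using vball_subset_region by blast
qed

lemma trial_in_region:
  assumes "v \<in> carrier_vec n" "vec_norm v \<le> Delta_max P"
  shows "x k + v \<in> region n P R"
  using vball_subset_region[of n R k P] run_at(1)[of k] assms vec_minus_self_add(1)[of "x k" n v]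
  by (auto simp: vball_def)

lemma bounds: 
  "0 \<le> LJ" "0 \<le> rmax" "0 \<le> Jmax" "0 \<le> C" "\<And>y. y \<in> region n P R \<Longrightarrow> vec_norm (r y) \<le> rmax"
proof -
  have mem: "vec_norm (r y) \<le> rmax \<and> mat_norm (J y) \<le> Jmax" if "y \<in> region n P R" for y
    using smooth that unfolding smooth_bounded_def by blast
  show "0 \<le> LJ" using smooth unfolding smooth_bounded_def by blast
  show "0 \<le> rmax" using mem[OF x_in_region[of 0]] vec_norm_nonneg order_trans by blast
  show "0 \<le> Jmax"
    using mem[OF x_in_region[of 0]] mat_norm_nonneg[OF J_carrier[OF run_at(1)] n] order_trans by blast
  show "0 \<le> C" using C by (simp add: inverse_bound_def)
  show "vec_norm (r y) \<le> rmax" if "y \<in> region n P R" for y using mem[OF that] by blast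
qed

lemma J_bound:
  assumes "y \<in> region n P R" "v \<in> carrier_vec n"
  shows "vec_norm (J y *\<^sub>v v) \<le> Jmax * vec_norm v"
proof -
  have "J y \<in> carrier_mat m n"
    using subsetD[OF region_subset_carrier assms(1)] by (rule J_carrier)
  then have "vec_norm (J y *\<^sub>v v) \<le> mat_norm (J y) * vec_norm v"
    using n assms(2) by (rule vec_norm_mult_mat_le)
  also have "\<dots> \<le> Jmax * vec_norm v"
    using smooth assms unfolding smooth_bounded_def by (intro mult_right_mono) auto
  finally show ?thesis .
qed

lemma J_lipschitz:
  assumes y: "y \<in> region n P R" and z: "z \<in> region n P R" and v: "v \<in> carrier_vec n"
  shows "vec_norm (J y *\<^sub>v v - J z *\<^sub>v v) \<le> LJ * vec_norm (y - z) * vec_norm v"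
proof -
  have c: "J y \<in> carrier_mat m n" "J z \<in> carrier_mat m n"
    using y z subsetD[OF region_subset_carrier] J_carrier by blast+
  have "vec_norm ((J y - J z) *\<^sub>v v) \<le> mat_norm (J y - J z) * vec_norm v"
    using c v by (intro vec_norm_mult_mat_le[OF _ n]) auto
  also have "\<dots> \<le> LJ * vec_norm (y - z) * vec_norm v"
    using smooth y z unfolding smooth_bounded_def by (intro mult_right_mono) auto
  finally show ?thesis using minus_mult_distrib_mat_vec[OF c v] by simp
qed

text \<open>Two uses of \<open>segment_increment_le\<close>: against 0 with the bounded Jacobian,
  and against the linear part with the Lipschitz one.\<close>

lemma increment_bounds:
  assumes v: "v \<in> carrier_vec n" and le: "vec_norm v \<le> Delta_max P"
  shows "vec_norm (r (x k + v) - r (x k)) \<le> Jmax * vec_norm v"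
    and "vec_norm (r (x k + v) - r (x k) - J (x k) *\<^sub>v v) \<le> LJ / 2 * (vec_norm v)\<^sup>2"
proof -
  have xc: "x k \<in> carrier_vec n" by (rule run_at)
  have seg: "x k + t \<cdot>\<^sub>v v \<in> region n P R" if "0 \<le> t" "t \<le> 1" for t
    using region_segment[OF x_in_region trial_in_region[OF v le] v that] .
  have jac: "has_jacobian n m r (J (x k + t \<cdot>\<^sub>v v)) (x k + t \<cdot>\<^sub>v v)" if "0 \<le> t" "t \<le> 1" for t
    using xc v by (intro has_jacobian_J) auto
  have Jc: "J (x k + t \<cdot>\<^sub>v v) *\<^sub>v v \<in> carrier_vec m" for t
    using xc v J_carrier[of "x k + t \<cdot>\<^sub>v v"] by auto
  have rc: "r (x k + v) - r (x k) \<in> carrier_vec m"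
    using r_carrier xc v by simp
  have "vec_norm (r (x k + v) - r (x k) - 0\<^sub>v m) \<le> Jmax * vec_norm v + 0 / 2"
  proof (rule segment_increment_le[OF r xc v zero_carrier_vec jac])
    fix t :: real assume t: "0 \<le> t" "t \<le> 1"
    have "J (x k + t \<cdot>\<^sub>v v) *\<^sub>v v - 0\<^sub>v m = J (x k + t \<cdot>\<^sub>v v) *\<^sub>v v" using Jc[of t] by auto
    then show "vec_norm (J (x k + t \<cdot>\<^sub>v v) *\<^sub>v v - 0\<^sub>v m) \<le> Jmax * vec_norm v + 0 * t"
      using J_bound[OF seg[OF t] v] by simp
  qed auto
  moreover have "r (x k + v) - r (x k) - 0\<^sub>v m = r (x k + v) - r (x k)" using rc by auto
  ultimately show "vec_norm (r (x k + v) - r (x k)) \<le> Jmax * vec_norm v" by simp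
  have "vec_norm (r (x k + v) - r (x k) - J (x k) *\<^sub>v v) \<le> 0 + LJ * (vec_norm v)\<^sup>2 / 2"
  proof (rule segment_increment_le[OF r xc v _ jac])
    show "J (x k) *\<^sub>v v \<in> carrier_vec m" using J_carrier[OF xc] v by auto
    fix t :: real assume t: "0 \<le> t" "t \<le> 1"
    have "x k + t \<cdot>\<^sub>v v - x k = t \<cdot>\<^sub>v v" using xc v by auto
    then show "vec_norm (J (x k + t \<cdot>\<^sub>v v) *\<^sub>v v - J (x k) *\<^sub>v v) \<le> 0 + LJ * (vec_norm v)\<^sup>2 * t"
      using J_lipschitz[OF seg[OF t] x_in_region[of k] v] t
      by (simp add: vec_norm_smult power2_eq_square mult_ac)
  qed auto
  then show "vec_norm (r (x k + v) - r (x k) - J (x k) *\<^sub>v v) \<le> LJ / 2 * (vec_norm v)\<^sup>2" by simp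
qed

text \<open>This is \<open>kappa_eg_r\<close> without its summand \<open>LJ\<close>, which accounts
  for moving the Jacobian away from the base point.\<close>

abbreviation "\<kappa>J \<equiv> LJ / 2 * sqrt (real n) * C"

lemma kappaJ: "0 \<le> \<kappa>J" "\<kappa>J \<le> kappa_eg_r n C LJ" "0 \<le> kappa_eg_r n C LJ"
  using bounds by (auto simp: kappa_eg_r_def algebra_simps)

text \<open>Taylor remainders at the nodes are at most \<open>LJ / 2 * D * D\<close>, so
  \<open>interp_jac_error\<close> applies with \<open>b = LJ / 2 * D\<close>.\<close>

lemma poised_jacobian_error:
  assumes Y: "interp_set n Y (x k)" and poised: "lambda_poised n (Lambda P) (x k) D Y"
    and D: "0 < D" "D \<le> Delta_max P" and v: "v \<in> carrier_vec n"
  shows "vec_norm ((J (x k) - interp_jac n m r (x k) Y) *\<^sub>v v) \<le> \<kappa>J * D * vec_norm v"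
proof -
  have xc: "x k \<in> carrier_vec n" by (rule run_at)
  have "vec_norm ((J (x k) - interp_jac n m r (x k) Y) *\<^sub>v v)
      \<le> sqrt (real n) * (LJ / 2 * D) * C * vec_norm v"
  proof (rule interp_jac_error[OF n r Y poised D(1) C J_carrier[OF xc] _ _ v])
    show "0 \<le> LJ / 2 * D" using bounds D by simp
    fix y assume "y \<in> Y"
    then have y: "y \<in> carrier_vec n" "vec_norm (y - x k) \<le> D"
      using poised by (auto simp: lambda_poised_def vball_def)
    have "vec_norm (r (x k + (y - x k)) - r (x k) - J (x k) *\<^sub>v (y - x k)) \<le> LJ / 2 * (vec_norm (y - x k))\<^sup>2"
      using y xc D by (intro increment_bounds) auto
    also have "\<dots> \<le> LJ / 2 * D\<^sup>2" using y bounds by (intro mult_left_mono power_mono) auto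
    finally show "vec_norm (r y - r (x k) - J (x k) *\<^sub>v (y - x k)) \<le> LJ / 2 * D * D"
      unfolding vec_minus_self_add(2)[OF xc y(1)] by (simp add: power2_eq_square)
  qed
  then show ?thesis by (simp add: mult_ac)
qed

lemma kappa_d_eq: "\<kappa> = kappa_ef n C (Delta_max P) LJ rmax Jmax"
  using bounds by (simp add: kappa_d_def kappa_ef_def L_grad_def)

lemma kappaJ_rmax_le: "\<kappa>J * rmax \<le> \<kappa>"
proof -
  have "\<kappa>J * rmax \<le> kappa_eg_r n C LJ * rmax" using kappaJ bounds by (intro mult_right_mono) auto
  moreover have "0 \<le> L_grad LJ rmax Jmax" using bounds by (simp add: L_grad_def)
  moreover have "0 \<le> (kappa_eg_r n C LJ * Delta_max P + Jmax)\<^sup>2" by simp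
  ultimately have "\<kappa>J * rmax \<le> kappa_eg n C (Delta_max P) LJ rmax Jmax"
    unfolding kappa_eg_def by (intro add_increasing2 add_increasing)
  then show ?thesis by (simp add: kappa_d_def)
qed

text \<open>At the base point the two gradients differ only by the transposed Jacobians applied to
  the same residual. \<open>Y\<close> and \<open>D\<close> are left free because the bound is also
  applied to criticality passes that do not end the loop.\<close>

lemma poised_gradient_error:
  assumes Y: "interp_set n Y (x k)" and poised: "lambda_poised n (Lambda P) (x k) D Y"
    and D: "0 < D" "D \<le> Delta_max P"
  shows "vec_norm (gradient n f (x k)) \<le> vec_norm (model_grad r (x k) (interp_jac n m r (x k) Y)) + \<kappa> * D"
proof -
  let ?A = "J (x k)" and ?B = "interp_jac n m r (x k) Y"
  have xc: "x k \<in> carrier_vec n" by (rule run_at)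
  have A: "?A \<in> carrier_mat m n" by (rule J_carrier[OF xc])
  have B: "?B \<in> carrier_mat m n" by (rule interp_jac_props[OF r Y])
  have rx: "r (x k) \<in> carrier_vec m" by (rule r_carrier[OF xc])
  have "vec_norm ((?A - ?B)\<^sup>T *\<^sub>v r (x k)) \<le> \<kappa>J * D * vec_norm (r (x k))"
    using A B kappaJ D by (intro transpose_vec_norm_le[OF _ rx poised_jacobian_error[OF Y poised D]]) auto
  also have "\<dots> \<le> \<kappa>J * D * rmax"
    by (rule mult_left_mono[OF bounds(5)[OF x_in_region] mult_nonneg_nonneg[OF kappaJ(1) less_imp_le[OF D(1)]]])
  also have "\<dots> \<le> \<kappa> * D" using mult_right_mono[OF kappaJ_rmax_le, of D] D by (simp add: mult_ac)
  finally have err: "vec_norm ((?A - ?B)\<^sup>T *\<^sub>v r (x k)) \<le> \<kappa> * D" .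
  have "?A\<^sup>T *\<^sub>v r (x k) = ?B\<^sup>T *\<^sub>v r (x k) + (?A - ?B)\<^sup>T *\<^sub>v r (x k)"
    unfolding transpose_minus[OF A B] using A B rx
    by (subst minus_mult_distrib_mat_vec[of _ n m]) (auto intro!: eq_vecI)
  then have "vec_norm (?A\<^sup>T *\<^sub>v r (x k)) \<le> vec_norm (?B\<^sup>T *\<^sub>v r (x k)) + vec_norm ((?A - ?B)\<^sup>T *\<^sub>v r (x k))"
    using vec_norm_triangle[OF mult_mat_vec_carrier[OF _ rx] mult_mat_vec_carrier[OF _ rx],
        of "?B\<^sup>T" n "(?A - ?B)\<^sup>T"] B minus_carrier_mat[OF B, of ?A] by auto
  then show ?thesis using err by (simp add: gradient_f[OF xc] model_grad_def)
qed

text \<open>\<open>lsq_diff\<close> expresses the error through the linearization error of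
  \<open>r\<close> and two squares of opposite sign, each estimated on its own.\<close>

lemma poised_model_error:
  assumes Y: "interp_set n Y (x k)" and poised: "lambda_poised n (Lambda P) (x k) D Y"
    and D: "0 < D" "D \<le> Delta_max P" and v: "v \<in> carrier_vec n" "vec_norm v \<le> D"
  shows "\<bar>f (x k + v) - model_val r (x k) (interp_jac n m r (x k) Y) v\<bar> \<le> \<kappa> * D\<^sup>2"
proof -
  let ?A = "J (x k)" and ?B = "interp_jac n m r (x k) Y"
  let ?d = "r (x k + v) - r (x k)"
  have xc: "x k \<in> carrier_vec n" by (rule run_at)
  have vD: "vec_norm v \<le> Delta_max P" using v D by simp
  have A: "?A \<in> carrier_mat m n" by (rule J_carrier[OF xc])
  have B: "?B \<in> carrier_mat m n" by (rule interp_jac_props[OF r Y])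
  have rx: "r (x k) \<in> carrier_vec m" by (rule r_carrier[OF xc])
  have rv: "r (x k + v) \<in> carrier_vec m" using xc v by (intro r_carrier) auto
  have d: "?d \<in> carrier_vec m" using rx rv by auto
  have Av: "?A *\<^sub>v v \<in> carrier_vec m" and Bv: "?B *\<^sub>v v \<in> carrier_vec m" using A B v by auto
  have AB: "vec_norm (?A *\<^sub>v v - ?B *\<^sub>v v) \<le> \<kappa>J * D * vec_norm v"
    using poised_jacobian_error[OF Y poised D v(1)] minus_mult_distrib_mat_vec[OF A B v(1)] by simp
  also have "\<dots> \<le> \<kappa>J * D * D" using kappaJ D v by (intro mult_left_mono) auto
  finally have AB2: "vec_norm (?A *\<^sub>v v - ?B *\<^sub>v v) \<le> \<kappa>J * D\<^sup>2" by (simp add: power2_eq_square)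
  have dA: "vec_norm (?d - ?A *\<^sub>v v) \<le> LJ / 2 * D\<^sup>2"
    using increment_bounds(2)[OF v(1) vD, of k] mult_left_mono[OF power_mono[OF v(2), of 2], of "LJ / 2"] bounds
    by simp
  have "vec_norm (?d - ?B *\<^sub>v v) = vec_norm ((?d - ?A *\<^sub>v v) + (?A *\<^sub>v v - ?B *\<^sub>v v))"
    using rx rv A B v by (intro arg_cong[where f = vec_norm] eq_vecI) auto
  also have "\<dots> \<le> LJ / 2 * D\<^sup>2 + \<kappa>J * D\<^sup>2"
    using vec_norm_triangle[of "?d - ?A *\<^sub>v v" m "?A *\<^sub>v v - ?B *\<^sub>v v"] d Av Bv dA AB2 by auto
  \<comment> \<open>\<open>kappa_eg_r\<close> equals \<open>\<kappa>J + LJ\<close>, at least the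
    \<open>LJ / 2 + \<kappa>J\<close> collected here.\<close>
  also have "\<dots> \<le> kappa_eg_r n C LJ * D\<^sup>2"
    unfolding distrib_right[symmetric] using bounds
    by (intro mult_right_mono) (auto simp: kappa_eg_r_def algebra_simps)
  finally have dB: "vec_norm (?d - ?B *\<^sub>v v) \<le> kappa_eg_r n C LJ * D\<^sup>2" .
  have "vec_norm (?B *\<^sub>v v) = vec_norm (?A *\<^sub>v v - (?A *\<^sub>v v - ?B *\<^sub>v v))"
    using A B v by (intro arg_cong[where f = vec_norm] eq_vecI) auto
  also have "\<dots> \<le> vec_norm (?A *\<^sub>v v) + vec_norm (?A *\<^sub>v v - ?B *\<^sub>v v)"
    using Av Bv by (intro vec_norm_triangle_minus) auto
  also have "\<dots> \<le> Jmax * D + \<kappa>J * D * D"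
    using order_trans[OF J_bound[OF x_in_region v(1)] mult_left_mono[OF v(2) bounds(3)]] AB2
    by (intro add_mono) (auto simp: power2_eq_square mult_ac)
  also have "\<dots> \<le> (kappa_eg_r n C LJ * Delta_max P + Jmax) * D"
    using mult_right_mono[OF mult_mono[OF kappaJ(2) D(2) kappaJ(3)], of D] D kappaJ
    by (simp add: algebra_simps)
  finally have Bn: "vec_norm (?B *\<^sub>v v) \<le> (kappa_eg_r n C LJ * Delta_max P + Jmax) * D" .
  have dn: "vec_norm ?d \<le> Jmax * D"
    using order_trans[OF increment_bounds(1)[OF v(1) vD] mult_left_mono[OF v(2) bounds(3)]] .
  have half_square_le: "a\<^sup>2 / 2 \<le> a\<^sup>2" for a :: real
    by simp
  have "f (x k + v) - model_val r (x k) ?B v =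
      r (x k) \<bullet> (?d - ?B *\<^sub>v v) + (vec_norm ?d)\<^sup>2 / 2 - (vec_norm (?B *\<^sub>v v))\<^sup>2 / 2"
    using lsq_diff[where r = r, OF rx rv] vec_norm_add_power2[OF rx Bv] scalar_prod_minus_distrib[OF rx d Bv]
    by (simp add: model_val_def lsq_def field_simps)
  moreover have "\<bar>r (x k) \<bullet> (?d - ?B *\<^sub>v v)\<bar> \<le> kappa_eg_r n C LJ * rmax * D\<^sup>2"
  proof -
    have "\<bar>r (x k) \<bullet> (?d - ?B *\<^sub>v v)\<bar> \<le> vec_norm (r (x k)) * vec_norm (?d - ?B *\<^sub>v v)"
      using rx d Bv by (intro scalar_prod_le_vec_norm) auto
    also have "\<dots> \<le> rmax * (kappa_eg_r n C LJ * D\<^sup>2)"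
      using bounds(5)[OF x_in_region] dB bounds by (intro mult_mono) auto
    finally show ?thesis by (simp add: mult_ac)
  qed
  moreover have "(vec_norm ?d)\<^sup>2 / 2 \<le> Jmax\<^sup>2 * D\<^sup>2"
    using order_trans[OF half_square_le power_mono[OF dn vec_norm_nonneg]] by (simp add: power_mult_distrib)
  moreover have "(vec_norm (?B *\<^sub>v v))\<^sup>2 / 2 \<le> (kappa_eg_r n C LJ * Delta_max P + Jmax)\<^sup>2 * D\<^sup>2"
    using order_trans[OF half_square_le power_mono[OF Bn vec_norm_nonneg]] by (simp add: power_mult_distrib)
  moreover have "kappa_eg_r n C LJ * rmax * D\<^sup>2 + Jmax\<^sup>2 * D\<^sup>2 +
      (kappa_eg_r n C LJ * Delta_max P + Jmax)\<^sup>2 * D\<^sup>2 \<le> \<kappa> * D\<^sup>2"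
  proof -
    define T where "T = (kappa_eg_r n C LJ * Delta_max P + Jmax)\<^sup>2"
    have "0 \<le> rmax * LJ" "0 \<le> 1 / 2 * (rmax * LJ + Jmax\<^sup>2 + T)" using bounds by (auto simp: T_def)
    then have "kappa_eg_r n C LJ * rmax + Jmax\<^sup>2 + T \<le>
        rmax * LJ + Jmax\<^sup>2 + kappa_eg_r n C LJ * rmax + T + 1 / 2 * (rmax * LJ + Jmax\<^sup>2 + T)"
      by simp
    then have "kappa_eg_r n C LJ * rmax + Jmax\<^sup>2 + T \<le> \<kappa>"
      unfolding kappa_d_eq kappa_ef_def kappa_eg_def L_grad_def T_def[symmetric] .
    then show ?thesis
      unfolding distrib_right[symmetric] T_def by (intro mult_right_mono) auto
  qed
  moreover have "0 \<le> (vec_norm ?d)\<^sup>2 / 2" "0 \<le> (vec_norm (?B *\<^sub>v v))\<^sup>2 / 2" by auto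
  ultimately show ?thesis unfolding abs_le_iff by linarith
qed


section \<open>Radii, model gradients and decrease\<close>

abbreviation "safe k \<equiv> is_safety P R k"
abbreviation "rat k \<equiv> ratio n m r R k"
abbreviation "poised k \<equiv> lambda_poised n (Lambda P) (x k) (\<Delta> k) (Yfin R k)"
text \<open>Every iteration falls into one of these three classes. Safety and unsuccessful
  iterations are merged because both cut the radius by at least a fixed factor.\<close>

abbreviation "succ k \<equiv> \<not> safe k \<and> eta1 P \<le> rat k"
abbreviation "improve k \<equiv> \<not> safe k \<and> rat k < eta1 P \<and> \<not> poised k"
abbreviation "shrink k \<equiv> safe k \<or> (rat k < eta1 P \<and> poised k)"

text \<open>Also right without a criticality phase: the truncated exponent is then 0, as it is after
  a single pass.\<close>

lemma radius_ncrit: "\<Delta> k = omega_C P ^ (ncrit R k - 1) * \<Delta>i k"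
  by (simp add: radius_def crit_radius_def)

text \<open>Conditional on the starting values, because \<open>init_bounds\<close> needs it inside
  its induction.\<close>

lemma rho_radius_bounds_if:
  assumes "0 < rho_init R k" "rho_init R k \<le> \<Delta>i k"
  shows "0 < \<rho> k \<and> \<rho> k \<le> \<Delta> k \<and> \<Delta> k \<le> \<Delta>i k \<and> \<rho> k \<le> rho_init R k"
proof -
  have w: "0 < omega_C P ^ i" "omega_C P ^ i \<le> 1" for i
    using params power_le_one[of "omega_C P" i] by auto
  have "\<Delta> k \<le> 1 * \<Delta>i k"
    unfolding radius_ncrit using assms w by (intro mult_right_mono) auto
  moreover have "0 < \<Delta> k" unfolding radius_ncrit using assms w by simp
  ultimately show ?thesis using assms by (auto simp: rho_def radius_def)
qed

text \<open>The last claim tells what a radius equal to \<rho> after a rejected step reveals: one of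
  the two candidates in the minimum has come down to \<rho>. In \<open>rho_lower\<close> this bounds
  \<rho> from below.\<close>

lemma tr_radius_bounds:
  assumes "0 < \<rho> k" "\<rho> k \<le> \<Delta> k" "\<Delta> k \<le> Delta_max P"
  shows "\<rho> k \<le> tr_radius n m r P R k" "tr_radius n m r P R k \<le> Delta_max P"
    "tr_radius n m r P R k \<le> gamma_inc_bar P * \<Delta> k"
    "rat k < eta1 P \<Longrightarrow> tr_radius n m r P R k \<le> \<Delta> k"
    "rat k < eta1 P \<Longrightarrow> tr_radius n m r P R k \<noteq> \<rho> k \<Longrightarrow> tr_radius n m r P R k \<le> gamma_dec P * \<Delta> k"
    "rat k < eta1 P \<Longrightarrow> tr_radius n m r P R k = \<rho> k \<Longrightarrow>
      gamma_dec P * \<Delta> k \<le> \<rho> k \<or> vec_norm (s k) \<le> \<rho> k"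
proof -
  have D: "0 < \<Delta> k" using assms by simp
  have a: "gamma_dec P * \<Delta> k \<le> 1 * \<Delta> k" "1 * \<Delta> k \<le> gamma_inc P * \<Delta> k"
    "gamma_inc P * \<Delta> k \<le> gamma_inc_bar P * \<Delta> k" "1 * \<Delta> k \<le> gamma_inc_bar P * \<Delta> k"
    using D params by (intro mult_right_mono; simp)+
  have b: "gamma_inc_bar P * vec_norm (s k) \<le> gamma_inc_bar P * \<Delta> k"
    using params run_at(5)[of k] by (intro mult_left_mono) auto
  \<comment> \<open>Naming the products keeps the case analysis over \<open>max\<close> and
    \<open>min\<close> linear.\<close>
  define p q t u where "p = gamma_dec P * \<Delta> k" and "q = gamma_inc P * \<Delta> k"
    and "t = gamma_inc_bar P * \<Delta> k" and "u = gamma_inc_bar P * vec_norm (s k)"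
  note defs = p_def[symmetric] q_def[symmetric] t_def[symmetric] u_def[symmetric]
  have "p \<le> \<Delta> k" "\<Delta> k \<le> q" "q \<le> t" "\<Delta> k \<le> t" "u \<le> t"
    using a b by (simp_all add: defs)
  with run_at(5)[of k] assms params(12)
  show "\<rho> k \<le> tr_radius n m r P R k" "tr_radius n m r P R k \<le> Delta_max P"
    "tr_radius n m r P R k \<le> gamma_inc_bar P * \<Delta> k"
    "rat k < eta1 P \<Longrightarrow> tr_radius n m r P R k \<le> \<Delta> k"
    "rat k < eta1 P \<Longrightarrow> tr_radius n m r P R k \<noteq> \<rho> k \<Longrightarrow> tr_radius n m r P R k \<le> gamma_dec P * \<Delta> k"
    "rat k < eta1 P \<Longrightarrow> tr_radius n m r P R k = \<rho> k \<Longrightarrow>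
      gamma_dec P * \<Delta> k \<le> \<rho> k \<or> vec_norm (s k) \<le> \<rho> k"
    unfolding tr_radius_def defs by (auto simp: max_def min_def split: if_splits)
qed

text \<open>The order survives a reset because \<open>alpha1\<close> is below \<open>alpha2\<close>,
  the upper bound because \<open>alpha2\<close> is below 1.\<close>

lemma init_bounds: "0 < rho_init R k \<and> rho_init R k \<le> \<Delta>i k \<and> \<Delta>i k \<le> Delta_max P"
proof (induction k)
  case 0
  then show ?case using run params by (auto simp: dfogn_run_def)
next
  case (Suc k)
  have b: "0 < \<rho> k" "\<rho> k \<le> \<Delta> k" "\<Delta> k \<le> Delta_max P"
    using rho_radius_bounds_if[of k] Suc by auto
  have reset: ?case if "reset_or_keep P R k D" "\<rho> k \<le> D" "D \<le> Delta_max P" for D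
  proof -
    have "alpha1 P * \<rho> k \<le> alpha2 P * \<rho> k" "alpha2 P * \<rho> k \<le> 1 * \<rho> k"
      using params b by (intro mult_right_mono; simp)+
    then have "alpha2 P * \<rho> k \<le> Delta_max P" using b by linarith
    then show ?thesis using that b params by (auto simp: reset_or_keep_def split: if_splits)
  qed
  show ?case
  proof (cases "safe k")
    case True
    have "omega_S P * \<Delta> k \<le> 1 * \<Delta> k" using params b by (intro mult_right_mono) auto
    moreover have res: "reset_or_keep P R k (max (\<rho> k) (omega_S P * \<Delta> k))"
      using run_at(6)[OF True] by (simp add: safety_update_def Let_def)
    ultimately show ?thesis using b by (intro reset[OF res]) linarith+
  next
    case False
    note D = tr_radius_bounds(1,2)[OF b]
    have "reset_or_keep P R k (tr_radius n m r P R k) \<or>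
        rho_init R (Suc k) = \<rho> k \<and> \<Delta>i (Suc k) = tr_radius n m r P R k"
      using run_at(7)[OF False] by (auto simp: tr_update_def Let_def split: if_splits)
    then show ?thesis using reset[OF _ D] D b by auto
  qed
qed

lemma rho_radius_bounds:
  "0 < \<rho> k" "\<rho> k \<le> \<Delta> k" "\<Delta> k \<le> Delta_max P" "0 < \<Delta> k" "\<rho> k \<le> rho_init R k" "0 < \<Delta>i k"
  using rho_radius_bounds_if[of k] init_bounds[of k] by auto

lemma interp_set_Yfin: "interp_set n (Yfin R k) (x k)"
  unfolding Yfin_def by (rule run_at) simp

lemma Jmod_carrier: "Jmod n m r R k \<in> carrier_mat m n"
  unfolding Jmod_def by (rule interp_jac_props[OF r interp_set_Yfin])

lemma kappa_pos: "0 < \<kappa>"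
  using d0 d0_le by simp

section \<open>Criticality phase and model gradients\<close>

lemma critical_poised:
  assumes "ncrit R k \<noteq> 0"
  shows "poised k" "\<Delta> k \<le> mu P * gn k"
proof -
  have "criticality_phase n m r P epsC R k" by (rule run_at)
  then have *: "\<forall>i\<in>{1..ncrit R k}.
           lambda_poised n (Lambda P) (x k) (crit_radius P R k i) (Yset R k i) \<and>
           (crit_radius P R k i \<le> mu P * vec_norm (crit_grad n m r R k i)
              \<longleftrightarrow> i = ncrit R k)"
    using assms unfolding criticality_phase_def by (meson not_one_le_zero)
  have "ncrit R k \<in> {1..ncrit R k}" using assms by simp
  note bspec[OF * this]
  then show "poised k" "\<Delta> k \<le> mu P * gn k"
    using assms by (auto simp: radius_def Yfin_def crit_grad_def gmod_def Jmod_def)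
qed

lemma noncritical_gradient: "ncrit R k = 0 \<Longrightarrow> c3 * eps < gn k"
  using run_at(3)[of k] epsC
  by (auto simp: criticality_phase_def crit_grad_def gmod_def Jmod_def Yfin_def split: if_splits)

lemma gradient_le_model_gradient:
  assumes "poised k"
  shows "vec_norm (gradient n f (x k)) \<le> gn k + \<kappa> * \<Delta> k"
  using poised_gradient_error[OF interp_set_Yfin assms rho_radius_bounds(4,3)]
  by (simp add: gmod_def Jmod_def)

text \<open>The radius is cut only after a failed pass. The penultimate pass has a poised set of
  radius \<open>?D\<close> and a model gradient below \<open>?D / mu P\<close>, so
  \<open>eps\<close> is at most \<open>?D * (\<kappa> + 1 / mu P)\<close>; the final radius is
  \<open>omega_C P * ?D\<close>.\<close>

lemma critical_radius_lower:
  assumes big: "eps \<le> vec_norm (gradient n f (x k))"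
  shows "min (\<Delta>i k) (omega_C P * eps / (\<kappa> + 1 / mu P)) \<le> \<Delta> k"
proof (cases "ncrit R k \<le> 1")
  case True
  then show ?thesis by (auto simp: radius_ncrit)
next
  case False
  then obtain i where i: "ncrit R k = Suc (Suc i)"
    by (metis One_nat_def Suc_pred' bot_nat_0.not_eq_extremum less_Suc0 not_le_imp_less less_imp_Suc_add plus_1_eq_Suc)
  let ?D = "crit_radius P R k (Suc i)"
  have "criticality_phase n m r P epsC R k" by (rule run_at)
  moreover have "ncrit R k \<noteq> 0" "Suc i \<in> {1..ncrit R k}" "Suc i \<noteq> ncrit R k" using i by auto
  ultimately have *: "lambda_poised n (Lambda P) (x k) ?D (Yset R k (Suc i))"
    "\<not> ?D \<le> mu P * vec_norm (crit_grad n m r R k (Suc i))"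
    unfolding criticality_phase_def by (metis (no_types, lifting))+
  have DD: "\<Delta> k = omega_C P * ?D" by (simp add: radius_ncrit crit_radius_def i)
  then have Dpos: "0 < ?D" using rho_radius_bounds(4)[of k] params by (simp add: zero_less_mult_iff)
  have "?D \<le> 1 * \<Delta>i k"
    unfolding crit_radius_def using params rho_radius_bounds(6)[of k]
    by (intro mult_right_mono) (auto intro!: power_le_one)
  then have Dmax: "?D \<le> Delta_max P" using init_bounds[of k] by simp
  have "eps \<le> vec_norm (crit_grad n m r R k (Suc i)) + \<kappa> * ?D"
    using big poised_gradient_error[OF run_at(2) *(1) Dpos Dmax] i by (simp add: crit_grad_def)
  moreover have "vec_norm (crit_grad n m r R k (Suc i)) \<le> ?D / mu P"
    using *(2) params by (simp add: field_simps)
  ultimately have "eps \<le> ?D * (\<kappa> + 1 / mu P)" by (simp add: algebra_simps)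
  then have "eps / (\<kappa> + 1 / mu P) \<le> ?D"
    using kappa_pos params by (simp add: pos_divide_le_eq add_pos_pos)
  then have "omega_C P * (eps / (\<kappa> + 1 / mu P)) \<le> \<Delta> k"
    unfolding DD using params by (intro mult_left_mono) auto
  then show ?thesis by simp
qed

text \<open>Bounding the model gradient by \<open>eps / \<kappa>\<close> and the radius by its worst case at the same time would
  lose a factor \<open>\<kappa>\<close>. But the model gradient can be much smaller than \<open>eps\<close> only if the criticality
  phase stopped with a radius of order \<open>eps / \<kappa>\<close>.\<close>

lemma model_gradient_cases:
  assumes big: "eps \<le> vec_norm (gradient n f (x k))"
  shows "min c3 (1 / 2) * eps \<le> gn k \<or> eps / (2 * \<kappa>) \<le> \<Delta> k \<and> \<Delta> k \<le> mu P * gn k"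
proof (cases "ncrit R k = 0")
  case True
  have "min c3 (1 / 2) * eps \<le> c3 * eps" using eps by (intro mult_right_mono) auto
  then show ?thesis using noncritical_gradient[OF True] by simp
next
  case False
  have e: "eps \<le> gn k + \<kappa> * \<Delta> k"
    using big gradient_le_model_gradient[OF critical_poised(1)[OF False]] by simp
  show ?thesis
  proof (cases "eps / 2 \<le> gn k")
    case True
    have "min c3 (1 / 2) * eps \<le> 1 / 2 * eps" using eps by (intro mult_right_mono) auto
    then show ?thesis using True by simp
  next
    case False
    then have "eps / 2 \<le> \<kappa> * \<Delta> k" using e by simp
    then have "eps / (2 * \<kappa>) \<le> \<Delta> k" using kappa_pos by (simp add: field_simps)
    then show ?thesis using critical_poised(2)[OF \<open>ncrit R k \<noteq> 0\<close>] by simp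
  qed
qed

section \<open>Model decrease, step length and success\<close>

lemma model_decrease_lower:
  "c1 * gn k * min (\<Delta> k) (gn k / kappaH) \<le> model_decrease n m r R k"
proof -
  have "gn k / kappaH \<le> gn k / max (mat_norm (Hmod n m r R k)) 1"
    using kappaH by (intro divide_left_mono) auto
  then have "c1 * gn k * min (\<Delta> k) (gn k / kappaH)
      \<le> c1 * gn k * min (\<Delta> k) (gn k / max (mat_norm (Hmod n m r R k)) 1)"
    using c1 by (intro mult_left_mono mult_nonneg_nonneg) auto
  also have "\<dots> \<le> model_decrease n m r R k" using cauchy unfolding cauchy_decrease_def by blast
  finally show ?thesis .
qed

lemma model_decrease_upper: "model_decrease n m r R k \<le> gn k * vec_norm (s k)"
proof -
  let ?A = "Jmod n m r R k"
  have A: "?A \<in> carrier_mat m n" by (rule Jmod_carrier)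
  have s: "s k \<in> carrier_vec n" by (rule run_at)
  have rx: "r (x k) \<in> carrier_vec m" by (rule r_carrier[OF run_at(1)])
  have As: "?A *\<^sub>v s k \<in> carrier_vec m" using A s by auto
  have "?A *\<^sub>v 0\<^sub>v n = 0\<^sub>v m" using A by (intro eq_vecI) auto
  then have "model_decrease n m r R k = - (r (x k) \<bullet> (?A *\<^sub>v s k)) - (vec_norm (?A *\<^sub>v s k))\<^sup>2 / 2"
    using rx vec_norm_add_power2[OF rx As] by (simp add: model_decrease_def model_val_def field_simps)
  also have "\<dots> \<le> \<bar>r (x k) \<bullet> (?A *\<^sub>v s k)\<bar>" by (smt (verit) zero_le_power2 divide_nonneg_nonneg)
  also have "\<dots> = \<bar>gmod n m r R k \<bullet> s k\<bar>"
    by (simp add: gmod_def model_grad_def transpose_vec_mult_scalar[OF A s rx])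
  also have "\<dots> \<le> gn k * vec_norm (s k)"
    using A rx s by (intro scalar_prod_le_vec_norm[of _ n]) (auto simp: gmod_def model_grad_def)
  finally show ?thesis .
qed

text \<open>The Hessian of a Gauss-Newton model is positive semidefinite, so the step bound holds with
  \<open>c1\<close>, which is at least the usual constant \<open>2 c1 / (1 + sqrt (1 + 2 c1))\<close>.\<close>

lemma step_lower:
  assumes "0 < gn k"
  shows "c1 * min (\<Delta> k) (gn k / kappaH) \<le> vec_norm (s k)"
proof -
  have "gn k * (c1 * min (\<Delta> k) (gn k / kappaH)) \<le> gn k * vec_norm (s k)"
    using order_trans[OF model_decrease_lower model_decrease_upper] by (simp add: mult_ac)
  then show ?thesis using assms by simp
qed

text \<open>The first smallness condition makes the Cauchy decrease at least
  \<open>c1 * gn k * \<Delta> k\<close>; the second keeps the model error within the fraction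
  \<open>1 - eta1 P\<close> of it. Only the trial value contributes an error, as the model is exact
  at the current iterate.\<close>

lemma small_radius_successful:
  assumes g: "0 < gn k" and poised: "poised k"
    and small: "\<Delta> k \<le> gn k / kappaH" "\<Delta> k \<le> c1 * (1 - eta1 P) / \<kappa> * gn k"
  shows "eta1 P \<le> rat k"
proof -
  let ?M = "model_decrease n m r R k"
  have D: "0 < \<Delta> k" by (rule rho_radius_bounds)
  have lo: "c1 * gn k * \<Delta> k \<le> ?M" using model_decrease_lower[of k] small(1) by (simp add: min_absorb1)
  have pos: "0 < c1 * gn k * \<Delta> k" using c1 g D by simp
  then have M: "0 < ?M" using lo by simp
  have sc: "s k \<in> carrier_vec n" "vec_norm (s k) \<le> \<Delta> k" by (rule run_at)+
  have e: "\<bar>f (x k + s k) - model_val r (x k) (Jmod n m r R k) (s k)\<bar> \<le> \<kappa> * (\<Delta> k)\<^sup>2"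
    unfolding Jmod_def
    by (rule poised_model_error[OF interp_set_Yfin poised rho_radius_bounds(4,3) sc])
  have "Jmod n m r R k *\<^sub>v 0\<^sub>v n = 0\<^sub>v m" using Jmod_carrier[of k] by (intro eq_vecI) auto
  then have "model_val r (x k) (Jmod n m r R k) (0\<^sub>v n) = f (x k)"
    using r_carrier[OF run_at(1), of k] by (simp add: model_val_def lsq_def)
  then have "?M - \<kappa> * (\<Delta> k)\<^sup>2 \<le> f (x k) - f (x k + s k)"
    using e by (simp add: model_decrease_def)
  moreover have "\<kappa> * (\<Delta> k)\<^sup>2 \<le> (1 - eta1 P) * ?M"
  proof -
    have "\<kappa> * \<Delta> k \<le> c1 * (1 - eta1 P) * gn k"
      using small(2) kappa_pos by (simp add: field_simps)
    then have "\<kappa> * \<Delta> k * \<Delta> k \<le> c1 * (1 - eta1 P) * gn k * \<Delta> k"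
      using D by (intro mult_right_mono) auto
    also have "\<dots> = (1 - eta1 P) * (c1 * gn k * \<Delta> k)" by simp
    also have "\<dots> \<le> (1 - eta1 P) * ?M" using lo params by (intro mult_left_mono) auto
    finally show ?thesis by (simp add: power2_eq_square)
  qed
  ultimately have "eta1 P * ?M \<le> f (x k) - f (x k + s k)" by (simp add: algebra_simps)
  then show ?thesis using M by (simp add: ratio_def pos_le_divide_eq)
qed

lemma f_nonneg: "0 \<le> f y"
  by (simp add: lsq_def)

lemma f_Suc_le:
  "f (x (Suc k)) \<le> f (x k) - of_bool (succ k) * (eta1 P * (c1 * gn k * min (\<Delta> k) (gn k / kappaH)))"
proof (cases "succ k")
  case True
  let ?b = "c1 * gn k * min (\<Delta> k) (gn k / kappaH)"
  have b: "0 \<le> ?b" using c1 kappaH rho_radius_bounds(4)[of k] by simp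
  have x: "x (Suc k) = x k + s k" using run_at(7)[of k] True by (auto simp: tr_update_def Let_def)
  have "eta1 P * model_decrease n m r R k \<le> f (x k) - f (x k + s k)"
  proof (cases "model_decrease n m r R k = 0")
    case True
    \<comment> \<open>Division by zero makes the ratio 0, below \<open>eta1 P\<close>, so a
      successful step cannot have zero model decrease.\<close>
    then show ?thesis using \<open>succ k\<close> params by (simp add: ratio_def)
  next
    case False
    then have "0 < model_decrease n m r R k" using order_trans[OF b model_decrease_lower] by simp
    then show ?thesis using True by (simp add: ratio_def pos_le_divide_eq)
  qed
  moreover have "eta1 P * ?b \<le> eta1 P * model_decrease n m r R k"
    using model_decrease_lower params by (intro mult_left_mono) auto
  ultimately show ?thesis using True x by simp
next
  case False
  then have "x (Suc k) = x k"
    using run_at(6,7)[of k] by (cases "safe k") (auto simp: safety_update_def tr_update_def Let_def)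
  then show ?thesis using False by auto
qed

text \<open>The new set is poised for the very radius with which the next iteration starts, around
  the same iterate. A criticality phase may change set and radius, but it ends with a poised set as
  well.\<close>

lemma not_improve_twice:
  assumes "improve k"
  shows "\<not> improve (Suc k)"
proof (cases "ncrit R (Suc k) = 0")
  case True
  have "lambda_poised n (Lambda P) (x (Suc k)) (tr_radius n m r P R k) (Yset R (Suc k) 0)"
    "\<Delta>i (Suc k) = tr_radius n m r P R k"
    using run_at(7)[of k] assms by (auto simp: tr_update_def Let_def)
  then show ?thesis using True by (simp add: Yfin_def radius_def)
next
  case False
  then show ?thesis using critical_poised(1) by blast
qed

end

section \<open>Complexity\<close>

text \<open>A common bound for the contraction of the radius by a safety step, a reset, a rejected
  step on a poised set and a repeated criticality pass.\<close>

definition shrink_factor :: "params \<Rightarrow> real" where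
  "shrink_factor P = max (max (omega_S P) (alpha2 P)) (max (gamma_dec P) (omega_C P))"

text \<open>The entries stem from the two alternatives of \<open>model_gradient_cases\<close>, both
  weakened to multiples of \<open>eps / \<kappa>\<close>.\<close>

definition gradient_const :: "params \<Rightarrow> real \<Rightarrow> real \<Rightarrow> real" where
  "gradient_const P c3 d0 = min (min c3 (1 / 2) * d0) (1 / (2 * mu P))"

text \<open>The entries belong to the initial radius, to the end of a criticality phase, and to a
  reset, where \<open>alpha1 P\<close> multiplies a \<rho> still of order \<open>z\<close>.\<close>

definition radius_const :: "params \<Rightarrow> real \<Rightarrow> real \<Rightarrow> real \<Rightarrow> real \<Rightarrow> real" where
  "radius_const P c1 c3 D0 d0 =
     min (D0 * d0\<^sup>2) (min (omega_C P * d0 / (1 + 1 / (mu P * d0)))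
       (alpha1 P * (min (gamma_dec P) c1 * (min d0 (c1 * (1 - eta1 P)) * gradient_const P c3 d0))))"

text \<open>One entry for each alternative of \<open>model_gradient_cases\<close>: the model
  gradient is at least of order \<open>eps\<close> and the radius of order \<open>z\<close>, or both
  are at least of order \<open>eps / \<kappa>\<close>.\<close>

definition decrease_const :: "params \<Rightarrow> real \<Rightarrow> real \<Rightarrow> real \<Rightarrow> real \<Rightarrow> real" where
  "decrease_const P c1 c3 D0 d0 =
     eta1 P * (c1 * min (min c3 (1 / 2) * min (radius_const P c1 c3 D0 d0) (min c3 (1 / 2) * d0\<^sup>2))
       (1 / (2 * mu P) * min (1 / 2) (1 / (2 * mu P))))"

text \<open>The weights 4, 5 and 2 are those of \<open>num_iterations_le\<close>; the last summand
  absorbs its additive 2.\<close>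

definition iteration_const :: "params \<Rightarrow> real \<Rightarrow> real \<Rightarrow> real \<Rightarrow> real \<Rightarrow> real \<Rightarrow> real" where
  "iteration_const P c1 c3 D0 f0 d0 =
     4 * (f0 / decrease_const P c1 c3 D0 d0) +
     5 * ((f0 / decrease_const P c1 c3 D0 d0 * ln (gamma_inc_bar P) + D0 / radius_const P c1 c3 D0 d0)
       / ln (1 / shrink_factor P)) +
     2 / d0\<^sup>2"

section \<open>Lower bounds as long as the gradient is large\<close>

context dfogn
begin

definition z :: real where
  "z = eps / (kappaH * \<kappa>\<^sup>2)"

abbreviation "Cg \<equiv> gradient_const P c3 d0"
abbreviation "C\<rho> \<equiv> radius_const P c1 c3 D0 d0"
abbreviation "Cf \<equiv> decrease_const P c1 c3 D0 d0"
abbreviation "\<beta> \<equiv> shrink_factor P"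

lemma const_pos: "0 < Cg" "0 < C\<rho>" "0 < Cf"
proof -
  show g: "0 < Cg" using c3 d0 params by (simp add: gradient_const_def)
  show \<rho>: "0 < C\<rho>"
    using g c1 d0 params unfolding radius_const_def
    by (simp add: add_pos_pos)
  show "0 < Cf" using \<rho> c3 c1 d0 params unfolding decrease_const_def by simp
qed

lemma shrink_factor_props: "0 < \<beta>" "\<beta> < 1" "omega_S P \<le> \<beta>" "alpha2 P \<le> \<beta>" "gamma_dec P \<le> \<beta>" "omega_C P \<le> \<beta>"
  using params by (auto simp: shrink_factor_def less_max_iff_disj)

text \<open>Surplus factors \<kappa> in \<open>z\<close> are traded for \<open>d0\<close>, which
  keeps the later constants free of \<kappa>.\<close>

lemma z_bounds:
  "0 < z" "d0 * z \<le> eps / \<kappa> / kappaH" "d0\<^sup>2 * z \<le> eps / kappaH" "d0\<^sup>2 * z \<le> 1" "z * d0 \<le> eps / \<kappa>"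
proof -
  have k: "0 < \<kappa>" by (rule kappa_pos)
  have kH: "0 < kappaH" using kappaH by simp
  show z: "0 < z" using k kH eps by (simp add: z_def)
  have "d0 * z \<le> \<kappa> * z" using d0_le z by (intro mult_right_mono) auto
  also have "\<dots> = eps / \<kappa> / kappaH" using k kH by (simp add: z_def power2_eq_square)
  finally show 1: "d0 * z \<le> eps / \<kappa> / kappaH" .
  also have "\<dots> \<le> eps / \<kappa>" using kappaH k eps by (simp add: pos_divide_le_eq mult_le_cancel_left1)
  finally show "z * d0 \<le> eps / \<kappa>" by (simp add: mult.commute)
  have "d0\<^sup>2 * z \<le> \<kappa>\<^sup>2 * z" using d0_le d0 z by (intro mult_right_mono power_mono) auto
  also have "\<dots> = eps / kappaH" using k kH by (simp add: z_def)
  finally show 2: "d0\<^sup>2 * z \<le> eps / kappaH" .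
  also have "\<dots> \<le> 1" using kappaH eps by (simp add: pos_divide_le_eq)
  finally show "d0\<^sup>2 * z \<le> 1" .
qed

text \<open>In the first alternative this gives away a factor \<kappa>. That is affordable for the
  radii, since \<open>z\<close> contains \<kappa> squared, but not for the decrease of
  \<open>f\<close>, where \<open>successful_decrease\<close> returns to the alternatives.\<close>

lemma model_gradient_lower:
  assumes big: "eps \<le> vec_norm (gradient n f (x k))"
  shows "Cg * (eps / \<kappa>) \<le> gn k" "0 < gn k"
proof -
  have k: "0 < \<kappa>" by (rule kappa_pos)
  have e: "0 < eps / \<kappa>" using k eps by simp
  have ek: "d0 * (eps / \<kappa>) \<le> eps" using d0_le k eps by (simp add: pos_divide_le_eq mult.commute)
  show le: "Cg * (eps / \<kappa>) \<le> gn k"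
    using model_gradient_cases[OF big]
  proof (elim disjE conjE)
    assume g: "min c3 (1 / 2) * eps \<le> gn k"
    have "Cg * (eps / \<kappa>) \<le> min c3 (1 / 2) * d0 * (eps / \<kappa>)"
      using e by (intro mult_right_mono) (auto simp: gradient_const_def)
    also have "\<dots> \<le> min c3 (1 / 2) * eps" unfolding mult.assoc
      using c3 ek by (intro mult_left_mono) auto
    finally show ?thesis using g by simp
  next
    assume g: "eps / (2 * \<kappa>) \<le> \<Delta> k" "\<Delta> k \<le> mu P * gn k"
    have "Cg * (eps / \<kappa>) \<le> 1 / (2 * mu P) * (eps / \<kappa>)"
      using e by (intro mult_right_mono) (auto simp: gradient_const_def)
    also have "\<dots> = eps / (2 * \<kappa>) / mu P" by simp
    also have "\<dots> \<le> gn k"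
      unfolding pos_divide_le_eq[OF params(3)] using g by (simp only: mult.commute)
    finally show ?thesis .
  qed
  have "0 < Cg * (eps / \<kappa>)" using const_pos(1) e by (rule mult_pos_pos)
  then show "0 < gn k" using le by simp
qed

lemma radius_lower:
  assumes big: "eps \<le> vec_norm (gradient n f (x k))" and init: "C\<rho> * z \<le> rho_init R k"
  shows "C\<rho> * z \<le> \<Delta> k"
proof -
  have k0: "0 < \<kappa>" by (rule kappa_pos)
  have crit: "C\<rho> * z \<le> omega_C P * eps / (\<kappa> + 1 / mu P)"
  proof -
    \<comment> \<open>By \<open>d0 \<le> \<kappa>\<close> the summand \<open>1 / mu P\<close> is at
      most \<open>\<kappa> / (mu P * d0)\<close>.\<close>
    have "\<kappa> + 1 / mu P \<le> \<kappa> * (1 + 1 / (mu P * d0))"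
      using d0_le d0 params k0 by (simp add: field_simps)
    then have "eps / (\<kappa> * (1 + 1 / (mu P * d0))) \<le> eps / (\<kappa> + 1 / mu P)"
      using eps k0 params d0 by (intro divide_left_mono mult_pos_pos add_pos_pos) auto
    then have e: "eps / \<kappa> / (1 + 1 / (mu P * d0)) \<le> eps / (\<kappa> + 1 / mu P)" by simp
    have "C\<rho> * z \<le> omega_C P * d0 / (1 + 1 / (mu P * d0)) * z"
      using z_bounds by (intro mult_right_mono) (auto simp: radius_const_def)
    also have "\<dots> = omega_C P * (z * d0 / (1 + 1 / (mu P * d0)))" by (simp add: mult_ac)
    also have "\<dots> \<le> omega_C P * (eps / \<kappa> / (1 + 1 / (mu P * d0)))"
      using z_bounds(5) params d0 by (intro mult_left_mono divide_right_mono) auto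
    also have "\<dots> \<le> omega_C P * (eps / (\<kappa> + 1 / mu P))"
      using e params by (intro mult_left_mono) auto
    finally show ?thesis by simp
  qed
  show ?thesis
    using critical_radius_lower[OF big] crit init init_bounds[of k] by auto
qed

text \<open>\<rho> can drop in a criticality phase, where \<open>radius_lower\<close> applies, and
  in a reset. A reset needs a \<rho> of at least order \<open>z\<close>: a safety step at a smaller
  \<rho> would contradict \<open>step_lower\<close>, and a rejected step on a poised set at a
  smaller radius would contradict \<open>small_radius_successful\<close>.\<close>

lemma rho_lower:
  assumes "\<And>k. k < N \<Longrightarrow> eps \<le> vec_norm (gradient n f (x k))"
  shows "C\<rho> * z \<le> rho_init R N"
  using assms
proof (induction N)
  case 0
  have "C\<rho> * z \<le> D0 * d0\<^sup>2 * z" using z_bounds by (intro mult_right_mono) (auto simp: radius_const_def)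
  also have "\<dots> \<le> D0 * 1" unfolding mult.assoc using z_bounds(4) params by (intro mult_left_mono) auto
  finally show ?case using run by (simp add: dfogn_run_def)
next
  case (Suc k)
  have big: "eps \<le> vec_norm (gradient n f (x k))" using Suc.prems by simp
  have init: "C\<rho> * z \<le> rho_init R k" using Suc by simp
  have k0: "0 < \<kappa>" by (rule kappa_pos)
  have kH0: "0 < kappaH" using kappaH by simp
  \<comment> \<open>A radius below \<open>?c * z\<close> meets both conditions of
    \<open>small_radius_successful\<close>: the entry \<open>d0\<close> serves the comparison with
    \<open>gn k / kappaH\<close>, the other entry the one involving \<kappa>.\<close>
  let ?c = "min d0 (c1 * (1 - eta1 P)) * Cg"
  have c0: "0 \<le> ?c" using d0 c1 params const_pos by simp
  have g: "Cg * (eps / \<kappa>) \<le> gn k" "0 < gn k" by (rule model_gradient_lower[OF big])+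
  have "C\<rho> * z \<le> \<Delta> k" by (rule radius_lower[OF big init])
  then have \<rho>: "C\<rho> * z \<le> \<rho> k" using init by (auto simp: rho_def)
  have gH: "?c * z \<le> gn k / kappaH"
  proof -
    have "?c * z \<le> d0 * (Cg * z)"
      unfolding mult.assoc using z_bounds(1) const_pos by (intro mult_right_mono mult_nonneg_nonneg) auto
    also have "\<dots> = Cg * (d0 * z)" by (rule mult.left_commute)
    also have "\<dots> \<le> Cg * (eps / \<kappa> / kappaH)"
      using z_bounds(2) const_pos by (intro mult_left_mono) auto
    also have "\<dots> \<le> gn k / kappaH" using divide_right_mono[OF g(1), of kappaH] kH0 by simp
    finally show ?thesis .
  qed
  have reset: "C\<rho> * z \<le> rho_init R (Suc k)"
    if "reset_or_keep P R k D" "D = \<rho> k \<Longrightarrow> min (gamma_dec P) c1 * (?c * z) \<le> \<rho> k" for D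
  proof (cases "D = \<rho> k")
    case True
    have "C\<rho> * z \<le> alpha1 P * (min (gamma_dec P) c1 * ?c) * z"
      using z_bounds by (intro mult_right_mono) (auto simp: radius_const_def)
    also have "\<dots> = alpha1 P * (min (gamma_dec P) c1 * (?c * z))" by simp
    also have "\<dots> \<le> alpha1 P * \<rho> k" using that(2)[OF True] params by (intro mult_left_mono) auto
    finally show ?thesis using that(1) True by (simp add: reset_or_keep_def)
  next
    case False
    then show ?thesis using that(1) \<rho> by (simp add: reset_or_keep_def)
  qed
  have cz: "0 \<le> ?c * z" using c0 z_bounds(1) by simp
  have c1z: "c1 * (?c * z) \<le> ?c * z" using c1 cz by (simp add: mult_left_le_one_le)
  have minle: "min (gamma_dec P) c1 * (?c * z) \<le> gamma_dec P * (?c * z)"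
    "min (gamma_dec P) c1 * (?c * z) \<le> c1 * (?c * z)"
    using cz by (intro mult_right_mono; simp)+
  show ?case
  proof (cases "safe k")
    case True
    have "?c * z \<le> \<rho> k"
    proof (rule ccontr)
      assume "\<not> ?c * z \<le> \<rho> k"
      \<comment> \<open>The minimum in \<open>step_lower\<close> is then at least \<rho>, which
        makes the step too long for a safety step.\<close>
      then have "\<rho> k \<le> min (\<Delta> k) (gn k / kappaH)" using gH rho_radius_bounds(2)[of k] by simp
      then have "c1 * \<rho> k \<le> vec_norm (s k)"
        using step_lower[OF g(2)] c1 mult_left_mono[of "\<rho> k" _ c1] by (meson order_trans less_eq_real_def linorder_not_less zero_less_divide_1_iff zero_less_numeral)
      moreover have "vec_norm (s k) < gamma_S P * \<rho> k" using True by (simp add: is_safety_def)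
      ultimately have "c1 * \<rho> k < gamma_S P * \<rho> k" by simp
      then show False using gamma_S_less_c1 rho_radius_bounds(1)[of k] by simp
    qed
    then have "min (gamma_dec P) c1 * (?c * z) \<le> \<rho> k" using minle c1z by linarith
    then show ?thesis
      using run_at(6)[OF True] by (auto simp: safety_update_def Let_def intro!: reset)
  next
    case False
    note upd = run_at(7)[OF False]
    show ?thesis
    proof (cases "eta1 P \<le> rat k \<or> \<not> poised k")
      case True
      then show ?thesis using upd \<rho> by (auto simp: tr_update_def Let_def split: if_splits)
    next
      case unsuccessful: False
      have r1: "reset_or_keep P R k (tr_radius n m r P R k)"
        using upd unsuccessful by (simp add: tr_update_def Let_def)
      have \<Delta>z: "?c * z \<le> \<Delta> k"
      proof (rule ccontr)
        assume less: "\<not> ?c * z \<le> \<Delta> k"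
        have "?c * z \<le> c1 * (1 - eta1 P) * Cg * z"
          using z_bounds(1) const_pos by (intro mult_right_mono) auto
        also have "\<dots> \<le> c1 * (1 - eta1 P) * Cg * (eps / \<kappa> / \<kappa>)"
        proof (rule mult_left_mono)
          have "z = eps / \<kappa> / \<kappa> / kappaH" by (simp add: z_def power2_eq_square mult_ac)
          also have "\<dots> \<le> eps / \<kappa> / \<kappa>"
            using kappaH eps k0 by (simp add: pos_divide_le_eq mult_le_cancel_left1)
          finally show "z \<le> eps / \<kappa> / \<kappa>" .
        qed (use c1 params const_pos in auto)
        also have "\<dots> = c1 * (1 - eta1 P) / \<kappa> * (Cg * (eps / \<kappa>))" by simp
        also have "\<dots> \<le> c1 * (1 - eta1 P) / \<kappa> * gn k"
          using g(1) c1 params k0 by (intro mult_left_mono) auto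
        finally have "\<Delta> k \<le> c1 * (1 - eta1 P) / \<kappa> * gn k" using less by simp
        moreover have "\<Delta> k \<le> gn k / kappaH" using less gH by simp
        ultimately show False using small_radius_successful[OF g(2)] unsuccessful by blast
      qed
      have "c1 * (?c * z) \<le> c1 * min (\<Delta> k) (gn k / kappaH)"
        using \<Delta>z gH c1 by (intro mult_left_mono min.boundedI) auto
      also have "\<dots> \<le> vec_norm (s k)" by (rule step_lower[OF g(2)])
      finally have "c1 * (?c * z) \<le> vec_norm (s k)" .
      moreover have "gamma_dec P * (?c * z) \<le> gamma_dec P * \<Delta> k"
        using \<Delta>z params by (intro mult_left_mono) auto
      moreover have "gamma_dec P * \<Delta> k \<le> \<rho> k \<or> vec_norm (s k) \<le> \<rho> k"
        if "tr_radius n m r P R k = \<rho> k"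
        using tr_radius_bounds(6)[OF rho_radius_bounds(1-3) _ that] unsuccessful by simp
      ultimately have "min (gamma_dec P) c1 * (?c * z) \<le> \<rho> k" if "tr_radius n m r P R k = \<rho> k"
        using that minle by (meson order_trans)
      then show ?thesis using reset[OF r1] by blast
    qed
  qed
qed


text \<open>The alternatives of \<open>model_gradient_cases\<close> stay apart: a model gradient of
  order \<open>eps\<close> is paired with a radius of order \<open>z\<close>, whereas a smaller one
  comes with a radius of order \<open>eps / \<kappa>\<close>.\<close>

lemma successful_decrease:
  assumes big: "eps \<le> vec_norm (gradient n f (x k))" and \<Delta>: "C\<rho> * z \<le> \<Delta> k"
  shows "Cf * (eps * z) \<le> eta1 P * (c1 * gn k * min (\<Delta> k) (gn k / kappaH))"
proof -
  let ?c4 = "min c3 (1 / 2)" and ?c5 = "1 / (2 * mu P)"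
  let ?A = "?c4 * min C\<rho> (?c4 * d0\<^sup>2)" and ?B = "?c5 * min (1 / 2) ?c5"
  have k0: "0 < \<kappa>" by (rule kappa_pos)
  have kH: "0 < kappaH" using kappaH by simp
  have z: "0 < z" by (rule z_bounds)
  have c4: "0 < ?c4" using c3 by simp
  have c5: "0 < ?c5" using params by simp
  have g: "0 < gn k" by (rule model_gradient_lower[OF big])
  have "min ?A ?B * (eps * z) \<le> gn k * min (\<Delta> k) (gn k / kappaH)"
    using model_gradient_cases[OF big]
  proof (elim disjE conjE)
    assume A: "?c4 * eps \<le> gn k"
    have "min C\<rho> (?c4 * d0\<^sup>2) * z \<le> gn k / kappaH"
    proof -
      have "min C\<rho> (?c4 * d0\<^sup>2) * z \<le> ?c4 * d0\<^sup>2 * z" using z by (intro mult_right_mono) auto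
      also have "\<dots> \<le> ?c4 * (eps / kappaH)"
        unfolding mult.assoc using z_bounds(3) c4 by (intro mult_left_mono) auto
      also have "\<dots> \<le> gn k / kappaH" using divide_right_mono[OF A, of kappaH] kH by simp
      finally show ?thesis .
    qed
    moreover have "min C\<rho> (?c4 * d0\<^sup>2) * z \<le> C\<rho> * z" using z by (intro mult_right_mono) auto
    ultimately have m: "min C\<rho> (?c4 * d0\<^sup>2) * z \<le> min (\<Delta> k) (gn k / kappaH)" using \<Delta> by simp
    have "min ?A ?B * (eps * z) \<le> ?A * (eps * z)"
      using eps z by (intro mult_right_mono) auto
    also have "\<dots> = (?c4 * eps) * (min C\<rho> (?c4 * d0\<^sup>2) * z)" by (simp only: mult_ac)
    also have "\<dots> \<le> gn k * min (\<Delta> k) (gn k / kappaH)"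
      using A m g c4 d0 z const_pos by (intro mult_mono mult_nonneg_nonneg) auto
    finally show ?thesis .
  next
    assume B: "eps / (2 * \<kappa>) \<le> \<Delta> k" "\<Delta> k \<le> mu P * gn k"
    define w where "w = eps / \<kappa>"
    have w: "0 < w" using eps k0 by (simp add: w_def)
    have B1: "1 / 2 * w \<le> \<Delta> k" using B(1) by (simp add: w_def)
    have g5: "?c5 * w \<le> gn k"
    proof -
      have "1 / 2 * w \<le> gn k * mu P" using B1 B(2) by (simp only: mult.commute[of "mu P"])
      then have "1 / 2 * w / mu P \<le> gn k" unfolding pos_divide_le_eq[OF params(3)] .
      then show ?thesis by simp
    qed
    have "w / kappaH \<le> w / 1" using kappaH w by (intro divide_left_mono) auto
    then have "min (1 / 2) ?c5 * (w / kappaH) \<le> 1 / 2 * w"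
      using w kH by (intro mult_mono) auto
    moreover have "min (1 / 2) ?c5 * (w / kappaH) \<le> gn k / kappaH"
    proof -
      have "min (1 / 2) ?c5 * (w / kappaH) \<le> ?c5 * (w / kappaH)"
        using w kH by (intro mult_right_mono) auto
      also have "\<dots> \<le> gn k / kappaH" using divide_right_mono[OF g5, of kappaH] kH by simp
      finally show ?thesis .
    qed
    ultimately have m: "min (1 / 2) ?c5 * (w / kappaH) \<le> min (\<Delta> k) (gn k / kappaH)" using B1 by simp
    have "min ?A ?B * (eps * z) \<le> ?B * (eps * z)"
      using eps z by (intro mult_right_mono) auto
    also have "\<dots> = (?c5 * w) * (min (1 / 2) ?c5 * (w / kappaH))"
    proof -
      \<comment> \<open>The larger radius makes up exactly for the factor \<kappa> lost in the
        gradient.\<close>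
      have "eps * z = w * (w / kappaH)" by (simp add: w_def z_def power2_eq_square)
      then show ?thesis by (simp only: mult_ac)
    qed
    also have "\<dots> \<le> gn k * min (\<Delta> k) (gn k / kappaH)"
      using g5 m g c5 w kH by (intro mult_mono mult_nonneg_nonneg) auto
    finally show ?thesis .
  qed
  then have "eta1 P * (c1 * (min ?A ?B * (eps * z))) \<le> eta1 P * (c1 * (gn k * min (\<Delta> k) (gn k / kappaH)))"
    using params c1 by (intro mult_left_mono) auto
  then show ?thesis by (simp only: decrease_const_def mult.assoc)
qed

text \<open>The comparison is with the radius after the criticality phase; the passes of that phase
  are charged separately through \<open>radius_ncrit\<close>.\<close>

lemma radius_Suc_le:
  "\<Delta>i (Suc k) \<le> (if succ k then gamma_inc_bar P else if shrink k then \<beta> else 1) * \<Delta> k"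
proof -
  note D = tr_radius_bounds[OF rho_radius_bounds(1-3)[of k]]
  note b = rho_radius_bounds[of k]
  have reset: "\<Delta>i (Suc k) \<le> \<beta> * \<Delta> k"
    if "reset_or_keep P R k E" "E \<noteq> \<rho> k \<Longrightarrow> E \<le> \<beta> * \<Delta> k" for E
  proof (cases "E = \<rho> k")
    case True
    have "alpha2 P * \<rho> k \<le> \<beta> * \<Delta> k"
      using shrink_factor_props b by (intro mult_mono) auto
    then show ?thesis using that True by (simp add: reset_or_keep_def)
  qed (use that in \<open>simp add: reset_or_keep_def\<close>)
  show ?thesis
  proof (cases "safe k")
    case True
    have "omega_S P * \<Delta> k \<le> \<beta> * \<Delta> k"
      using shrink_factor_props b by (intro mult_right_mono) auto
    moreover have res: "reset_or_keep P R k (max (\<rho> k) (omega_S P * \<Delta> k))"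
      using run_at(6)[OF True] by (simp add: safety_update_def Let_def)
    ultimately have "\<Delta>i (Suc k) \<le> \<beta> * \<Delta> k" by (intro reset[OF res]) (simp add: max_def split: if_splits)
    then show ?thesis using True by simp
  next
    case False
    note upd = run_at(7)[OF False]
    have "gamma_dec P * \<Delta> k \<le> \<beta> * \<Delta> k"
      using shrink_factor_props b by (intro mult_right_mono) auto
    then have dec: "rat k < eta1 P \<Longrightarrow> tr_radius n m r P R k \<noteq> \<rho> k \<Longrightarrow> tr_radius n m r P R k \<le> \<beta> * \<Delta> k"
      using D(5) by linarith
    consider "eta1 P \<le> rat k" | "rat k < eta1 P" "\<not> poised k" | "rat k < eta1 P" "poised k" by linarith
    then show ?thesis
    proof cases
      case 1
      then show ?thesis using False upd D(3) by (simp add: tr_update_def Let_def)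
    next
      case 2
      then show ?thesis using False upd D(4) by (simp add: tr_update_def Let_def)
    next
      case 3
      then have "reset_or_keep P R k (tr_radius n m r P R k)" using upd by (simp add: tr_update_def Let_def)
      then have "\<Delta>i (Suc k) \<le> \<beta> * \<Delta> k" using dec 3 by (intro reset) auto
      then show ?thesis using 3 by simp
    qed
  qed
qed

section \<open>Counting iterations and evaluations\<close>

definition num_succ :: "nat \<Rightarrow> real" where
  "num_succ N = (\<Sum>k<N. of_bool (succ k))"

definition num_shrink :: "nat \<Rightarrow> real" where
  "num_shrink N = (\<Sum>k<N. real (ncrit R k - 1) + of_bool (shrink k))"

lemma num_succ_decrease:
  assumes "\<And>k. k < N \<Longrightarrow> eps \<le> vec_norm (gradient n f (x k))"
  shows "f (x N) + num_succ N * (Cf * (eps * z)) \<le> f0"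
  using assms
proof (induction N)
  case 0
  then show ?case using f0 by (simp add: num_succ_def)
next
  case (Suc k)
  have big: "eps \<le> vec_norm (gradient n f (x k))" using Suc.prems by simp
  have \<rho>i: "C\<rho> * z \<le> rho_init R k" using Suc.prems by (intro rho_lower) simp
  have "C\<rho> * z \<le> \<Delta> k"
    using radius_lower[OF big \<rho>i] .
  then have "of_bool (succ k) * (Cf * (eps * z)) \<le>
      of_bool (succ k) * (eta1 P * (c1 * gn k * min (\<Delta> k) (gn k / kappaH)))"
    using successful_decrease[OF big] by (intro mult_left_mono) auto
  then have "f (x (Suc k)) + of_bool (succ k) * (Cf * (eps * z)) \<le> f (x k)"
    using f_Suc_le[of k] by linarith
  moreover have "num_succ (Suc k) * (Cf * (eps * z)) =
      num_succ k * (Cf * (eps * z)) + of_bool (succ k) * (Cf * (eps * z))"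
    by (simp only: num_succ_def sum.lessThan_Suc distrib_right)
  moreover have "f (x k) + num_succ k * (Cf * (eps * z)) \<le> f0" using Suc by simp
  ultimately show ?case by linarith
qed

text \<open>The truncated \<open>ncrit R k - 1\<close> is the number of passes that shrink the radius, the first pass
  being run at the initial radius.\<close>

lemma ln_radius_le:
  "ln (\<Delta>i N) \<le> ln D0 + num_succ N * ln (gamma_inc_bar P) + num_shrink N * ln \<beta>"
proof (induction N)
  case 0
  then show ?case using run by (simp add: dfogn_run_def num_succ_def num_shrink_def)
next
  case (Suc k)
  let ?q = "if succ k then gamma_inc_bar P else if shrink k then \<beta> else 1"
  have q: "0 < ?q" using params shrink_factor_props by simp
  have D: "0 < \<Delta> k" "0 < \<Delta>i k" "0 < \<Delta>i (Suc k)" by (rule rho_radius_bounds)+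
  have "ln (\<Delta>i (Suc k)) \<le> ln (?q * \<Delta> k)" using radius_Suc_le[of k] D by simp
  also have "\<dots> = ln ?q + ln (\<Delta> k)" by (rule ln_mult_pos[OF q D(1)])
  \<comment> \<open>A model-improving iteration contributes \<open>ln 1\<close>, so the radius
    cannot bound the number of these.\<close>
  also have "ln ?q = of_bool (succ k) * ln (gamma_inc_bar P) + of_bool (shrink k) * ln \<beta>"
    by auto
  also have "ln (\<Delta> k) = real (ncrit R k - 1) * ln (omega_C P) + ln (\<Delta>i k)"
    unfolding radius_ncrit using D params by (simp add: ln_mult ln_realpow)
  also have "real (ncrit R k - 1) * ln (omega_C P) \<le> real (ncrit R k - 1) * ln \<beta>"
    using params shrink_factor_props by (intro mult_left_mono) auto
  finally show ?case using Suc by (simp add: num_succ_def num_shrink_def algebra_simps)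
qed

text \<open>The successor of a model-improving iteration is successful or shrinking and pays for it.
  The last index may still lack its successor; the extra term stands for it and carries the
  induction.\<close>

lemma num_improve_le:
  "(\<Sum>k<N. of_bool (improve k) :: real) \<le>
    num_succ N + num_shrink N + of_bool (N \<noteq> 0 \<and> improve (N - 1))"
proof (induction N)
  case 0
  then show ?case by (simp add: num_succ_def num_shrink_def)
next
  case (Suc k)
  show ?case
  proof (cases "improve k")
    case True
    then have "\<not> (k \<noteq> 0 \<and> improve (k - 1))"
      using not_improve_twice[of "k - 1"] by (cases k) auto
    then show ?thesis using Suc True by (auto simp: num_succ_def num_shrink_def)
  next
    case False
    then have some: "(1::real) \<le> of_bool (succ k) + of_bool (shrink k)" by auto
    have lin: "i \<le> s + a + (h + (c + b)) + 0"
      if "i \<le> s + h + e" "e \<le> 1" "1 \<le> a + b" "0 \<le> c" for i s h e a b c :: real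
      using that by simp
    have eqs: "num_succ (Suc k) = num_succ k + of_bool (succ k)"
      "num_shrink (Suc k) = num_shrink k + (real (ncrit R k - 1) + of_bool (shrink k))"
      "(\<Sum>k<Suc k. of_bool (improve k) :: real) = (\<Sum>k<k. of_bool (improve k))"
      "of_bool (Suc k \<noteq> 0 \<and> improve (Suc k - 1)) = (0::real)"
      using False by (simp_all add: num_succ_def num_shrink_def)
    show ?thesis unfolding eqs by (rule lin[OF Suc _ some]) simp_all
  qed
qed

text \<open>An index builds at most two models besides those counted by
  \<open>ncrit R k - 1\<close>: the initial one and that of the first pass. Charging each class
  twice and inserting \<open>num_improve_le\<close> leaves an additive 2 for an unpaired last
  index.\<close>

lemma num_iterations_le:
  "real (num_iterations R N) \<le> 4 * num_succ N + 5 * num_shrink N + 2"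
proof -
  have lin: "1 + b \<le> 2 * a + c" if "1 \<le> a" "b \<le> 1 + c" for a b c :: real
    using that by simp
  have "real (num_iterations R N) = (\<Sum>k<N. 1 + real (ncrit R k))"
    by (simp add: num_iterations_def)
  also have "\<dots> \<le> (\<Sum>k<N. 2 * (of_bool (improve k) + of_bool (succ k) + of_bool (shrink k)) + real (ncrit R k - 1))"
  proof (rule sum_mono)
    fix k
    have "(1::real) \<le> of_bool (improve k) + of_bool (succ k) + of_bool (shrink k)" by auto
    moreover have "real (ncrit R k) \<le> 1 + real (ncrit R k - 1)" by simp
    ultimately show "1 + real (ncrit R k) \<le>
        2 * (of_bool (improve k) + of_bool (succ k) + of_bool (shrink k)) + real (ncrit R k - 1)"
      by (rule lin)
  qed
  also have "\<dots> \<le> 2 * (\<Sum>k<N. of_bool (improve k)) + 2 * num_succ N + 2 * num_shrink N"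
  proof -
    have "0 \<le> (\<Sum>k<N. real (ncrit R k - 1))" by (simp add: sum_nonneg)
    then show ?thesis
      by (simp add: num_succ_def num_shrink_def sum.distrib sum_distrib_left[symmetric] algebra_simps)
  qed
  also have "\<dots> \<le> 2 * (num_succ N + num_shrink N + 1) + 2 * num_succ N + 2 * num_shrink N"
  proof -
    have "of_bool (N \<noteq> 0 \<and> improve (N - 1)) \<le> (1::real)" by simp
    from order_trans[OF num_improve_le[of N] add_left_mono[OF this]] show ?thesis by simp
  qed
  also have "\<dots> \<le> 4 * num_succ N + 5 * num_shrink N + 2"
  proof -
    have "0 \<le> num_shrink N" by (simp add: num_shrink_def sum_nonneg)
    then show ?thesis by simp
  qed
  finally show ?thesis .
qed

abbreviation "Ci \<equiv> iteration_const P c1 c3 D0 f0 d0"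

text \<open>Lets additive constants be absorbed into multiples of
  \<open>1 / (eps * z)\<close>.\<close>

lemma one_le_scale: "1 \<le> 1 / (eps * z) / d0\<^sup>2"
proof -
  have "eps * (d0\<^sup>2 * z) \<le> 1 * 1"
    using eps z_bounds(1,4) by (intro mult_mono) auto
  moreover have "0 < eps * (d0\<^sup>2 * z)" using eps z_bounds(1) d0 by simp
  ultimately have "1 \<le> 1 / (eps * (d0\<^sup>2 * z))" by (simp only: le_divide_eq_1_pos mult_1)
  then show ?thesis by (simp only: divide_divide_eq_left mult_ac)
qed

lemma iterations_bound:
  assumes big: "\<And>k. k < N \<Longrightarrow> eps \<le> vec_norm (gradient n f (x k))"
  shows "real (num_iterations R N) \<le> Ci / (eps * z)"
proof -
  define Z where "Z = 1 / (eps * z)"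
  have z: "0 < z" by (rule z_bounds)
  have ez: "0 < eps * z" using eps z by simp
  have Z: "0 < Z" using ez by (simp add: Z_def)
  have g0: "0 \<le> ln (gamma_inc_bar P)" using params by simp
  have L: "0 < ln (1 / \<beta>)" "ln \<beta> = - ln (1 / \<beta>)" using shrink_factor_props by (simp_all add: ln_div)
  have zZ: "1 / z \<le> Z" unfolding Z_def using eps z by (simp add: divide_simps)
  have oneZ: "1 \<le> Z / d0\<^sup>2" unfolding Z_def by (rule one_le_scale)
  have S: "num_succ N \<le> f0 / Cf * Z"
  proof -
    have "num_succ N * (Cf * (eps * z)) \<le> f0"
      using num_succ_decrease[of N, OF big] f_nonneg[of "x N"] by linarith
    then have "num_succ N \<le> f0 / (Cf * (eps * z))"
      using const_pos ez by (simp add: pos_le_divide_eq)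
    then show ?thesis by (simp add: Z_def)
  qed
  have T: "num_shrink N \<le> (f0 / Cf * ln (gamma_inc_bar P) + D0 / C\<rho>) / ln (1 / \<beta>) * Z"
  proof -
    have cz: "0 < C\<rho> * z" using const_pos z by simp
    have "C\<rho> * z \<le> \<Delta>i N" using rho_lower[of N, OF big] init_bounds[of N] by linarith
    then have "ln (C\<rho> * z) \<le> ln (\<Delta>i N)" using cz by simp
    then have a: "num_shrink N * ln (1 / \<beta>) \<le> ln D0 - ln (C\<rho> * z) + num_succ N * ln (gamma_inc_bar P)"
      using ln_radius_le[of N] L(2) by simp
    have "ln D0 - ln (C\<rho> * z) = ln (D0 / (C\<rho> * z))" using ln_divide_pos[OF params(1) cz] by simp
    \<comment> \<open>The crude \<open>ln t < t\<close> suffices, because \<open>1 / z\<close> does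
      not exceed \<open>1 / (eps * z)\<close>.\<close>
    also have "\<dots> \<le> D0 / (C\<rho> * z)" using params cz by (intro less_imp_le ln_less_self) simp
    also have "\<dots> = D0 / C\<rho> * (1 / z)" by simp
    also have "\<dots> \<le> D0 / C\<rho> * Z" using zZ params const_pos by (intro mult_left_mono) auto
    finally have b: "ln D0 - ln (C\<rho> * z) \<le> D0 / C\<rho> * Z" .
    have c: "num_succ N * ln (gamma_inc_bar P) \<le> f0 / Cf * Z * ln (gamma_inc_bar P)"
      using S g0 by (intro mult_right_mono)
    have "num_shrink N * ln (1 / \<beta>) \<le> f0 / Cf * Z * ln (gamma_inc_bar P) + D0 / C\<rho> * Z"
      using a b c by linarith
    also have "\<dots> = (f0 / Cf * ln (gamma_inc_bar P) + D0 / C\<rho>) * Z"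
      by (simp only: distrib_right distrib_left mult_ac)
    finally have "num_shrink N * ln (1 / \<beta>) \<le> (f0 / Cf * ln (gamma_inc_bar P) + D0 / C\<rho>) * Z" .
    then show ?thesis using L(1) by (simp add: pos_le_divide_eq)
  qed
  have "real (num_iterations R N) \<le> 4 * (f0 / Cf * Z) +
      5 * ((f0 / Cf * ln (gamma_inc_bar P) + D0 / C\<rho>) / ln (1 / \<beta>) * Z) + 2 * (Z / d0\<^sup>2)"
    using num_iterations_le[of N] S T oneZ by linarith
  also have "\<dots> = Ci * Z"
    by (simp only: iteration_const_def distrib_right mult.assoc times_divide_eq_left)
  finally show ?thesis by (simp add: Z_def)
qed

text \<open>Each charged item is a set of at most \<open>n + 2\<close> points, namely a new
  interpolation set and, at the end of an iteration, possibly the trial point. Index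
  \<open>k\<close> has \<open>ncrit R k + 1\<close> such items, as many as it builds models.\<close>

lemma evaluations_le: "real (num_evaluations P R N) \<le> 2 * real n + 3 * real n * real (num_iterations R N)"
proof -
  have card: "finite (Yset R k i) \<and> card (Yset R k i) = n + 1" if "i \<le> ncrit R k" for k i
    using run_at(2)[OF that] by (simp add: interp_set_def)
  have "num_evaluations P R N \<le> (n + 1) + (\<Sum>k<N. ncrit R k * (n + 2) + (n + 2))"
    unfolding num_evaluations_def
  proof (intro add_mono sum_mono)
    show "card (Yset R 0 0) \<le> n + 1" using card[of 0 0] by simp
    fix k
    have "(\<Sum>i<ncrit R k. card (Yset R k (Suc i) - Yset R k i)) \<le> (\<Sum>i<ncrit R k. n + 2)"
    proof (rule sum_mono)
      fix i assume "i \<in> {..<ncrit R k}"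
      then have "finite (Yset R k (Suc i))" "card (Yset R k (Suc i)) = n + 1" using card[of "Suc i" k] by auto
      then show "card (Yset R k (Suc i) - Yset R k i) \<le> n + 2"
        using card_mono[of "Yset R k (Suc i)" "Yset R k (Suc i) - Yset R k i"] by auto
    qed
    then show "(\<Sum>i<ncrit R k. card (Yset R k (Suc i) - Yset R k i)) \<le> ncrit R k * (n + 2)" by simp
    let ?Y = "if safe k then Yset R (Suc k) 0 else insert (x k + s k) (Yset R (Suc k) 0)"
    have Y: "finite (Yset R (Suc k) 0)" "card (Yset R (Suc k) 0) = n + 1" using card[of 0 "Suc k"] by auto
    then have "finite ?Y" "card ?Y \<le> n + 2" by (auto simp: card_insert_if)
    then show "card (?Y - Yfin R k) \<le> n + 2"
      by (meson Diff_subset card_mono order_trans)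
  qed
  also have "\<dots> = (n + 1) + (n + 2) * num_iterations R N"
    by (simp add: num_iterations_def sum_distrib_left algebra_simps)
  \<comment> \<open>From \<open>1 \<le> n\<close> one gets \<open>n + 1 \<le> 2 * n\<close> and
    \<open>n + 2 \<le> 3 * n\<close>.\<close>
  also have "\<dots> \<le> 2 * n + 3 * n * num_iterations R N"
    using n by (intro add_mono mult_right_mono) auto
  finally have "real (num_evaluations P R N) \<le> real (2 * n + 3 * n * num_iterations R N)"
    by (rule of_nat_mono)
  then show ?thesis by simp
qed

text \<open>The iteration bound holds for every initial range of indices with large gradient, so
  such a range is finite and the \<open>LEAST\<close> in \<open>first_small\<close> is attained.
  \<open>K\<close> is sized for the evaluations, its second summand paying for the initial
  set.\<close>

lemma complexity:
  defines "N \<equiv> first_small n r R eps" and "K \<equiv> 3 * Ci + 2 / d0\<^sup>2"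
  shows "\<exists>k. small_grad n r R eps k"
    and "real (num_iterations R N) \<le> K * kappaH * \<kappa>\<^sup>2 / eps\<^sup>2"
    and "real (num_evaluations P R N) \<le> K * kappaH * \<kappa>\<^sup>2 * real n / eps\<^sup>2"
proof -
  define Z where "Z = 1 / (eps * z)"
  have Z_eq: "Z = kappaH * \<kappa>\<^sup>2 / eps\<^sup>2" using eps by (simp add: Z_def z_def power2_eq_square)
  have z: "0 < z" by (rule z_bounds)
  have Z: "0 < Z" using eps z by (simp add: Z_def)
  have oneZ: "1 \<le> Z / d0\<^sup>2" unfolding Z_def by (rule one_le_scale)
  have it: "real (num_iterations R M) \<le> Ci * Z" if "\<And>k. k < M \<Longrightarrow> \<not> small_grad n r R eps k" for M
    using iterations_bound[of M] that by (simp add: small_grad_def Z_def not_less)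
  show "\<exists>k. small_grad n r R eps k"
  proof (rule ccontr)
    assume none: "\<not> ?thesis"
    obtain M where M: "Ci * Z < real M" using reals_Archimedean2 by blast
    have "M \<le> num_iterations R M"
      using sum_mono[of "{..<M}" "\<lambda>_. 1" "\<lambda>k. 1 + ncrit R k"] by (simp add: num_iterations_def)
    then show False using it[of M] none M by (meson leD le_less_trans of_nat_le_iff order_trans)
  qed
  have itN: "real (num_iterations R N) \<le> Ci * Z"
    by (rule it) (use not_less_Least in \<open>auto simp: N_def first_small_def\<close>)
  \<comment> \<open>The sign of \<open>Ci\<close> is read off from the bound just proved, whose
    left-hand side is a count.\<close>
  then have "0 \<le> Ci * Z" by (meson of_nat_0_le_iff order_trans)
  then have Ci0: "0 \<le> Ci" using Z by (simp add: zero_le_mult_iff)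
  have "Ci * Z \<le> K * Z" unfolding K_def using Ci0 Z d0 by (intro mult_right_mono) auto
  then show "real (num_iterations R N) \<le> K * kappaH * \<kappa>\<^sup>2 / eps\<^sup>2"
    using itN by (simp add: Z_eq mult.assoc)
  have "real (num_evaluations P R N) \<le> 2 * real n * (Z / d0\<^sup>2) + 3 * real n * (Ci * Z)"
    using evaluations_le[of N] mult_left_mono[OF oneZ, of "2 * real n"]
      mult_left_mono[OF itN, of "3 * real n"] by simp
  also have "\<dots> = K * Z * real n" by (simp add: K_def algebra_simps)
  finally show "real (num_evaluations P R N) \<le> K * kappaH * \<kappa>\<^sup>2 * real n / eps\<^sup>2"
    by (simp add: Z_eq mult.assoc)
qed

end

text \<open>The target order is the square of \<open>sqrt (real n) * LJ\<close>. Terms of lower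
  order are raised to it by factors \<open>LJ / l0\<close> and \<open>sqrt (real n)\<close>, both at
  least 1; hence the \<open>l0\<close> in the constant.\<close>

lemma kappa_d_le:
  assumes "0 \<le> rmax" "0 \<le> Jmax" "0 \<le> C" "0 < l0" "0 \<le> Dmax" "1 \<le> n" "l0 \<le> LJ"
  shows "kappa_d n C Dmax LJ rmax Jmax \<le>
    (3 / 2 * (rmax / l0 + (Jmax / l0)\<^sup>2) + (C + 2) / 2 * (rmax / l0) + 3 / 2 * ((C + 2) / 2 * Dmax + Jmax / l0)\<^sup>2)
      * real n * LJ\<^sup>2"
proof -
  let ?q = "real n * LJ\<^sup>2"
  have n: "1 \<le> sqrt (real n)" using assms by simp
  have LJ: "0 < LJ" using assms by simp
  have u: "LJ \<le> sqrt (real n) * LJ" using n LJ by simp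
  have q: "(sqrt (real n) * LJ)\<^sup>2 = ?q" by (simp add: power_mult_distrib)
  have sn: "sqrt (real n) \<le> real n" using mult_left_mono[OF n, of "sqrt (real n)"] by simp
  have J: "Jmax \<le> Jmax / l0 * LJ"
    using mult_left_mono[of l0 LJ "Jmax / l0"] assms by simp
  also have "\<dots> \<le> Jmax / l0 * (sqrt (real n) * LJ)"
    using u assms by (intro mult_left_mono) auto
  finally have J': "Jmax \<le> Jmax / l0 * (sqrt (real n) * LJ)" .
  have J2: "Jmax\<^sup>2 \<le> (Jmax / l0)\<^sup>2 * ?q"
    using power_mono[OF J' assms(2), of 2]
    unfolding power_mult_distrib[of _ "sqrt (real n) * LJ"] q .
  have LL: "LJ \<le> sqrt (real n) * LJ / l0 * LJ"
    using mult_mono[OF u, of 1 "LJ / l0"] assms LJ by simp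
  have r1: "rmax * LJ \<le> rmax / l0 * ?q"
  proof -
    have "sqrt (real n) * LJ * LJ \<le> real n * LJ * LJ"
      using assms(6) LJ by (intro mult_right_mono) (auto simp: sn)
    then have "LJ \<le> ?q / l0"
      using LL assms divide_right_mono[of "sqrt (real n) * LJ * LJ" "real n * LJ * LJ" l0]
      by (simp add: power2_eq_square mult_ac)
    then show ?thesis using mult_left_mono[of LJ "?q / l0" rmax] assms by simp
  qed
  have e: "kappa_eg_r n C LJ \<le> (C + 2) / 2 * (sqrt (real n) * LJ)"
    unfolding kappa_eg_r_def using u by (simp add: algebra_simps)
  have e0: "0 \<le> kappa_eg_r n C LJ" unfolding kappa_eg_r_def using assms by simp
  have er: "kappa_eg_r n C LJ * rmax \<le> (C + 2) / 2 * (rmax / l0) * ?q"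
  proof -
    have "sqrt (real n) * LJ \<le> ?q / l0"
    proof -
      have "sqrt (real n) * LJ * l0 \<le> real n * LJ * LJ"
        using assms LJ by (intro mult_mono) (auto simp: sn)
      then show ?thesis using assms by (simp add: pos_le_divide_eq power2_eq_square mult_ac)
    qed
    then have "(C + 2) / 2 * (sqrt (real n) * LJ) \<le> (C + 2) / 2 * (?q / l0)"
      using assms by (intro mult_left_mono) auto
    then have "kappa_eg_r n C LJ * rmax \<le> (C + 2) / 2 * (?q / l0) * rmax"
      using order_trans[OF e] assms(1) by (intro mult_right_mono)
    then show ?thesis by (simp add: mult_ac)
  qed
  have "kappa_eg_r n C LJ * Dmax + Jmax \<le>
      (C + 2) / 2 * (sqrt (real n) * LJ) * Dmax + Jmax / l0 * (sqrt (real n) * LJ)"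
    using mult_right_mono[OF e assms(5)] J' by (rule add_mono)
  also have "\<dots> = ((C + 2) / 2 * Dmax + Jmax / l0) * (sqrt (real n) * LJ)"
    by (simp only: distrib_right distrib_left mult_ac)
  finally have "(kappa_eg_r n C LJ * Dmax + Jmax)\<^sup>2 \<le> (((C + 2) / 2 * Dmax + Jmax / l0) * (sqrt (real n) * LJ))\<^sup>2"
    using e0 assms by (intro power_mono) auto
  then have T: "(kappa_eg_r n C LJ * Dmax + Jmax)\<^sup>2 \<le> ((C + 2) / 2 * Dmax + Jmax / l0)\<^sup>2 * ?q"
    unfolding power_mult_distrib[of _ "sqrt (real n) * LJ"] q .
  define a b t where "a = rmax * LJ" and "b = Jmax\<^sup>2" and "t = (kappa_eg_r n C LJ * Dmax + Jmax)\<^sup>2"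
  \<comment> \<open>This is \<open>kappa_ef - kappa_eg\<close>, so the maximum in
    \<open>kappa_d\<close> is \<open>kappa_ef\<close>.\<close>
  have "0 \<le> 1 / 2 * (a + b + t)" using assms LJ by (simp add: a_def b_def t_def)
  then have "kappa_d n C Dmax LJ rmax Jmax = 3 / 2 * a + 3 / 2 * b + kappa_eg_r n C LJ * rmax + 3 / 2 * t"
    unfolding kappa_d_def kappa_ef_def kappa_eg_def L_grad_def a_def[symmetric] b_def[symmetric] t_def[symmetric]
    by (simp add: add_divide_distrib)
  also have "\<dots> \<le> 3 / 2 * (rmax / l0 * ?q) + 3 / 2 * ((Jmax / l0)\<^sup>2 * ?q) +
      (C + 2) / 2 * (rmax / l0) * ?q + 3 / 2 * (((C + 2) / 2 * Dmax + Jmax / l0)\<^sup>2 * ?q)"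
    using r1 J2 er T unfolding a_def b_def t_def by linarith
  also have "\<dots> = (3 / 2 * (rmax / l0 + (Jmax / l0)\<^sup>2) + (C + 2) / 2 * (rmax / l0) +
      3 / 2 * ((C + 2) / 2 * Dmax + Jmax / l0)\<^sup>2) * real n * LJ\<^sup>2"
    by (simp only: distrib_right distrib_left mult.assoc)
  finally show ?thesis .
qed

theorem corollary3p18:
  fixes P :: params and c1 c3 D0 f0 d0 :: real
  assumes "1 / 2 \<le> c1" and "c1 \<le> 1"
    and "0 < c3"
    and "valid_params P c1 D0"
    and "0 < d0"
  shows
    "(\<exists>K. \<forall>(n::nat) (m::nat) (r :: real vec \<Rightarrow> real vec) (R :: run)
         (eps::real) (epsC::real) (kappaH::real) (LJ::real) (rmax::real) (Jmax::real) (C::real).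
        1 \<le> n \<and> r \<in> carrier_vec n \<rightarrow> carrier_vec m \<and>
        0 < eps \<and> eps \<le> 1 \<and> 0 < epsC \<and> c3 * eps \<le> epsC \<and>
        dfogn_run n m r P epsC D0 R \<and> lsq r (iterate R 0) = f0 \<and>
        cauchy_decrease n m r P c1 R \<and>
        smooth_bounded n m r P R LJ rmax Jmax \<and>
        1 \<le> kappaH \<and> (\<forall>k. mat_norm (Hmod n m r R k) \<le> kappaH) \<and>
        inverse_bound n (Lambda P) C \<and>
        d0 \<le> kappa_d n C (Delta_max P) LJ rmax Jmax \<longrightarrow>
        (\<exists>k. small_grad n r R eps k) \<and>
        real (num_iterations R (first_small n r R eps))
          \<le> K * kappaH * (kappa_d n C (Delta_max P) LJ rmax Jmax)\<^sup>2 / eps\<^sup>2 \<and>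
        real (num_evaluations P R (first_small n r R eps))
          \<le> K * kappaH * (kappa_d n C (Delta_max P) LJ rmax Jmax)\<^sup>2 * real n / eps\<^sup>2) \<and>
     (\<forall>rmax Jmax C l0. 0 \<le> rmax \<and> 0 \<le> Jmax \<and> 0 \<le> C \<and> 0 < l0 \<longrightarrow>
        (\<exists>K. \<forall>n LJ. 1 \<le> n \<and> l0 \<le> LJ \<longrightarrow>
           kappa_d n C (Delta_max P) LJ rmax Jmax \<le> K * real n * LJ\<^sup>2))"
proof (intro conjI)
  \<comment> \<open>The witness is fixed before the dimensions, \<open>r\<close> and the run, so it
    is built from the data of the theorem alone.\<close>
  let ?K = "3 * iteration_const P c1 c3 D0 f0 d0 + 2 / d0\<^sup>2"
  show "\<exists>K. \<forall>(n::nat) (m::nat) (r :: real vec \<Rightarrow> real vec) (R :: run)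
         (eps::real) (epsC::real) (kappaH::real) (LJ::real) (rmax::real) (Jmax::real) (C::real).
        1 \<le> n \<and> r \<in> carrier_vec n \<rightarrow> carrier_vec m \<and>
        0 < eps \<and> eps \<le> 1 \<and> 0 < epsC \<and> c3 * eps \<le> epsC \<and>
        dfogn_run n m r P epsC D0 R \<and> lsq r (iterate R 0) = f0 \<and>
        cauchy_decrease n m r P c1 R \<and>
        smooth_bounded n m r P R LJ rmax Jmax \<and>
        1 \<le> kappaH \<and> (\<forall>k. mat_norm (Hmod n m r R k) \<le> kappaH) \<and>
        inverse_bound n (Lambda P) C \<and>
        d0 \<le> kappa_d n C (Delta_max P) LJ rmax Jmax \<longrightarrow>
        (\<exists>k. small_grad n r R eps k) \<and>
        real (num_iterations R (first_small n r R eps))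
          \<le> K * kappaH * (kappa_d n C (Delta_max P) LJ rmax Jmax)\<^sup>2 / eps\<^sup>2 \<and>
        real (num_evaluations P R (first_small n r R eps))
          \<le> K * kappaH * (kappa_d n C (Delta_max P) LJ rmax Jmax)\<^sup>2 * real n / eps\<^sup>2"
  proof (intro exI[of _ ?K] allI impI)
    fix n m r R eps epsC kappaH LJ rmax Jmax C
    assume A: "1 \<le> n \<and> r \<in> carrier_vec n \<rightarrow> carrier_vec m \<and>
        0 < eps \<and> eps \<le> 1 \<and> 0 < epsC \<and> c3 * eps \<le> epsC \<and>
        dfogn_run n m r P epsC D0 R \<and> lsq r (iterate R 0) = f0 \<and>
        cauchy_decrease n m r P c1 R \<and>
        smooth_bounded n m r P R LJ rmax Jmax \<and>
        1 \<le> kappaH \<and> (\<forall>k. mat_norm (Hmod n m r R k) \<le> kappaH) \<and>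
        inverse_bound n (Lambda P) C \<and>
        d0 \<le> kappa_d n C (Delta_max P) LJ rmax Jmax"
    then interpret dfogn n m r P R c1 c3 D0 f0 d0 eps epsC kappaH LJ rmax Jmax C
      using assms by unfold_locales blast+
    show "(\<exists>k. small_grad n r R eps k) \<and>
        real (num_iterations R (first_small n r R eps))
          \<le> ?K * kappaH * (kappa_d n C (Delta_max P) LJ rmax Jmax)\<^sup>2 / eps\<^sup>2 \<and>
        real (num_evaluations P R (first_small n r R eps))
          \<le> ?K * kappaH * (kappa_d n C (Delta_max P) LJ rmax Jmax)\<^sup>2 * real n / eps\<^sup>2"
      by (intro conjI complexity)
  qed
  show "\<forall>rmax Jmax C l0. 0 \<le> rmax \<and> 0 \<le> Jmax \<and> 0 \<le> C \<and> 0 < l0 \<longrightarrow>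
      (\<exists>K. \<forall>n LJ. 1 \<le> n \<and> l0 \<le> LJ \<longrightarrow>
         kappa_d n C (Delta_max P) LJ rmax Jmax \<le> K * real n * LJ\<^sup>2)"
  proof (intro allI impI)
    fix rmax Jmax C l0 :: real
    assume "0 \<le> rmax \<and> 0 \<le> Jmax \<and> 0 \<le> C \<and> 0 < l0"
    moreover have "0 \<le> Delta_max P" using assms(4) unfolding valid_params_def by linarith
    ultimately show "\<exists>K. \<forall>n LJ. 1 \<le> n \<and> l0 \<le> LJ \<longrightarrow>
         kappa_d n C (Delta_max P) LJ rmax Jmax \<le> K * real n * LJ\<^sup>2"
      using kappa_d_le by blast
  qed
qed

end
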